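(* There is an algorithm and a function $s:(0,\infty)\to(0,1)$ with $s(c)=\Omega(\mathrm{poly}(1/c))$ (that is, there exist absolute constants $\delta>0$ and $K>0$ such that $s(c)\ge \delta\, c^{-K}$ for all $c\ge 1$) such that, given a $0$-$1$ integer linear program on $n$ variables and $m=cn$ constraints, the algorithm decides whether the program is feasible in time $2^{(1-s(c))n}$.
   Context: A $0$-$1$ integer linear program on $n$ variables and $m$ constraints is given by real coefficients $M_{i,j}$ ($1\le i\le n$, $1\le j\le m$) and a vector $r\in\mathbb{R}^m$. It is feasible if there is $x\in\{0,1\}^n$ with $\sum_{i=1}^n M_{i,j}x_i\ge r_j$ for every $j=1,\dots,m$. There is no objective function. Running time counts elementary operations, where arithmetic operations and comparisons on real numbers have unit cost. The parameter $c$ is treated as a constant (fixed as $n$ grows), and the time bound is understood up to a multiplicative constant that may depend on $c$. *)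

theory Defs
  imports Complex_Main
begin

section \<open>0-1 integer linear programs\<close>

text \<open>The program with coefficients \<open>M i j\<close> (variable \<open>i < n\<close>, constraint \<open>j < m\<close>) and
  right-hand side \<open>r\<close>. Indices start at 0; values of \<open>M\<close>, \<open>r\<close> outside the range are irrelevant.\<close>

definition ilp_feasible :: "nat \<Rightarrow> nat \<Rightarrow> (nat \<Rightarrow> nat \<Rightarrow> real) \<Rightarrow> (nat \<Rightarrow> real) \<Rightarrow> bool" where
  "ilp_feasible n m M r \<longleftrightarrow>
     (\<exists>x :: nat \<Rightarrow> real. (\<forall>i<n. x i \<in> {0, 1}) \<and> (\<forall>j<m. (\<Sum>i<n. M i j * x i) \<ge> r j))"


section \<open>The real RAM\<close>

text \<open>
  Algorithms are while-programs over a random access machine with two memories, one holding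
  natural numbers (used for control and addressing) and one holding exact real numbers; both are
  addressed by natural numbers, possibly computed at run time.

  The operations are chosen so that unit cost is reasonable. Natural numbers can only be added,
  subtracted and compared. Reals admit the four field operations and comparison, but there is no
  rounding or other transfer from reals to naturals except through the outcome of a comparison.
  The only real constants a program may contain are integers, so that a program cannot hide an
  infinite amount of advice in a constant.\<close>

datatype nexp =
    NConst nat
  | NGet nexp
  | NAdd nexp nexp
  | NSub nexp nexp

datatype rexp =
    RConst int
  | RGet nexp
  | RAdd rexp rexp
  | RSub rexp rexp
  | RMul rexp rexp
  | RDiv rexp rexp

datatype bexp =
    NLess nexp nexp
  | RLess rexp rexp
  | BNot bexp
  | BAnd bexp bexp

text \<open>\<open>NSet a e\<close> and \<open>RSet a e\<close> store the value of \<open>e\<close> at the address given by the value of \<open>a\<close>.\<close>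

datatype com =
    Skip
  | NSet nexp nexp
  | RSet nexp rexp
  | Seq com com
  | If bexp com com
  | While bexp com

type_synonym ram_state = "(nat \<Rightarrow> nat) \<times> (nat \<Rightarrow> real)"

text \<open>Subtraction of naturals is truncated at 0, and division of a real by 0 yields 0.\<close>

primrec nval :: "nexp \<Rightarrow> ram_state \<Rightarrow> nat" where
  "nval (NConst k) \<sigma> = k"
| "nval (NGet e) \<sigma> = fst \<sigma> (nval e \<sigma>)"
| "nval (NAdd e f) \<sigma> = nval e \<sigma> + nval f \<sigma>"
| "nval (NSub e f) \<sigma> = nval e \<sigma> - nval f \<sigma>"

primrec rval :: "rexp \<Rightarrow> ram_state \<Rightarrow> real" where
  "rval (RConst k) \<sigma> = of_int k"
| "rval (RGet e) \<sigma> = snd \<sigma> (nval e \<sigma>)"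
| "rval (RAdd e f) \<sigma> = rval e \<sigma> + rval f \<sigma>"
| "rval (RSub e f) \<sigma> = rval e \<sigma> - rval f \<sigma>"
| "rval (RMul e f) \<sigma> = rval e \<sigma> * rval f \<sigma>"
| "rval (RDiv e f) \<sigma> = rval e \<sigma> / rval f \<sigma>"

primrec bval :: "bexp \<Rightarrow> ram_state \<Rightarrow> bool" where
  "bval (NLess e f) \<sigma> \<longleftrightarrow> nval e \<sigma> < nval f \<sigma>"
| "bval (RLess e f) \<sigma> \<longleftrightarrow> rval e \<sigma> < rval f \<sigma>"
| "bval (BNot b) \<sigma> \<longleftrightarrow> \<not> bval b \<sigma>"
| "bval (BAnd b d) \<sigma> \<longleftrightarrow> bval b \<sigma> \<and> bval d \<sigma>"

text \<open>Every constant, memory access, arithmetic operation, comparison and connective that is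
  evaluated costs one unit.\<close>

primrec ncost :: "nexp \<Rightarrow> nat" where
  "ncost (NConst k) = 1"
| "ncost (NGet e) = 1 + ncost e"
| "ncost (NAdd e f) = 1 + ncost e + ncost f"
| "ncost (NSub e f) = 1 + ncost e + ncost f"

primrec rcost :: "rexp \<Rightarrow> nat" where
  "rcost (RConst k) = 1"
| "rcost (RGet e) = 1 + ncost e"
| "rcost (RAdd e f) = 1 + rcost e + rcost f"
| "rcost (RSub e f) = 1 + rcost e + rcost f"
| "rcost (RMul e f) = 1 + rcost e + rcost f"
| "rcost (RDiv e f) = 1 + rcost e + rcost f"

primrec bcost :: "bexp \<Rightarrow> nat" where
  "bcost (NLess e f) = 1 + ncost e + ncost f"
| "bcost (RLess e f) = 1 + rcost e + rcost f"
| "bcost (BNot b) = 1 + bcost b"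
| "bcost (BAnd b d) = 1 + bcost b + bcost d"

text \<open>\<open>exec p \<sigma> t \<tau>\<close>: started in state \<open>\<sigma>\<close>, the program \<open>p\<close> terminates in state \<open>\<tau>\<close> after exactly
  \<open>t\<close> elementary operations.\<close>

inductive exec :: "com \<Rightarrow> ram_state \<Rightarrow> nat \<Rightarrow> ram_state \<Rightarrow> bool" where
  Skip: "exec Skip \<sigma> 1 \<sigma>"
| NSet: "exec (NSet a e) \<sigma> (1 + ncost a + ncost e)
           ((fst \<sigma>)(nval a \<sigma> := nval e \<sigma>), snd \<sigma>)"
| RSet: "exec (RSet a e) \<sigma> (1 + ncost a + rcost e)
           (fst \<sigma>, (snd \<sigma>)(nval a \<sigma> := rval e \<sigma>))"
| Seq: "exec p \<sigma> t \<tau> \<Longrightarrow> exec q \<tau> u \<upsilon> \<Longrightarrow> exec (Seq p q) \<sigma> (t + u) \<upsilon>"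
| IfTrue: "bval b \<sigma> \<Longrightarrow> exec p \<sigma> t \<tau> \<Longrightarrow> exec (If b p q) \<sigma> (1 + bcost b + t) \<tau>"
| IfFalse: "\<not> bval b \<sigma> \<Longrightarrow> exec q \<sigma> t \<tau> \<Longrightarrow> exec (If b p q) \<sigma> (1 + bcost b + t) \<tau>"
| WhileFalse: "\<not> bval b \<sigma> \<Longrightarrow> exec (While b p) \<sigma> (1 + bcost b) \<sigma>"
| WhileTrue: "bval b \<sigma> \<Longrightarrow> exec p \<sigma> t \<tau> \<Longrightarrow> exec (While b p) \<tau> u \<upsilon> \<Longrightarrow>
     exec (While b p) \<sigma> (1 + bcost b + t + u) \<upsilon>"

inductive_cases exec_SkipE: "exec Skip \<sigma> t \<tau>"
inductive_cases exec_NSetE: "exec (NSet a e) \<sigma> t \<tau>"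
inductive_cases exec_RSetE: "exec (RSet a e) \<sigma> t \<tau>"
inductive_cases exec_SeqE: "exec (Seq p q) \<sigma> t \<tau>"
inductive_cases exec_IfE: "exec (If b p q) \<sigma> t \<tau>"
inductive_cases exec_WhileE: "exec (While b p) \<sigma> t \<tau>"

lemma exec_deterministic:
  assumes "exec p \<sigma> t \<tau>" "exec p \<sigma> t' \<tau>'"
  shows "t' = t \<and> \<tau>' = \<tau>"
  using assms
proof (induction arbitrary: t' \<tau>' rule: exec.induct)
  case Skip
  then show ?case by (elim exec_SkipE) simp
next
  case NSet
  then show ?case by (elim exec_NSetE) simp
next
  case RSet
  then show ?case by (elim exec_RSetE) simp
next
  case (Seq p \<sigma> t \<tau> q u \<upsilon>)
  from Seq.prems show ?case
  proof (rule exec_SeqE)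
    fix v \<rho> w
    assume *: "t' = v + w" "exec p \<sigma> v \<rho>" "exec q \<rho> w \<tau>'"
    have "v = t \<and> \<rho> = \<tau>" using *(2) by (rule Seq.IH(1))
    moreover from this *(3) have "w = u \<and> \<tau>' = \<upsilon>" by (intro Seq.IH(2)) simp
    ultimately show ?thesis using *(1) by simp
  qed
next
  case (IfTrue b \<sigma> p t \<tau> q)
  from IfTrue.prems show ?case
  proof (rule exec_IfE)
    fix v
    assume *: "t' = Suc (bcost b + v)" "exec p \<sigma> v \<tau>'"
    have "v = t \<and> \<tau>' = \<tau>" using *(2) by (rule IfTrue.IH)
    with *(1) show ?thesis by simp
  qed (use IfTrue.hyps in blast)+
next
  case (IfFalse b \<sigma> q t \<tau> p)
  from IfFalse.prems show ?case
  proof (rule exec_IfE)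
    fix v
    assume *: "t' = Suc (bcost b + v)" "exec q \<sigma> v \<tau>'"
    have "v = t \<and> \<tau>' = \<tau>" using *(2) by (rule IfFalse.IH)
    with *(1) show ?thesis by simp
  qed (use IfFalse.hyps in blast)+
next
  case (WhileFalse b \<sigma> p)
  from WhileFalse.prems show ?case
    by (rule exec_WhileE) (use WhileFalse.hyps in simp_all)
next
  case (WhileTrue b \<sigma> p t \<tau> u \<upsilon>)
  from WhileTrue.prems show ?case
  proof (rule exec_WhileE)
    assume "\<not> bval b \<sigma>"
    with WhileTrue.hyps show ?thesis by simp
  next
    fix v \<rho> w
    assume *: "t' = Suc (bcost b + v + w)" "exec p \<sigma> v \<rho>" "exec (While b p) \<rho> w \<tau>'"
    have "v = t \<and> \<rho> = \<tau>" using *(2) by (rule WhileTrue.IH(1))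
    moreover from this *(3) have "w = u \<and> \<tau>' = \<upsilon>" by (intro WhileTrue.IH(2)) simp
    ultimately show ?thesis using *(1) by simp
  qed
qed


section \<open>Deciding integer linear programs on the real RAM\<close>

text \<open>The input: \<open>n\<close> and \<open>m\<close> in cells 0 and 1 of the memory of naturals, and in the real memory
  the coefficients, \<open>M i j\<close> in cell \<open>i * m + j\<close>, followed by \<open>r\<close>. All other cells are 0.\<close>

definition ilp_input :: "nat \<Rightarrow> nat \<Rightarrow> (nat \<Rightarrow> nat \<Rightarrow> real) \<Rightarrow> (nat \<Rightarrow> real) \<Rightarrow> ram_state" where
  "ilp_input n m M r =
     ((\<lambda>a. if a = 0 then n else if a = 1 then m else 0),
      (\<lambda>a. if a < n * m then M (a div m) (a mod m)
           else if a < n * m + m then r (a - n * m) else 0))"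

text \<open>The answer is read off from cell 0 of the memory of naturals.\<close>

definition decides_ilp_within ::
    "com \<Rightarrow> nat \<Rightarrow> nat \<Rightarrow> (nat \<Rightarrow> nat \<Rightarrow> real) \<Rightarrow> (nat \<Rightarrow> real) \<Rightarrow> real \<Rightarrow> bool" where
  "decides_ilp_within p n m M r T \<longleftrightarrow>
     (\<exists>t \<tau>. exec p (ilp_input n m M r) t \<tau> \<and> real t \<le> T \<and>
            fst \<tau> 0 = (if ilp_feasible n m M r then 1 else 0))"

end

theory Submission
  imports Defs
begin

text \<open>
  Split the variables into a third and two thirds. The partial assignments of the first part give
  a list \<open>A\<close> of vectors \<open>r - \<Sum>\<^sub>i M\<^sub>i x\<^sub>i\<close>, those of the second part a list \<open>B\<close> of vectors
  \<open>\<Sum>\<^sub>i M\<^sub>i x\<^sub>i\<close>, and the program is feasible iff some \<open>a \<in> A\<close> lies coordinatewise below some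
  \<open>b \<in> B\<close>.

  Such a pair is searched by divide and conquer. A node \<open>(A, B, j, l)\<close> has all pairs in order in the
  coordinates below \<open>j\<close>. Take a pivot at the top \<open>1/e\<close> quantile of \<open>A\<close> in coordinate \<open>j\<close> and split
  both lists there. Pairs (high, low) are impossible, pairs (low, high) are in order in coordinate
  \<open>j\<close> and move on to \<open>j + 1\<close>, and pairs (low, low) and (high, high) cost one unit of the budget
  \<open>l\<close>; when it is exhausted, the node is solved by brute force. With \<open>x\<close> and \<open>y\<close> the fractions of
  high elements of \<open>A\<close> and of low elements of \<open>B\<close>, either both are at least \<open>1/e\<close>, and then the
  fraction \<open>x y\<close> of discarded pairs outweighs a discount \<open>1 + 1/(2e)\<close> per unit of budget, or both
  are at most \<open>1/e\<close>, and then the fraction of pairs that pay is so small that a factor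
  \<open>1 / (1 - 2/e\<^sup>2)\<close> per coordinate covers the discount. So brute force sees at most
  \<open>2\<^sup>n exp (4 m / e\<^sup>2 - l / (4 e))\<close> pairs from the root. With \<open>q\<close> about \<open>c\<close>, \<open>l = n / (100 q)\<close>
  and \<open>e = 64 m / l\<close> the saving is of order \<open>n / q\<^sup>3\<close>, whereas the number of nodes is only
  \<open>2\<close> to a small multiple of \<open>n\<close>, because a path contains at most \<open>l\<close> paying steps.
\<close>

section \<open>Weakest preconditions with running time\<close>

text \<open>One terminating run is enough for a weakest precondition because \<open>exec\<close> is
  deterministic. The postcondition also sees the elapsed time, so cost and result are derived
  together.\<close>

definition wp :: "com \<Rightarrow> ram_state \<Rightarrow> (nat \<Rightarrow> ram_state \<Rightarrow> bool) \<Rightarrow> bool" where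
  "wp p \<sigma> Q \<longleftrightarrow> (\<exists>t \<tau>. exec p \<sigma> t \<tau> \<and> Q t \<tau>)"

lemma wp_mono: "wp p \<sigma> Q \<Longrightarrow> (\<And>t \<tau>. Q t \<tau> \<Longrightarrow> Q' t \<tau>) \<Longrightarrow> wp p \<sigma> Q'"
  unfolding wp_def by blast

lemma wp_Skip: "wp Skip \<sigma> Q = Q 1 \<sigma>"
  unfolding wp_def by (metis exec.Skip exec_deterministic)

lemma wp_NSet: "wp (NSet a e) (f, g) Q =
    Q (1 + ncost a + ncost e) (f(nval a (f, g) := nval e (f, g)), g)"
proof -
  have "exec (NSet a e) (f, g) (1 + ncost a + ncost e) (f(nval a (f, g) := nval e (f, g)), g)"
    using exec.NSet[of a e "(f, g)"] by simp
  then show ?thesis unfolding wp_def by (metis exec_deterministic)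
qed

lemma wp_RSet: "wp (RSet a e) (f, g) Q =
    Q (1 + ncost a + rcost e) (f, g(nval a (f, g) := rval e (f, g)))"
proof -
  have "exec (RSet a e) (f, g) (1 + ncost a + rcost e) (f, g(nval a (f, g) := rval e (f, g)))"
    using exec.RSet[of a e "(f, g)"] by simp
  then show ?thesis unfolding wp_def by (metis exec_deterministic)
qed

lemma wp_Seq: "wp (Seq p q) \<sigma> Q = wp p \<sigma> (\<lambda>t \<tau>. wp q \<tau> (\<lambda>u \<upsilon>. Q (t + u) \<upsilon>))"
  unfolding wp_def by (blast intro: exec.Seq elim: exec_SeqE)

lemma wp_SeqI:
  assumes "wp p \<sigma> R" and "\<And>t \<tau>. R t \<tau> \<Longrightarrow> wp q \<tau> (\<lambda>u \<upsilon>. Q (t + u) \<upsilon>)"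
  shows "wp (Seq p q) \<sigma> Q"
  unfolding wp_Seq by (rule wp_mono[OF assms])

lemma wp_If: "wp (If b p q) \<sigma> Q =
    (if bval b \<sigma> then wp p \<sigma> (\<lambda>t. Q (1 + bcost b + t)) else wp q \<sigma> (\<lambda>t. Q (1 + bcost b + t)))"
proof (cases "bval b \<sigma>")
  case True
  have "exec (If b p q) \<sigma> u \<tau> \<longleftrightarrow> (\<exists>t. u = 1 + bcost b + t \<and> exec p \<sigma> t \<tau>)" for u \<tau>
    using True exec.IfTrue[of b \<sigma> p _ \<tau> q] by (auto elim!: exec_IfE)
  with True show ?thesis unfolding wp_def by auto
next
  case False
  have "exec (If b p q) \<sigma> u \<tau> \<longleftrightarrow> (\<exists>t. u = 1 + bcost b + t \<and> exec q \<sigma> t \<tau>)" for u \<tau>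
    using False exec.IfFalse[of b \<sigma> q _ \<tau> p] by (auto elim!: exec_IfE)
  with False show ?thesis unfolding wp_def by auto
qed

text \<open>Kept out of \<open>wp_simps\<close>, where its right-hand side would unfold again
  without end.\<close>

lemma wp_While_unfold:
  "wp (While b p) \<sigma> Q \<longleftrightarrow>
    (if bval b \<sigma> then wp p \<sigma> (\<lambda>t \<tau>. wp (While b p) \<tau> (\<lambda>u \<upsilon>. Q (1 + bcost b + t + u) \<upsilon>))
     else Q (1 + bcost b) \<sigma>)"
proof (cases "bval b \<sigma>")
  case True
  show ?thesis
  proof
    assume "wp (While b p) \<sigma> Q"
    then obtain t \<tau> where *: "exec (While b p) \<sigma> t \<tau>" "Q t \<tau>" unfolding wp_def by blast
    from *(1) obtain v \<rho> w where "t = Suc (bcost b + v + w)" "exec p \<sigma> v \<rho>"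
        "exec (While b p) \<rho> w \<tau>"
      by (rule exec_WhileE) (use True in auto)
    with *(2) show "if bval b \<sigma> then wp p \<sigma> (\<lambda>t \<tau>. wp (While b p) \<tau> (\<lambda>u \<upsilon>. Q (1 + bcost b + t + u) \<upsilon>))
        else Q (1 + bcost b) \<sigma>"
      using True unfolding wp_def by (simp del: split_paired_Ex) blast
  next
    assume "if bval b \<sigma> then wp p \<sigma> (\<lambda>t \<tau>. wp (While b p) \<tau> (\<lambda>u \<upsilon>. Q (1 + bcost b + t + u) \<upsilon>))
        else Q (1 + bcost b) \<sigma>"
    with True show "wp (While b p) \<sigma> Q"
      unfolding wp_def by (simp del: split_paired_Ex) (meson exec.WhileTrue[simplified])
  qed
next
  case False
  then show ?thesis unfolding wp_def
    by (metis exec.WhileFalse exec_deterministic)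
qed

lemmas wp_simps = wp_Skip wp_NSet wp_RSet wp_Seq wp_If

text \<open>The real parameter of the invariant is a bound on the time still to be spent.\<close>

lemma wp_While_potential:
  assumes "I \<phi> \<sigma>"
    and nonneg: "\<And>\<phi> \<sigma>. I \<phi> \<sigma> \<Longrightarrow> 0 \<le> \<phi>"
    and step: "\<And>\<phi> \<sigma>. I \<phi> \<sigma> \<Longrightarrow> bval b \<sigma> \<Longrightarrow>
      wp p \<sigma> (\<lambda>t \<tau>. \<exists>\<psi>. I \<psi> \<tau> \<and> real (t + 1 + bcost b) + \<psi> \<le> \<phi>)"
  shows "wp (While b p) \<sigma> (\<lambda>t \<tau>. real t \<le> \<phi> + 1 + bcost b \<and> (\<exists>\<psi>. I \<psi> \<tau>) \<and> \<not> bval b \<tau>)"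
  using assms(1)
\<comment> \<open>Every round costs at least one unit, so the real potential drops by at least 1 and
  its rounded-up value strictly decreases.\<close>
proof (induction "nat \<lceil>\<phi>\<rceil>" arbitrary: \<phi> \<sigma> rule: less_induct)
  case less
  show ?case
  proof (cases "bval b \<sigma>")
    case True
    show ?thesis
      unfolding wp_While_unfold[of b p \<sigma>] if_P[OF True]
    proof (rule wp_mono[OF step[OF less.prems True]])
      fix t \<tau>
      assume "\<exists>\<psi>. I \<psi> \<tau> \<and> real (t + 1 + bcost b) + \<psi> \<le> \<phi>"
      then obtain \<psi> where \<psi>: "I \<psi> \<tau>" "real (t + 1 + bcost b) + \<psi> \<le> \<phi>" by blast
      have "0 \<le> \<psi>" using nonneg \<psi>(1) .
      then have "nat \<lceil>\<psi>\<rceil> < nat \<lceil>\<phi>\<rceil>" using \<psi>(2) by linarith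
      then show "wp (While b p) \<tau> (\<lambda>u \<upsilon>. real (1 + bcost b + t + u) \<le> \<phi> + 1 + real (bcost b) \<and>
          (\<exists>\<psi>. I \<psi> \<upsilon>) \<and> \<not> bval b \<upsilon>)"
        by (rule wp_mono[OF less.hyps[OF _ \<psi>(1)]]) (use \<psi>(2) in auto)
    qed
  next
    case False
    then show ?thesis
      unfolding wp_While_unfold[of b p \<sigma>] using less.prems nonneg[OF less.prems] by auto
  qed
qed

section \<open>Counting loops and loops over lists in memory\<close>

abbreviation V :: "nat \<Rightarrow> nexp" where "V k \<equiv> NGet (NConst k)"

definition For :: "nat \<Rightarrow> nexp \<Rightarrow> com \<Rightarrow> com" where
  "For i e p = Seq (NSet (NConst i) (NConst 0))
     (While (NLess (V i) e) (Seq p (NSet (NConst i) (NAdd (V i) (NConst 1)))))"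

text \<open>The bound \<open>e\<close> is evaluated again in every round, so the invariant must fix
  its value \<open>K\<close>. A round costs the body plus \<open>ncost e + 10\<close> for test and
  increment; the failing last test accounts for \<open>K + 1\<close>, and the initial assignment for
  3 of the 13.\<close>

lemma wp_For:
  assumes init: "I 0 (f(i := 0)) g"
    and bound: "\<And>k f g. k \<le> K \<Longrightarrow> I k f g \<Longrightarrow> f i = k \<Longrightarrow> nval e (f, g) = K"
    and step: "\<And>k f g. k < K \<Longrightarrow> I k f g \<Longrightarrow> f i = k \<Longrightarrow>
      wp p (f, g) (\<lambda>t \<tau>. t \<le> B \<and> fst \<tau> i = k \<and> I (Suc k) ((fst \<tau>)(i := Suc k)) (snd \<tau>))"
    and post: "\<And>t f g. I K f g \<Longrightarrow> f i = K \<Longrightarrow> t \<le> (K + 1) * (B + ncost e + 13) \<Longrightarrow> Q t (f, g)"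
  shows "wp (For i e p) (f, g) Q"
proof -
  let ?W = "While (NLess (V i) e) (Seq p (NSet (NConst i) (NAdd (V i) (NConst 1))))"
  have loop: "wp ?W (f, g) (\<lambda>t \<tau>. t \<le> (K - k + 1) * (B + ncost e + 10) \<and> I K (fst \<tau>) (snd \<tau>) \<and> fst \<tau> i = K)"
    if "I k f g" "f i = k" "k \<le> K" for k f g
    using that
  proof (induction "K - k" arbitrary: k f g)
    case 0
    then show ?case using bound[of k f g] by (subst wp_While_unfold) simp
  next
    case (Suc d)
    then have k: "k < K" by simp
    have c: "bval (NLess (V i) e) (f, g)" using bound[of k f g] Suc.prems k by simp
    show ?case
      unfolding wp_While_unfold[of _ _ "(f, g)"] if_P[OF c] wp_Seq
    proof (rule wp_mono[OF step[OF k Suc.prems(1,2)]])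
      fix t \<tau>
      assume a: "t \<le> B \<and> fst \<tau> i = k \<and> I (Suc k) ((fst \<tau>)(i := Suc k)) (snd \<tau>)"
      obtain f' g' where \<tau>: "\<tau> = (f', g')" by fastforce
      have d: "d = K - Suc k" using Suc.hyps(2) by simp
      have e: "(K - k + 1) * (B + ncost e + 10) = (K - Suc k + 1) * (B + ncost e + 10) + (B + ncost e + 10)"
      proof -
        have "K - k + 1 = Suc (K - Suc k + 1)" using k by simp
        then show ?thesis by (simp only: mult_Suc add.commute)
      qed
      have "wp ?W (f'(i := Suc k), g') (\<lambda>t \<tau>. t \<le> (K - Suc k + 1) * (B + ncost e + 10) \<and>
          I K (fst \<tau>) (snd \<tau>) \<and> fst \<tau> i = K)"
        by (rule Suc.hyps(1)[OF d]) (use a k \<tau> in auto)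
      then have "wp ?W (f'(i := Suc k), g') (\<lambda>ta \<upsilon>. 1 + bcost (NLess (V i) e) + (t + 6) + ta
          \<le> (K - k + 1) * (B + ncost e + 10) \<and> I K (fst \<upsilon>) (snd \<upsilon>) \<and> fst \<upsilon> i = K)"
        by (rule wp_mono) (use a e in auto)
      then show "wp (NSet (NConst i) (NAdd (V i) (NConst 1))) \<tau>
            (\<lambda>u \<upsilon>. wp ?W \<upsilon> (\<lambda>ua \<upsilon>. 1 + bcost (NLess (V i) e) + (t + u) + ua
             \<le> (K - k + 1) * (B + ncost e + 10) \<and> I K (fst \<upsilon>) (snd \<upsilon>) \<and> fst \<upsilon> i = K))"
        using a by (simp add: \<tau> wp_NSet)
    qed
  qed
  have "wp ?W (f(i := 0), g) (\<lambda>t \<tau>. t \<le> (K + 1) * (B + ncost e + 10) \<and> I K (fst \<tau>) (snd \<tau>) \<and> fst \<tau> i = K)"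
    using loop[of 0 "f(i := 0)" g] init by simp
  then have "wp ?W (f(i := 0), g) (\<lambda>t. Q (Suc (Suc (Suc t))))"
    by (rule wp_mono) (use post in \<open>auto simp: algebra_simps\<close>)
  then show ?thesis by (simp add: For_def wp_Seq wp_NSet)
qed

definition holds :: "(nat \<Rightarrow> nat) \<Rightarrow> nat \<Rightarrow> nat list \<Rightarrow> bool" where
  "holds f p xs \<longleftrightarrow> (\<forall>i<length xs. f (p + i) = xs ! i)"

lemma holds_Nil: "holds f p []"
  by (simp add: holds_def)

lemma holds_Cons: "holds f p (x # xs) \<longleftrightarrow> f p = x \<and> holds f (Suc p) xs"
  by (auto simp: holds_def nth_Cons' less_Suc_eq_0_disj)

lemma holds_append: "holds f p (xs @ ys) \<longleftrightarrow> holds f p xs \<and> holds f (p + length xs) ys"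
  by (induction xs arbitrary: p) (auto simp: holds_Nil holds_Cons)

lemma holds_cong: "(\<And>v. p \<le> v \<Longrightarrow> v < p + length xs \<Longrightarrow> f v = h v) \<Longrightarrow> holds f p xs = holds h p xs"
  by (simp add: holds_def)

definition ForList :: "nat \<Rightarrow> nat \<Rightarrow> nexp \<Rightarrow> nexp \<Rightarrow> com \<Rightarrow> com" where
  "ForList i x src len p = For i len (Seq (NSet (NConst x) (NGet (NAdd src (V i)))) p)"

text \<open>The body may write to memory, so \<open>bound\<close> asks in every round that the list
  is still intact at its address.\<close>

lemma wp_ForList:
  assumes init: "I 0 (f(i := 0)) g"
    and neq: "i \<noteq> x"
    and bound: "\<And>k f g. k \<le> length xs \<Longrightarrow> I k f g \<Longrightarrow> f i = k \<Longrightarrow>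
      nval len (f, g) = length xs \<and> nval src (f, g) = p0 \<and> holds f p0 xs"
    and step: "\<And>k f g. k < length xs \<Longrightarrow> I k f g \<Longrightarrow> f i = k \<Longrightarrow>
      wp p (f(x := xs ! k), g)
        (\<lambda>t \<tau>. t \<le> B \<and> fst \<tau> i = k \<and> I (Suc k) ((fst \<tau>)(i := Suc k)) (snd \<tau>))"
    and post: "\<And>t f g. I (length xs) f g \<Longrightarrow> f i = length xs \<Longrightarrow>
      t \<le> (length xs + 1) * (B + ncost src + ncost len + 19) \<Longrightarrow> Q t (f, g)"
  \<comment> \<open>Below, fetching the current element adds \<open>ncost src + 6\<close> to each
    round.\<close>
  shows "wp (ForList i x src len p) (f, g) Q"
  unfolding ForList_def
proof (rule wp_For[where I = I and K = "length xs" and B = "B + ncost src + 6"])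
  show "I 0 (f(i := 0)) g" by (rule init)
  show "nval len (f, g) = length xs" if "k \<le> length xs" "I k f g" "f i = k" for k f g
    using bound that by blast
  show "wp (Seq (NSet (NConst x) (NGet (NAdd src (V i)))) p) (f, g)
         (\<lambda>t \<tau>. t \<le> B + ncost src + 6 \<and> fst \<tau> i = k \<and> I (Suc k) ((fst \<tau>)(i := Suc k)) (snd \<tau>))"
    if k: "k < length xs" "I k f g" "f i = k" for k f g
  proof -
    have "nval src (f, g) = p0" "holds f p0 xs" using bound[of k f g] k by auto
    then have e: "f (nval src (f, g) + f i) = xs ! k" using k by (simp add: holds_def)
    show ?thesis
      by (simp add: wp_Seq wp_NSet e) (rule wp_mono[OF step[OF k]], simp)
  qed
  show "Q t (f, g)" if "I (length xs) f g" "f i = length xs"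
    "t \<le> (length xs + 1) * (B + ncost src + 6 + ncost len + 13)" for t f g
    using post[OF that(1,2)] that(3) by (simp add: algebra_simps)
qed

section \<open>Splitting a node\<close>

text \<open>
  Cells of the memory of naturals used as program variables (addresses from 100 on hold lists of
  pointers to vectors, a vector being \<open>m\<close> consecutive cells of the real memory):
  \<^item> 0 answer, 1 \<open>m\<close>, 2 \<open>n\<close>, 3 \<open>q\<close>, 4 initial budget, 5 \<open>e\<close>, 10 size of the first part;
  \<^item> 6 head and 7 tail of the queue of nodes, 8 first free real cell, 9 current row of \<open>M\<close>;
  \<^item> 11, 12 address and length of \<open>A\<close>; 13, 14 of \<open>B\<close>; 15 \<open>j\<close>; 16 \<open>l\<close>;
  \<^item> 17, 19, 21, 22 loop counters; 18, 20 current list elements; 25 pivot; 26 which way ties with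
    the pivot are split; 23, 24, 27, 28 scratch.
\<close>

lemma filter_take_Suc:
  "k < length xs \<Longrightarrow> filter P (take (Suc k) xs) = filter P (take k xs) @ (if P (xs ! k) then [xs ! k] else [])"
  by (simp add: take_Suc_conv_app_nth)

text \<open>Survivors are appended at the tail of the queue (cell 7), so the filtered list is
  written directly into the node under construction.\<close>

definition Filter :: "nexp \<Rightarrow> nexp \<Rightarrow> bexp \<Rightarrow> com" where
  "Filter src len test = ForList 19 20 src len
     (If test (Seq (NSet (V 7) (V 20)) (NSet (NConst 7) (NAdd (V 7) (NConst 1)))) Skip)"

text \<open>The input lies below the tail \<open>f 7\<close> and output goes to the tail, so the
  input is never overwritten. The value of \<open>test\<close> may depend only on the current
  element in cell 20 and on cells that the loop leaves alone.\<close>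

lemma wp_Filter:
  assumes xs: "holds f p xs" "f a = p" "f b = length xs" "p + length xs \<le> f 7" "100 \<le> p"
    and cells: "a \<notin> {7, 19, 20}" "a < 100" "b \<notin> {7, 19, 20}" "b < 100"
    and test: "\<And>h. (\<forall>v. v \<notin> {7, 19, 20} \<longrightarrow> v < f 7 \<longrightarrow> h v = f v) \<Longrightarrow> bval test (h, g) = P (h 20)"
    and cost: "bcost test \<le> 60"
    and post: "\<And>t h. t \<le> (length xs + 1) * 200 \<Longrightarrow> h 7 = f 7 + length (filter P xs) \<Longrightarrow>
      holds h (f 7) (filter P xs) \<Longrightarrow> (\<forall>v. v \<notin> {7, 19, 20} \<longrightarrow> v < f 7 \<longrightarrow> h v = f v) \<Longrightarrow> Q t (h, g)"
  shows "wp (Filter (V a) (V b) test) (f, g) Q"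
  unfolding Filter_def
proof (rule wp_ForList[where xs = xs and B = 80 and I = "\<lambda>k h g'. g' = g \<and>
    h 7 = f 7 + length (filter P (take k xs)) \<and> holds h (f 7) (filter P (take k xs)) \<and>
    (\<forall>v. v \<notin> {7, 19, 20} \<longrightarrow> v < f 7 \<longrightarrow> h v = f v)" and ?p0.0 = p])
  show "g = g \<and> (f(19 := 0)) 7 = f 7 + length (filter P (take 0 xs)) \<and>
    holds (f(19 := 0)) (f 7) (filter P (take 0 xs)) \<and>
    (\<forall>v. v \<notin> {7, 19, 20} \<longrightarrow> v < f 7 \<longrightarrow> (f(19 := 0)) v = f v)"
    by (simp add: holds_Nil)
next
  fix k h g'
  assume k: "k \<le> length xs" and I: "g' = g \<and>
    h 7 = f 7 + length (filter P (take k xs)) \<and> holds h (f 7) (filter P (take k xs)) \<and>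
    (\<forall>v. v \<notin> {7, 19, 20} \<longrightarrow> v < f 7 \<longrightarrow> h v = f v)"
  have "holds h p xs = holds f p xs"
    by (rule holds_cong) (use I xs in auto)
  then show "nval (V b) (h, g') = length xs \<and> nval (V a) (h, g') = p \<and> holds h p xs"
    using I xs cells by simp
next
  fix k h g'
  assume k: "k < length xs" "h 19 = k" and I: "g' = g \<and>
    h 7 = f 7 + length (filter P (take k xs)) \<and> holds h (f 7) (filter P (take k xs)) \<and>
    (\<forall>v. v \<notin> {7, 19, 20} \<longrightarrow> v < f 7 \<longrightarrow> h v = f v)"
  have b: "bval test (h(20 := xs ! k), g) = P (xs ! k)"
    using test[of "h(20 := xs ! k)"] I by simp
  \<comment> \<open>The two possible effects of a round on memory: an element appended here, an
    element skipped in 2.\<close>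
  have 1: "holds (h(20 := x, f 7 + d := y, 7 := z, 19 := w)) (f 7) (filter P (take k xs))"
    if "d = length (filter P (take k xs))" for x y z w d
    by (subst holds_cong[where h = h]) (use I xs(4,5) that in auto)
  have 2: "holds (h(20 := x, 19 := w)) (f 7) (filter P (take k xs))" for x w
    by (subst holds_cong[where h = h]) (use I xs(4,5) in auto)
  show "wp (If test (Seq (NSet (V 7) (V 20)) (NSet (NConst 7) (NAdd (V 7) (NConst 1)))) Skip)
     (h(20 := xs ! k), g') (\<lambda>t \<tau>. t \<le> 80 \<and> fst \<tau> 19 = k \<and> snd \<tau> = g \<and>
        ((fst \<tau>)(19 := Suc k)) 7 = f 7 + length (filter P (take (Suc k) xs)) \<and>
        holds ((fst \<tau>)(19 := Suc k)) (f 7) (filter P (take (Suc k) xs)) \<and>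
       (\<forall>v. v \<notin> {7, 19, 20} \<longrightarrow> v < f 7 \<longrightarrow> ((fst \<tau>)(19 := Suc k)) v = f v))"
    using I xs(4,5) cost b k
    by (auto simp: wp_simps filter_take_Suc[OF k(1)] holds_append holds_Cons holds_Nil 1 2)
next
  show "Q t (h, g')" if "g' = g \<and>
    h 7 = f 7 + length (filter P (take (length xs) xs)) \<and> holds h (f 7) (filter P (take (length xs) xs)) \<and>
    (\<forall>v. v \<notin> {7, 19, 20} \<longrightarrow> v < f 7 \<longrightarrow> h v = f v)"
   "t \<le> (length xs + 1) * (80 + ncost (V a) + ncost (V b) + 19)" for t h g'
    using that post[of t h] by simp
qed simp

text \<open>Each hit adds \<open>e\<close> (cell 5) instead of 1: the result is \<open>e\<close>
  times the count, and comparing a share with \<open>1/e\<close> becomes a comparison of naturals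
  without any multiplication.\<close>

definition Count :: "nat \<Rightarrow> nexp \<Rightarrow> nexp \<Rightarrow> bexp \<Rightarrow> com" where
  "Count c src len test = Seq (NSet (NConst c) (NConst 0)) (ForList 19 20 src len
     (If test (NSet (NConst c) (NAdd (V c) (V 5))) Skip))"

lemma wp_Count:
  assumes xs: "holds f p xs" "f a = p" "f b = length xs" "100 \<le> p"
    and cells: "a \<notin> {c, 19, 20}" "b \<notin> {c, 19, 20}" "c \<notin> {5, 19, 20}" "c < 100"
    and test: "\<And>h. (\<forall>v. v \<notin> {c, 19, 20} \<longrightarrow> h v = f v) \<Longrightarrow> bval test (h, g) = P (h 20)"
    and cost: "bcost test \<le> 60"
    and post: "\<And>t h. t \<le> (length xs + 1) * 200 \<Longrightarrow> h c = f 5 * length (filter P xs) \<Longrightarrow>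
      (\<forall>v. v \<notin> {c, 19, 20} \<longrightarrow> h v = f v) \<Longrightarrow> Q t (h, g)"
  shows "wp (Count c (V a) (V b) test) (f, g) Q"
  unfolding Count_def wp_Seq wp_NSet
proof (rule wp_ForList[where xs = xs and B = 80 and I = "\<lambda>k h g'. g' = g \<and>
    h c = f 5 * length (filter P (take k xs)) \<and> (\<forall>v. v \<notin> {c, 19, 20} \<longrightarrow> h v = f v)" and ?p0.0 = p])
  fix k h g'
  assume k: "k \<le> length xs" and I: "g' = g \<and> h c = f 5 * length (filter P (take k xs)) \<and>
    (\<forall>v. v \<notin> {c, 19, 20} \<longrightarrow> h v = f v)"
  have "holds h p xs = holds f p xs"
    by (rule holds_cong) (use I xs(4) cells in auto)
  then show "nval (V b) (h, g') = length xs \<and> nval (V a) (h, g') = p \<and> holds h p xs"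
    using I xs cells by simp
next
  fix k h g'
  assume k: "k < length xs" "h 19 = k" and I: "g' = g \<and> h c = f 5 * length (filter P (take k xs)) \<and>
    (\<forall>v. v \<notin> {c, 19, 20} \<longrightarrow> h v = f v)"
  have b: "bval test (h(20 := xs ! k), g) = P (xs ! k)"
    using test[of "h(20 := xs ! k)"] I by simp
  show "wp (If test (NSet (NConst c) (NAdd (V c) (V 5))) Skip)
     (h(20 := xs ! k), g') (\<lambda>t \<tau>. t \<le> 80 \<and> fst \<tau> 19 = k \<and> snd \<tau> = g \<and>
        ((fst \<tau>)(19 := Suc k)) c = f 5 * length (filter P (take (Suc k) xs)) \<and>
       (\<forall>v. v \<notin> {c, 19, 20} \<longrightarrow> ((fst \<tau>)(19 := Suc k)) v = f v))"
  proof -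
    have "h 5 = f 5" using I cells by simp
    moreover have "c \<noteq> 5" "c \<noteq> 19" "c \<noteq> 20" "20 \<noteq> c" "19 \<noteq> c" using cells by auto
    moreover have "g' = g" "h c = f 5 * length (filter P (take k xs))" "h 19 = k"
     "\<And>v. v \<noteq> c \<Longrightarrow> v \<noteq> 19 \<Longrightarrow> v \<noteq> 20 \<Longrightarrow> h v = f v" using I k by auto
    ultimately show ?thesis using cost b
      by (simp only: wp_simps filter_take_Suc[OF k(1)] distrib_left) simp
  qed
next
  show "Q (1 + ncost (NConst c) + ncost (NConst 0) + t) (h, g')" if "g' = g \<and>
    h c = f 5 * length (filter P (take (length xs) xs)) \<and>
    (\<forall>v. v \<notin> {c, 19, 20} \<longrightarrow> h v = f v)"
   "t \<le> (length xs + 1) * (80 + ncost (V a) + ncost (V b) + 19)" for t h g'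
    using that post[of "1 + ncost (NConst c) + ncost (NConst 0) + t" h] by simp
qed (use cells in auto)

abbreviation RL :: "nat \<Rightarrow> nat \<Rightarrow> bexp" where
  "RL x y \<equiv> RLess (RGet (NAdd (V x) (V 15))) (RGet (NAdd (V y) (V 15)))"

section \<open>Finding a quantile\<close>

definition Pivot :: com where
  "Pivot = ForList 17 18 (V 11) (V 12)
     (Seq (Count 23 (V 11) (V 12) (BNot (RL 20 18)))
     (Seq (Count 24 (V 11) (V 12) (RL 18 20))
       (If (BAnd (BNot (NLess (V 23) (V 12))) (NLess (V 24) (V 12)))
         (NSet (NConst 25) (V 18)) Skip)))"

text \<open>A top \<open>1/e\<close> quantile, multiplied out: a share of at least
  \<open>1/e\<close> lies weakly above \<open>p\<close>, a share below \<open>1/e\<close> strictly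
  above it. Both halves matter, since ties are placed on either side later.\<close>

definition is_pivot :: "nat \<Rightarrow> (nat \<Rightarrow> real) \<Rightarrow> nat list \<Rightarrow> nat \<Rightarrow> bool" where
  "is_pivot e v A p \<longleftrightarrow> length A \<le> e * length (filter (\<lambda>x. \<not> v x < v p) A) \<and>
     e * length (filter (\<lambda>x. v p < v x) A) < length A"

lemma finite_minimum: "finite S \<Longrightarrow> S \<noteq> {} \<Longrightarrow> \<exists>p\<in>S. \<forall>x\<in>S. v p \<le> (v x :: real)"
  using arg_min_if_finite[of S v] by (meson linorder_not_le)

text \<open>Take the largest value that still has a \<open>1/e\<close> share weakly above it; the
  minimum of \<open>A\<close> qualifies because \<open>e\<close> is at least 1. If too many elements
  were strictly above, the next larger value would qualify as well.\<close>

lemma pivot_exists: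
  assumes "A \<noteq> []" "1 \<le> e"
  shows "\<exists>p\<in>set A. is_pivot e v A p"
proof -
  let ?c = "\<lambda>p. length (filter (\<lambda>x. \<not> v x < v p) A)"
  let ?S = "{p \<in> set A. length A \<le> e * ?c p}"
  have fin: "finite ?S" by simp
  obtain q where q: "q \<in> set A" "\<And>x. x \<in> set A \<Longrightarrow> v q \<le> v x"
    using finite_minimum[of "set A" v] assms(1) by auto
  have "filter (\<lambda>x. \<not> v x < v q) A = A" using q(2) by (simp add: filter_id_conv leD)
  then have "q \<in> ?S" using q(1) assms(2) by simp
  then have "?S \<noteq> {}" by blast
  then obtain p where p: "p \<in> ?S" "\<And>x. x \<in> ?S \<Longrightarrow> v x \<le> v p"
    using finite_minimum[OF fin, of "\<lambda>x. - v x"] by auto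
  have "e * length (filter (\<lambda>x. v p < v x) A) < length A"
  proof (rule ccontr)
    assume c: "\<not> ?thesis"
    let ?H = "{x \<in> set A. v p < v x}"
    have "?H \<noteq> {}"
    proof
      assume "?H = {}"
      then have "filter (\<lambda>x. v p < v x) A = []" by (auto simp: filter_empty_conv)
      with c assms(1) show False by simp
    qed
    then obtain r where r: "r \<in> ?H" "\<And>x. x \<in> ?H \<Longrightarrow> v r \<le> v x"
      using finite_minimum[of ?H v] by auto
    \<comment> \<open>No value of \<open>A\<close> lies strictly between those of \<open>p\<close>
      and \<open>r\<close>, so being weakly above \<open>r\<close> means being strictly above
      \<open>p\<close>.\<close>
    have "filter (\<lambda>x. \<not> v x < v r) A = filter (\<lambda>x. v p < v x) A"
      by (rule filter_cong) (use r in force)+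
    then have "r \<in> ?S" using c r(1) by simp
    then show False using p(2) r(1) by force
  qed
  then show ?thesis using p(1) unfolding is_pivot_def by blast
qed

text \<open>Every element is tried with two counts, which is quadratic in the length of
  \<open>A\<close>. This is why \<open>A\<close> comes from only a third of the variables: its
  square then has the order of the length of \<open>B\<close>. Cell 25 keeps the last pivot
  met.\<close>

lemma wp_Pivot:
  assumes A: "holds f p A" "f 11 = p" "f 12 = length A" "100 \<le> p"
    and e: "f 5 = e" "1 \<le> e" and v: "v = (\<lambda>x. g (x + f 15))"
    and post: "\<And>t h. t \<le> 500 * (length A + 1)\<^sup>2 \<Longrightarrow>
      (A \<noteq> [] \<longrightarrow> h 25 \<in> set A \<and> is_pivot e v A (h 25)) \<Longrightarrow>
      (\<forall>v. v \<notin> {17, 18, 19, 20, 23, 24, 25} \<longrightarrow> h v = f v) \<Longrightarrow> Q t (h, g)"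
  shows "wp Pivot (f, g) Q"
  unfolding Pivot_def
proof (rule wp_ForList[where xs = A and B = "(length A + 1) * 400 + 60" and I = "\<lambda>k h g'. g' = g \<and>
    ((\<exists>x\<in>set (take k A). is_pivot e v A x) \<longrightarrow> h 25 \<in> set A \<and> is_pivot e v A (h 25)) \<and>
    (\<forall>v. v \<notin> {17, 18, 19, 20, 23, 24, 25} \<longrightarrow> h v = f v)" and ?p0.0 = p])
  fix k h g'
  assume k: "k \<le> length A" and I: "g' = g \<and>
    ((\<exists>x\<in>set (take k A). is_pivot e v A x) \<longrightarrow> h 25 \<in> set A \<and> is_pivot e v A (h 25)) \<and>
    (\<forall>v. v \<notin> {17, 18, 19, 20, 23, 24, 25} \<longrightarrow> h v = f v)"
  have "holds h p A = holds f p A"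
    by (rule holds_cong) (use I A(4) in auto)
  then show "nval (V 12) (h, g') = length A \<and> nval (V 11) (h, g') = p \<and> holds h p A"
    using I A by simp
next
  fix k h g'
  assume k: "k < length A" "h 17 = k" and I: "g' = g \<and>
    ((\<exists>x\<in>set (take k A). is_pivot e v A x) \<longrightarrow> h 25 \<in> set A \<and> is_pivot e v A (h 25)) \<and>
    (\<forall>v. v \<notin> {17, 18, 19, 20, 23, 24, 25} \<longrightarrow> h v = f v)"
  let ?x = "A ! k"
  let ?h = "h(18 := ?x)"
  have hA: "holds h' p A" if "\<forall>v. v \<notin> {17, 18, 19, 20, 23, 24, 25} \<longrightarrow> h' v = f v" for h'
    by (subst holds_cong[where h = f]) (use that A in auto)
  have ins: "set (take (Suc k) A) = insert ?x (set (take k A))"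
    using k by (simp add: take_Suc_conv_app_nth)
  have x: "?x \<in> set A" using k by simp
  show "wp (Seq (Count 23 (V 11) (V 12) (BNot (RL 20 18)))
         (Seq (Count 24 (V 11) (V 12) (RL 18 20))
           (If (BAnd (BNot (NLess (V 23) (V 12))) (NLess (V 24) (V 12))) (NSet (NConst 25) (V 18)) Skip)))
         (?h, g')
       (\<lambda>t \<tau>. t \<le> (length A + 1) * 400 + 60 \<and> fst \<tau> 17 = k \<and> snd \<tau> = g \<and>
           ((\<exists>x\<in>set (take (Suc k) A). is_pivot e v A x) \<longrightarrow>
             ((fst \<tau>)(17 := Suc k)) 25 \<in> set A \<and> is_pivot e v A (((fst \<tau>)(17 := Suc k)) 25)) \<and>
           (\<forall>v. v \<notin> {17, 18, 19, 20, 23, 24, 25} \<longrightarrow> ((fst \<tau>)(17 := Suc k)) v = f v))"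
    unfolding wp_Seq
  proof (rule wp_Count[where xs = A and p = p and P = "\<lambda>x. \<not> v x < v ?x"])
    show "holds ?h p A" by (rule hA) (use I in auto)
    show "bval (BNot (RL 20 18)) (h', g') = (\<not> v (h' 20) < v (A ! k))"
      if "\<forall>v. v \<notin> {23, 19, 20} \<longrightarrow> h' v = ?h v" for h'
      using that I v by simp
    fix t1 h1
    assume h1: "t1 \<le> (length A + 1) * 200"
      "h1 23 = ?h 5 * length (filter (\<lambda>x. \<not> v x < v ?x) A)"
      "\<forall>v. v \<notin> {23, 19, 20} \<longrightarrow> h1 v = ?h v"
    show "wp (Count 24 (V 11) (V 12) (RL 18 20)) (h1, g')
            (\<lambda>t2 \<tau>. wp (If (BAnd (BNot (NLess (V 23) (V 12))) (NLess (V 24) (V 12))) (NSet (NConst 25) (V 18)) Skip) \<tau>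
                     (\<lambda>t3 \<tau>. t1 + (t2 + t3) \<le> (length A + 1) * 400 + 60 \<and> fst \<tau> 17 = k \<and> snd \<tau> = g \<and>
           ((\<exists>x\<in>set (take (Suc k) A). is_pivot e v A x) \<longrightarrow>
             ((fst \<tau>)(17 := Suc k)) 25 \<in> set A \<and> is_pivot e v A (((fst \<tau>)(17 := Suc k)) 25)) \<and>
           (\<forall>v. v \<notin> {17, 18, 19, 20, 23, 24, 25} \<longrightarrow> ((fst \<tau>)(17 := Suc k)) v = f v)))"
    proof (rule wp_Count[where xs = A and p = p and P = "\<lambda>x. v ?x < v x"])
      show "holds h1 p A" by (rule hA) (use I h1 in auto)
      show "bval (RL 18 20) (h', g') = (v ?x < v (h' 20))"
        if "\<forall>v. v \<notin> {24, 19, 20} \<longrightarrow> h' v = h1 v" for h'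
        using that I v h1 by simp
      fix t2 h2
      assume h2: "t2 \<le> (length A + 1) * 200"
        "h2 24 = h1 5 * length (filter (\<lambda>x. v ?x < v x) A)"
        "\<forall>v. v \<notin> {24, 19, 20} \<longrightarrow> h2 v = h1 v"
      have [simp]: "h2 23 = e * length (filter (\<lambda>x. \<not> v x < v ?x) A)"
        "h2 24 = e * length (filter (\<lambda>x. v ?x < v x) A)" "h2 12 = length A" "h2 18 = ?x" "h2 17 = k"
        "h2 25 = h 25"
        using h1 h2 I A e k by simp_all
      have fr: "h2 v = f v" if "v \<notin> {17, 18, 19, 20, 23, 24, 25}" for v
        using h1 h2 I that by simp
      have "is_pivot e v A ?x \<longleftrightarrow> \<not> h2 23 < h2 12 \<and> h2 24 < h2 12"
        by (simp add: is_pivot_def linorder_not_less)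
      then show "wp (If (BAnd (BNot (NLess (V 23) (V 12))) (NLess (V 24) (V 12))) (NSet (NConst 25) (V 18)) Skip) (h2, g')
         (\<lambda>t3 \<tau>. t1 + (t2 + t3) \<le> (length A + 1) * 400 + 60 \<and> fst \<tau> 17 = k \<and> snd \<tau> = g \<and>
           ((\<exists>x\<in>set (take (Suc k) A). is_pivot e v A x) \<longrightarrow>
             ((fst \<tau>)(17 := Suc k)) 25 \<in> set A \<and> is_pivot e v A (((fst \<tau>)(17 := Suc k)) 25)) \<and>
           (\<forall>v. v \<notin> {17, 18, 19, 20, 23, 24, 25} \<longrightarrow> ((fst \<tau>)(17 := Suc k)) v = f v))"
        using I h1(1) h2(1) x by (simp add: wp_simps ins fr del: insert_iff) (auto simp: fr)
    qed (use I A h1 in simp_all)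
  qed (use I A in simp_all)
next
  fix t h g'
  assume I: "g' = g \<and>
    ((\<exists>x\<in>set (take (length A) A). is_pivot e v A x) \<longrightarrow> h 25 \<in> set A \<and> is_pivot e v A (h 25)) \<and>
    (\<forall>v. v \<notin> {17, 18, 19, 20, 23, 24, 25} \<longrightarrow> h v = f v)"
    and t: "t \<le> (length A + 1) * ((length A + 1) * 400 + 60 + ncost (V 11) + ncost (V 12) + 19)"
  have "t \<le> 500 * (length A + 1)\<^sup>2"
    using t by (simp add: power2_eq_square algebra_simps)
  moreover have "A \<noteq> [] \<longrightarrow> h 25 \<in> set A \<and> is_pivot e v A (h 25)"
    using I pivot_exists[of A e v] e by auto
  ultimately show "Q t (h, g')" using I post by simp
qed auto

section \<open>Nodes and the construction of a child\<close>

type_synonym node = "nat list \<times> nat list \<times> nat \<times> nat"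

text \<open>The lengths in the header make a block self-delimiting, so the queue is a plain
  concatenation of blocks.\<close>

fun enc :: "node \<Rightarrow> nat list" where
  "enc (A, B, j, l) = [j, l, length A, length B] @ A @ B"

text \<open>The lengths of the filtered lists are known only afterwards. Hence four header cells are
  reserved first, and the lengths are filled in later as differences of tail positions; cell 28
  keeps the start of the block and cell 27 the start of its second list.\<close>

definition Child :: "nexp \<Rightarrow> nexp \<Rightarrow> bexp \<Rightarrow> bexp \<Rightarrow> com" where
  "Child j l a b =
    Seq (Seq (NSet (NConst 28) (V 7))
        (Seq (NSet (V 7) j)
        (Seq (NSet (NAdd (V 7) (NConst 1)) l)
             (NSet (NConst 7) (NAdd (V 7) (NConst 4))))))
   (Seq (Filter (V 11) (V 12) a)
   (Seq (Seq (NSet (NAdd (V 28) (NConst 2)) (NSub (V 7) (NAdd (V 28) (NConst 4))))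
             (NSet (NConst 27) (V 7)))
   (Seq (Filter (V 13) (V 14) b)
        (NSet (NAdd (V 28) (NConst 3)) (NSub (V 7) (V 27))))))"

text \<open>The hypotheses on \<open>j\<close> and \<open>l\<close> mention updated states because
  \<open>j\<close> is evaluated after the write to cell 28, and \<open>l\<close> after the first
  header cell has been written too.\<close>

lemma wp_Child:
  assumes A: "holds f p A" "f 11 = p" "f 12 = length A" "100 \<le> p" "p + length A \<le> f 7"
    and B: "holds f q B" "f 13 = q" "f 14 = length B" "100 \<le> q" "q + length B \<le> f 7"
    and jl: "nval j (f(28 := f 7), g) = j0"
      "nval l (f(28 := f 7, f 7 := j0), g) = l0" "ncost j \<le> 10" "ncost l \<le> 10"
    and test: "\<And>h. (\<forall>v. v \<notin> {7, 19, 20, 27, 28} \<longrightarrow> v < 100 \<longrightarrow> h v = f v) \<Longrightarrow>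
      bval a (h, g) = P (h 20) \<and> bval b (h, g) = P' (h 20)"
    and cost: "bcost a \<le> 60" "bcost b \<le> 60"
    and post: "\<And>t h. t \<le> (length A + length B + 3) * 200 \<Longrightarrow>
      h 7 = f 7 + length (enc (filter P A, filter P' B, j0, l0)) \<Longrightarrow>
      holds h (f 7) (enc (filter P A, filter P' B, j0, l0)) \<Longrightarrow>
      (\<forall>v. v \<notin> {7, 19, 20, 27, 28} \<longrightarrow> v < f 7 \<longrightarrow> h v = f v) \<Longrightarrow> Q t (h, g)"
  shows "wp (Child j l a b) (f, g) Q"
proof -
  let ?c = "f 7"
  have c: "100 \<le> ?c" using A by simp
  define f1 where "f1 = f(28 := ?c, ?c := j0, Suc ?c := l0, 7 := ?c + 4)"
  have f17: "f1 7 = ?c + 4" by (simp add: f1_def)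
  have hA: "holds h p A" if "\<forall>v. v \<notin> {7, 19, 20, 27, 28} \<longrightarrow> v < ?c \<longrightarrow> h v = f v" for h
    by (subst holds_cong[where h = f]) (use that A in auto)
  have hB: "holds h q B" if "\<forall>v. v \<notin> {7, 19, 20, 27, 28} \<longrightarrow> v < ?c \<longrightarrow> h v = f v" for h
    by (subst holds_cong[where h = f]) (use that B in auto)
  show ?thesis
    unfolding Child_def
  proof (rule wp_SeqI[where R = "\<lambda>t \<tau>. t \<le> 40 \<and> \<tau> = (f1, g)"], goal_cases)
    case 1
    show ?case using jl c by (simp add: wp_simps f1_def)
  next
    case (2 t0 \<tau>0)
    then have t0: "t0 \<le> 40" and \<tau>0: "\<tau>0 = (f1, g)" by auto
    show ?case
      unfolding \<tau>0
    proof (rule wp_SeqI, rule wp_Filter[where a = 11 and b = 12 and xs = A and p = p and P = P and g = g])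
      show "holds f1 p A" by (rule hA) (use c in \<open>auto simp: f1_def\<close>)
      show "bval a (h, g) = P (h 20)" if "\<forall>v. v \<notin> {7, 19, 20} \<longrightarrow> v < f1 7 \<longrightarrow> h v = f1 v" for h
        by (rule test[THEN conjunct1]) (use that c in \<open>auto simp: f1_def\<close>)
      show "t \<le> (length A + 1) * 200 \<Longrightarrow> h 7 = f1 7 + length (filter P A) \<Longrightarrow>
        holds h (f1 7) (filter P A) \<Longrightarrow> (\<forall>v. v \<notin> {7, 19, 20} \<longrightarrow> v < f1 7 \<longrightarrow> h v = f1 v) \<Longrightarrow>
        (\<lambda>t \<tau>. \<exists>h1. \<tau> = (h1, g) \<and> t \<le> (length A + 1) * 200 \<and> h1 7 = f1 7 + length (filter P A) \<and>
          holds h1 (f1 7) (filter P A) \<and> (\<forall>v. v \<notin> {7, 19, 20} \<longrightarrow> v < f1 7 \<longrightarrow> h1 v = f1 v)) t (h, g)" for t h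
        by simp
    next
      fix t1 \<tau>1
      assume "\<exists>h1. \<tau>1 = (h1, g) \<and> t1 \<le> (length A + 1) * 200 \<and> h1 7 = f1 7 + length (filter P A) \<and>
          holds h1 (f1 7) (filter P A) \<and> (\<forall>v. v \<notin> {7, 19, 20} \<longrightarrow> v < f1 7 \<longrightarrow> h1 v = f1 v)"
      then obtain h1 where \<tau>1: "\<tau>1 = (h1, g)" and h1: "t1 \<le> (length A + 1) * 200"
        "h1 7 = f1 7 + length (filter P A)" "holds h1 (f1 7) (filter P A)"
        "\<forall>v. v \<notin> {7, 19, 20} \<longrightarrow> v < f1 7 \<longrightarrow> h1 v = f1 v" by blast
      have [simp]: "h1 28 = ?c" "h1 7 = ?c + 4 + length (filter P A)" "h1 13 = q" "h1 14 = length B"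
        using h1 c B by (simp_all add: f1_def)
      have fr1: "h1 v = f v" if "v \<notin> {7, 19, 20, 27, 28}" "v < ?c" for v
        using h1(4) that by (simp add: f1_def)
      define f2 where "f2 = h1(?c + 2 := length (filter P A), 27 := ?c + 4 + length (filter P A))"
      have fr2: "f2 v = f v" if "v \<notin> {7, 19, 20, 27, 28}" "v < ?c" for v
        using fr1 that by (simp add: f2_def)
      have f27: "f2 7 = ?c + 4 + length (filter P A)" "f2 28 = ?c" "f2 27 = ?c + 4 + length (filter P A)"
        "f2 ?c = j0" "f2 (Suc ?c) = l0" "f2 (Suc (Suc ?c)) = length (filter P A)"
        using c h1 by (simp_all add: f2_def f1_def)
      have f2A: "holds f2 (?c + 4) (filter P A)"
        by (subst holds_cong[where h = h1]) (use h1(3) c in \<open>auto simp: f2_def f1_def\<close>)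
      show "wp (Seq (Seq (NSet (NAdd (V 28) (NConst 2)) (NSub (V 7) (NAdd (V 28) (NConst 4))))
             (NSet (NConst 27) (V 7)))
           (Seq (Filter (V 13) (V 14) b) (NSet (NAdd (V 28) (NConst 3)) (NSub (V 7) (V 27)))))
         \<tau>1 (\<lambda>u. Q (t0 + (t1 + u)))"
        unfolding \<tau>1
      proof (rule wp_SeqI[where R = "\<lambda>t \<tau>. t \<le> 20 \<and> \<tau> = (f2, g)"], goal_cases)
        case 1
        show ?case using c by (simp add: wp_simps f2_def)
      next
        case (2 t2 \<tau>2)
        then have t2: "t2 \<le> 20" and \<tau>2: "\<tau>2 = (f2, g)" by auto
        show ?case
          unfolding \<tau>2 wp_Seq
        proof (rule wp_Filter[where xs = B and p = q and P = P'])
          show "holds f2 q B" by (rule hB) (use c fr2 in auto)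
          show "bval b (h, g) = P' (h 20)" if "\<forall>v. v \<notin> {7, 19, 20} \<longrightarrow> v < f2 7 \<longrightarrow> h v = f2 v" for h
            by (rule test[THEN conjunct2]) (use that c fr2 f27 in auto)
          fix t3 h2
          assume h2: "t3 \<le> (length B + 1) * 200" "h2 7 = f2 7 + length (filter P' B)"
            "holds h2 (f2 7) (filter P' B)" "\<forall>v. v \<notin> {7, 19, 20} \<longrightarrow> v < f2 7 \<longrightarrow> h2 v = f2 v"
          have [simp]: "h2 28 = ?c" "h2 27 = ?c + 4 + length (filter P A)"
            "h2 7 = ?c + 4 + length (filter P A) + length (filter P' B)"
            using h2 c f27 by simp_all
          define h where "h = h2(?c + 3 := length (filter P' B))"
          have e: "h ?c = j0" "h (Suc ?c) = l0" "h (Suc (Suc ?c)) = length (filter P A)"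
             "h (Suc (Suc (Suc ?c))) = length (filter P' B)"
            using h2(4) f27 c by (auto simp: h_def)
          have eA: "holds h (?c + 4) (filter P A)"
            by (subst holds_cong[where h = f2]) (use h2(4) f2A f27 c in \<open>auto simp: h_def\<close>)
          have eB: "holds h (?c + 4 + length (filter P A)) (filter P' B)"
            by (subst holds_cong[where h = h2]) (use h2(3) f27 c in \<open>auto simp: h_def\<close>)
          have Qu: "Q u (h, g)" if u: "u = t0 + (t1 + (t2 + (t3 + 10)))" for u
          proof (rule post)
            show "u \<le> (length A + length B + 3) * 200"
              using h1(1) h2(1) t0 t2 u by simp
            show "holds h ?c (enc (filter P A, filter P' B, j0, l0))"
              using e eA eB by (simp add: holds_Cons holds_append numeral_eq_Suc)
            show "\<forall>v. v \<notin> {7, 19, 20, 27, 28} \<longrightarrow> v < ?c \<longrightarrow> h v = f v"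
              using h2(4) fr2 f27 by (simp add: h_def)
          qed (use c in \<open>simp add: h_def\<close>)
          have "Q (t0 + (t1 + (t2 + (t3 + (1 + ncost (NAdd (V 28) (NConst 3)) + ncost (NSub (V 7) (V 27))))))) (h, g)"
            by (rule Qu) simp
          moreover have "h2(nval (NAdd (V 28) (NConst 3)) (h2, g) := nval (NSub (V 7) (V 27)) (h2, g)) = h"
            by (simp add: h_def)
          ultimately show "wp (NSet (NAdd (V 28) (NConst 3)) (NSub (V 7) (V 27))) (h2, g)
             (\<lambda>u \<upsilon>. Q (t0 + (t1 + (t2 + (t3 + u)))) \<upsilon>)"
            by (simp only: wp_NSet)
        qed (use c B cost fr2 f27 in \<open>auto simp: f2_def\<close>)
      qed
    qed (use c A cost in \<open>auto simp: f1_def\<close>)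
  qed
qed

section \<open>Comparing all pairs\<close>

definition Brute :: com where
  "Brute = ForList 17 18 (V 11) (V 12) (ForList 19 20 (V 13) (V 14)
    (Seq (NSet (NConst 22) (NConst 1))
    (Seq (For 21 (V 1) (If (RLess (RGet (NAdd (V 20) (V 21))) (RGet (NAdd (V 18) (V 21))))
         (NSet (NConst 22) (NConst 0)) Skip))
      (If (NLess (NConst 0) (V 22)) (NSet (NConst 0) (NConst 1)) Skip))))"

text \<open>With the number of coordinates as a parameter, \<open>dom j\<close> also expresses the
  order in the coordinates settled so far.\<close>

definition dom :: "nat \<Rightarrow> (nat \<Rightarrow> real) \<Rightarrow> nat \<Rightarrow> nat \<Rightarrow> bool" where
  "dom m g x y \<longleftrightarrow> (\<forall>i<m. g (x + i) \<le> g (y + i))"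

lemma wp_Brute:
  assumes A: "holds f p A" "f 11 = p" "f 12 = length A" "100 \<le> p"
    and B: "holds f q B" "f 13 = q" "f 14 = length B" "100 \<le> q"
    and m: "f 1 = m"
    and post: "\<And>t h. t \<le> (length A + 1) * ((length B + 1) * ((m + 1) * 110)) \<Longrightarrow>
      h 0 = (if \<exists>x\<in>set A. \<exists>y\<in>set B. dom m g x y then 1 else f 0) \<Longrightarrow>
      (\<forall>v. v \<notin> {0, 17, 18, 19, 20, 21, 22} \<longrightarrow> h v = f v) \<Longrightarrow> Q t (h, g)"
  shows "wp Brute (f, g) Q"
  unfolding Brute_def
proof (rule wp_ForList[where xs = A and ?p0.0 = p and B = "(length B + 1) * ((m + 1) * 80)" and
    I = "\<lambda>k h g'. g' = g \<and> h 0 = (if \<exists>x\<in>set (take k A). \<exists>y\<in>set B. dom m g x y then 1 else f 0) \<and>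
      (\<forall>v. v \<notin> {0, 17, 18, 19, 20, 21, 22} \<longrightarrow> h v = f v)"], goal_cases)
  case (3 k h g')
  have "holds h p A = holds f p A"
    by (rule holds_cong) (use 3 A(4) in auto)
  then show ?case using 3 A by simp
next
  case (4 k h1 g')
  let ?x = "A ! k"
  let ?h1 = "h1(18 := ?x)"
  have g': "g' = g" using 4 by simp
  have h1: "h1 v = f v" if "v \<notin> {0, 17, 18, 19, 20, 21, 22}" for v using 4 that by simp
  show ?case
    unfolding g'
  proof (rule wp_ForList[where xs = B and ?p0.0 = q and B = "(m + 1) * 55" and
    I = "\<lambda>i h g'. g' = g \<and> h 0 = (if \<exists>y\<in>set (take i B). dom m g ?x y then 1 else h1 0) \<and>
      (\<forall>v. v \<notin> {0, 19, 20, 21, 22} \<longrightarrow> h v = ?h1 v)"], goal_cases)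
    case (3 i h g')
    have "holds h q B = holds f q B"
      by (rule holds_cong) (use 3 B(4) h1 in auto)
    then show ?case using 3 B h1 by simp
  next
    case (4 i h2 g')
    let ?y = "B ! i"
    have g': "g' = g" using 4 by simp
    have h2: "h2 v = ?h1 v" if "v \<notin> {0, 19, 20, 21, 22}" for v using 4 that by simp
    have h20: "h2 0 = (if \<exists>y\<in>set (take i B). dom m g ?x y then 1 else h1 0)" "h2 19 = i" using 4 by simp_all
    have ins: "set (take (Suc i) B) = insert ?y (set (take i B))"
      using 4(1) by (simp add: take_Suc_conv_app_nth)
    show ?case
      unfolding g'
    proof (rule wp_SeqI[where R = "\<lambda>t \<tau>. t = 3 \<and> \<tau> = (h2(20 := ?y, 22 := 1), g)"], simp add: wp_simps)
      fix t :: nat and \<tau> :: ram_state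
      assume "t = 3 \<and> \<tau> = (h2(20 := ?y, 22 := 1), g)"
      then have t: "t = 3" and \<tau>: "\<tau> = (h2(20 := ?y, 22 := 1), g)" by auto
      show "wp (Seq (For 21 (V 1) (If (RLess (RGet (NAdd (V 20) (V 21))) (RGet (NAdd (V 18) (V 21))))
            (NSet (NConst 22) (NConst 0)) Skip))
          (If (NLess (NConst 0) (V 22)) (NSet (NConst 0) (NConst 1)) Skip)) \<tau>
          (\<lambda>u \<tau>. t + u \<le> (m + 1) * 55 \<and> fst \<tau> 19 = i \<and> snd \<tau> = g \<and>
            ((fst \<tau>)(19 := Suc i)) 0 = (if \<exists>y\<in>set (take (Suc i) B). dom m g ?x y then 1 else h1 0) \<and>
            (\<forall>v. v \<notin> {0, 19, 20, 21, 22} \<longrightarrow> ((fst \<tau>)(19 := Suc i)) v = ?h1 v))"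
        unfolding wp_Seq \<tau>
      proof (rule wp_For[where K = m and B = 20 and I = "\<lambda>j h g'. g' = g \<and>
          h 22 = (if \<forall>i<j. g (?x + i) \<le> g (?y + i) then 1 else 0) \<and>
          (\<forall>v. v \<notin> {21, 22} \<longrightarrow> h v = (h2(20 := ?y)) v)"], goal_cases)
        case (2 j h3 g')
        then show ?case using h2 h1 m by simp
      next
        case (3 j h3 g')
        then have "h3 18 = ?x" using h2 by simp
        then show ?case using 3 by (auto simp: wp_simps less_Suc_eq not_less)
      next
        case (4 t' h3 g')
        have "h3 22 = (if dom m g ?x ?y then 1 else 0)" using 4 by (simp add: dom_def)
        moreover have "h3 0 = h2 0" "h3 19 = h2 19" using 4 by simp_all
        ultimately show ?case using 4 h2 h20 t
          by (simp add: wp_simps ins)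
      qed simp
    qed
  next
    case (5 t h g')
    have ins: "set (take (Suc k) A) = insert ?x (set (take k A))"
      using 4(1) by (simp add: take_Suc_conv_app_nth)
    have "t \<le> (length B + 1) * ((m + 1) * 80)" using 5(3) by (simp add: algebra_simps)
    then show ?case using 5 4 h1 by (simp add: ins)
  qed (use h1 in auto)
next
  case (5 t h g')
  have "t \<le> (length A + 1) * ((length B + 1) * ((m + 1) * 110))" using 5(3)
    by (simp add: algebra_simps)
  then show ?case using 5 post by simp
qed auto

text \<open>Elements equal to the pivot are high iff \<open>s\<close> holds. This is chosen so that the fractions of high
  elements of \<open>A\<close> and of low elements of \<open>B\<close> lie on the same side of \<open>1/e\<close>.\<close>

definition hi :: "bool \<Rightarrow> (nat \<Rightarrow> real) \<Rightarrow> nat \<Rightarrow> nat \<Rightarrow> bool" where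
  "hi s v p x \<longleftrightarrow> v p < v x \<or> s \<and> \<not> v x < v p"

text \<open>Ties in \<open>B\<close> are always high, while \<open>s\<close> decides about ties in
  \<open>A\<close>. In both cases a (low, high) pair is weakly in order at \<open>j\<close>, and a
  (high, low) pair violates the order strictly, so that combination is dropped.\<close>

fun children :: "nat \<Rightarrow> (nat \<Rightarrow> real) \<Rightarrow> nat \<Rightarrow> node \<Rightarrow> node list" where
  "children e g p (A, B, j, l) =
    (let v = (\<lambda>x. g (x + j));
         s = (length B \<le> e * length (filter (\<lambda>y. v y < v p) B));
         AL = filter (\<lambda>x. \<not> hi s v p x) A; AH = filter (hi s v p) A;
         BL = filter (\<lambda>y. v y < v p) B; BH = filter (\<lambda>y. \<not> v y < v p) B
     in [(AL, BL, j, l - 1), (AH, BH, j, l - 1), (AL, BH, j + 1, l)])"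

text \<open>The negation of \<open>hi\<close> as a machine test, with the flag \<open>s\<close> of
  \<open>children\<close> stored in cell 26 as 0 or 1.\<close>

abbreviation (input) loA :: bexp where
  "loA \<equiv> BAnd (BNot (RL 25 20)) (BNot (BAnd (NLess (NConst 0) (V 26)) (BNot (RL 20 25))))"

definition Split :: com where
  "Split =
    Seq Pivot
   (Seq (Count 27 (V 13) (V 14) (RL 20 25))
   (Seq (If (NLess (V 27) (V 14)) (NSet (NConst 26) (NConst 0)) (NSet (NConst 26) (NConst 1)))
   (Seq (Child (V 15) (NSub (V 16) (NConst 1)) loA (RL 20 25))
   (Seq (Child (V 15) (NSub (V 16) (NConst 1)) (BNot loA) (BNot (RL 20 25)))
        (Child (NAdd (V 15) (NConst 1)) (V 16) loA (BNot (RL 20 25)))))))"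

lemma wp_Split:
  assumes A: "holds f p A" "f 11 = p" "f 12 = length A" "100 \<le> p" "p + length A \<le> f 7"
    and B: "holds f q B" "f 13 = q" "f 14 = length B" "100 \<le> q" "q + length B \<le> f 7"
    and jl: "f 15 = j" "f 16 = l" and e: "f 5 = e" "1 \<le> e"
    and post: "\<And>t h r ns. t \<le> 4000 * ((length A + 1)\<^sup>2 + length B) \<Longrightarrow>
      (A \<noteq> [] \<longrightarrow> r \<in> set A \<and> is_pivot e (\<lambda>x. g (x + j)) A r) \<Longrightarrow>
      ns = children e g r (A, B, j, l) \<Longrightarrow>
      h 7 = f 7 + length (concat (map enc ns)) \<Longrightarrow> holds h (f 7) (concat (map enc ns)) \<Longrightarrow>
      (\<forall>v. v \<notin> {7, 17, 18, 19, 20, 23, 24, 25, 26, 27, 28} \<longrightarrow> v < f 7 \<longrightarrow> h v = f v) \<Longrightarrow> Q t (h, g)"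
  shows "wp Split (f, g) Q"
proof -
  let ?c = "f 7"
  let ?v = "\<lambda>x. g (x + j)"
  have c: "100 \<le> ?c" using A by simp
  have hA: "holds h p A" if "\<forall>v. v \<notin> {7, 17, 18, 19, 20, 23, 24, 25, 26, 27, 28} \<longrightarrow> v < ?c \<longrightarrow> h v = f v" for h
    by (subst holds_cong[where h = f]) (use that A in auto)
  have hB: "holds h q B" if "\<forall>v. v \<notin> {7, 17, 18, 19, 20, 23, 24, 25, 26, 27, 28} \<longrightarrow> v < ?c \<longrightarrow> h v = f v" for h
    by (subst holds_cong[where h = f]) (use that B in auto)
  show ?thesis
    unfolding Split_def wp_Seq
  proof (rule wp_Pivot[OF A(1-4) e refl], goal_cases)
    case (1 t0 h0)
    note h0 = 1
    define r where "r = h0 25"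
    define s where "s \<longleftrightarrow> length B \<le> e * length (filter (\<lambda>y. ?v y < ?v r) B)"
    have f0: "h0 v = f v" if "v \<notin> {7, 17, 18, 19, 20, 23, 24, 25, 26, 27, 28}" for v
      using h0(3) that by simp
    show ?case
    proof (rule wp_Count[where xs = B and p = q and P = "\<lambda>y. ?v y < ?v r"], goal_cases)
      case 1
      show ?case by (rule hB) (use f0 in auto)
    next
      case (9 h)
      then show ?case by (simp add: f0 jl r_def)
    next
      case (11 t1 h1)
      have f1: "h1 v = f v" if "v \<notin> {7, 17, 18, 19, 20, 23, 24, 25, 26, 27, 28}" for v
        using 11(3) f0 that by simp
      have r1: "h1 25 = r" "h1 7 = ?c" using 11(3) h0(3) by (simp_all add: r_def)
      have s1: "h1 27 < h1 14 \<longleftrightarrow> \<not> s" using 11(2) f1 by (simp add: s_def f0 B e not_le)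
      define f2 where "f2 = h1(26 := if s then 1 else 0)"
      have f2: "f2 v = f v" if "v \<notin> {17, 18, 19, 20, 23, 24, 25, 26, 27, 28}" for v
        using f1[of v] r1 that by (cases "v = 7") (simp_all add: f2_def)
      have r2: "f2 25 = r" "f2 26 = (if s then 1 else 0)" using r1 by (simp_all add: f2_def)
      let ?L = "\<lambda>x. \<not> hi s ?v r x" and ?M = "\<lambda>y. ?v y < ?v r"
      have c2: "f2 7 = ?c" using r1 by (simp add: f2_def)
      let ?F = "\<lambda>h. \<forall>v. v \<notin> {7, 19, 20, 27, 28} \<longrightarrow> v < ?c \<longrightarrow> h v = f2 v"
      \<comment> \<open>One statement for all three calls of \<open>Child\<close>. The condition
        \<open>?F\<close> says that the data read by a call are as in \<open>f2\<close>; every call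
        preserves it, since it writes only scratch cells and cells from the tail on.\<close>
      have child: "wp (Child J X a b) (h, g) R"
        if F: "?F h" and le: "?c \<le> h 7"
          and J: "J = V 15 \<and> j0 = j \<or> J = NAdd (V 15) (NConst 1) \<and> j0 = j + 1"
          and X: "X = NSub (V 16) (NConst 1) \<and> l0 = l - 1 \<or> X = V 16 \<and> l0 = l"
          and a: "a = loA \<and> P = ?L \<or> a = BNot loA \<and> P = hi s ?v r"
          and b: "b = RL 20 25 \<and> P' = ?M \<or> b = BNot (RL 20 25) \<and> P' = (\<lambda>y. \<not> ?M y)"
          and R: "\<And>t h'. t \<le> (length A + length B + 3) * 200 \<Longrightarrow>
              h' 7 = h 7 + length (enc (filter P A, filter P' B, j0, l0)) \<Longrightarrow>
              holds h' (h 7) (enc (filter P A, filter P' B, j0, l0)) \<Longrightarrow>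
              (\<And>v. 100 \<le> v \<Longrightarrow> v < h 7 \<Longrightarrow> h' v = h v) \<Longrightarrow> ?F h' \<Longrightarrow> R t (h', g)"
        for J X a b h R j0 l0 P P'
      proof -
      have hv: "h v = f v" if "v \<notin> {7, 17, 18, 19, 20, 23, 24, 25, 26, 27, 28}" "v < 100" for v
        using F f2[of v] that c by simp
      show ?thesis
      proof (rule wp_Child[where A = A and B = B and p = p and q = q and P = P and P' = P'
            and ?j0.0 = j0 and ?l0.0 = l0], goal_cases)
        case 1
        show ?case by (rule hA) (use F f2 in auto)
      next
        case 6
        show ?case by (rule hB) (use F f2 in auto)
      next
        case (15 h')
        have F': "h' v = f2 v" if "v \<notin> {7, 19, 20, 27, 28}" "v < 100" for v
          using 15[rule_format, OF that] F that c by simp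
        show ?case using a b by (auto simp: F' r2 f2 jl hi_def split: if_splits)
      next
        case (18 t h')
        show ?case
        proof (rule R)
          show "?F h'"
          proof (intro allI impI)
            fix v assume v: "v \<notin> {7, 19, 20, 27, 28}" "v < ?c"
            then have "h' v = h v" using 18(4) le by auto
            with F v show "h' v = f2 v" by auto
          qed
        qed (use 18 in auto)
      next
        case 2 show ?case using hv[of 11] A by simp
      next
        case 3 show ?case using hv[of 12] A by simp
      next
        case 4 show ?case using A by simp
      next
        case 5 show ?case using A le by simp
      next
        case 7 show ?case using hv[of 13] B by simp
      next
        case 8 show ?case using hv[of 14] B by simp
      next
        case 9 show ?case using B by simp
      next
        case 10 show ?case using B le by simp
      next
        case 11 show ?case using J hv[of 15] jl c le by auto
      next
        case 12 show ?case using X hv[of 16] jl c le by auto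
      next
        case 13 show ?case using J by auto
      next
        case 14 show ?case using X by auto
      next
        case 16 show ?case using a by (elim disjE) simp_all
      next
        case 17 show ?case using b by (elim disjE) simp_all
      qed
      qed
      define e1 where "e1 = enc (filter ?L A, filter ?M B, j, l - 1)"
      define e2 where "e2 = enc (filter (hi s ?v r) A, filter (\<lambda>y. \<not> ?M y) B, j, l - 1)"
      define e3 where "e3 = enc (filter ?L A, filter (\<lambda>y. \<not> ?M y) B, j + 1, l)"
      have *: "wp (Child (V 15) (NSub (V 16) (NConst 1)) loA (RL 20 25)) (f2, g)
        (\<lambda>t2 \<tau>. wp (Child (V 15) (NSub (V 16) (NConst 1)) (BNot loA) (BNot (RL 20 25))) \<tau>
        (\<lambda>t3 \<tau>. wp (Child (NAdd (V 15) (NConst 1)) (V 16) loA (BNot (RL 20 25))) \<tau>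
        (\<lambda>t4 \<tau>. Q (t0 + (t1 + (9 + (t2 + (t3 + t4))))) \<tau>)))"
      proof (rule child[where P = ?L and P' = ?M and ?j0.0 = j and ?l0.0 = "l - 1"], goal_cases)
        case (7 t2 h2)
        note h2 = 7[folded e1_def, unfolded c2]
        show ?case
        proof (rule child[where P = "hi s ?v r" and P' = "\<lambda>y. \<not> ?M y" and ?j0.0 = j and ?l0.0 = "l - 1"], goal_cases)
          case (7 t3 h3)
          note h3 = 7[folded e2_def, unfolded h2(2)]
          show ?case
          proof (rule child[where P = ?L and P' = "\<lambda>y. \<not> ?M y" and ?j0.0 = "j + 1" and ?l0.0 = l], goal_cases)
            case (7 t4 h4)
            note h4 = 7[folded e3_def, unfolded h3(2)]
            \<comment> \<open>Blocks already written survive, because each later call writes at its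
              own, higher tail.\<close>
            have "holds h4 ?c e1"
              by (subst holds_cong[where h = h2]) (use h2 h3(4) h4(4) c in auto)
            moreover have "holds h4 (?c + length e1) e2"
              by (subst holds_cong[where h = h3]) (use h3 h4(4) c in auto)
            ultimately have H: "holds h4 ?c (e1 @ e2 @ e3)"
              using h4(3) by (simp add: holds_append add.assoc)
            have ns: "concat (map enc (children e g r (A, B, j, l))) = e1 @ e2 @ e3"
              by (simp add: Let_def s_def[symmetric] e1_def e2_def e3_def del: enc.simps)
            show ?case
            proof (rule post[of _ r, OF _ _ refl], goal_cases)
              case 1
              have "length A + 1 \<le> (length A + 1)\<^sup>2" by (simp add: power2_eq_square)
              then show ?case using h2(1) h3(1) h4(1) h0(1) 11(1) by simp
            next
              case 2
              then show ?case using h0(2) by (simp add: r_def jl)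
            next
              case 3
              then show ?case using h4(2) by (simp only: ns) simp
            next
              case 4
              then show ?case using H by (simp only: ns)
            next
              case 5
              then show ?case using h4(5) f2 by auto
            qed
          qed (use h3 in auto)
        qed (use h2 in auto)
      qed (use c2 in auto)
      have "wp (If (NLess (V 27) (V 14)) (NSet (NConst 26) (NConst 0)) (NSet (NConst 26) (NConst 1))) (h1, g)
          (\<lambda>t \<tau>. t = 9 \<and> \<tau> = (f2, g))"
        using s1 by (simp add: wp_simps f2_def)
      then show ?case by (rule wp_mono) (elim conjE, simp only: *)
    next
      case 2 show ?case using f0[of 13] B by simp
    next
      case 3 show ?case using f0[of 14] B by simp
    next
      case 4 show ?case using B by simp
    qed simp_all
  qed
qed

section \<open>The potential of a node\<close>

text \<open>Here \<open>x\<close> and \<open>y\<close> count the high elements of \<open>A\<close>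
  and the low ones of \<open>B\<close>. The product \<open>a * b\<close> splits into paying pairs,
  free pairs \<open>(a - x) * (b - y)\<close> and discarded pairs \<open>x * y\<close>, so the claim
  is that \<open>1/(2E)\<close> times the paying pairs is at most the discarded pairs plus
  \<open>2/E^2\<close> times the free ones. If both shares are large, the discarded pairs suffice;
  if both are small, the free ones do.\<close>

lemma mass_ineq:
  fixes a b x y E :: real
  assumes "0 \<le> x" "x \<le> a" "0 \<le> y" "y \<le> b" "2 \<le> E"
    and "a \<le> E * x \<and> b \<le> E * y \<or> E * x \<le> a \<and> E * y \<le> b"
  shows "((a - x) * y + x * (b - y)) * (1 + 1 / (2 * E)) + (a - x) * (b - y) * (1 - 2 / E\<^sup>2) \<le> a * b"
proof -
  have E: "0 < E" using assms by simp
  have "((a - x) * y + x * (b - y)) \<le> 2 * E * (x * y + 2 / E\<^sup>2 * ((a - x) * (b - y)))"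
    using assms(6)
  proof
    assume h: "a \<le> E * x \<and> b \<le> E * y"
    have "(a - x) * y \<le> E * x * y" "x * (b - y) \<le> x * (E * y)"
      using h assms by (intro mult_right_mono mult_left_mono; linarith)+
    moreover define k where "k = 2 / E\<^sup>2 * ((a - x) * (b - y))"
    have "0 \<le> E * k" using E assms by (simp add: k_def)
    ultimately show ?thesis unfolding k_def[symmetric] by (simp add: algebra_simps)
  next
    assume h: "E * x \<le> a \<and> E * y \<le> b"
    \<comment> \<open>With \<open>E\<close> at least 2, small shares are at most one half, so
      \<open>a\<close> and \<open>b\<close> are bounded by twice the numbers of low and high
      elements.\<close>
    have "2 * x \<le> E * x" "2 * y \<le> E * y" using assms by (intro mult_right_mono; simp)+
    then have d: "a \<le> 2 * (a - x)" "b \<le> 2 * (b - y)" using h by auto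
    have "E * ((a - x) * y) \<le> (a - x) * (2 * (b - y))" "E * (x * (b - y)) \<le> 2 * (a - x) * (b - y)"
    proof -
      have "(a - x) * (E * y) \<le> (a - x) * (2 * (b - y))" using h d assms by (intro mult_left_mono) auto
      then show "E * ((a - x) * y) \<le> (a - x) * (2 * (b - y))" by (simp add: algebra_simps)
      have "(E * x) * (b - y) \<le> (2 * (a - x)) * (b - y)" using h d assms by (intro mult_right_mono) auto
      then show "E * (x * (b - y)) \<le> 2 * (a - x) * (b - y)" by (simp add: algebra_simps)
    qed
    then have "E * ((a - x) * y + x * (b - y)) \<le> 4 * ((a - x) * (b - y))" by (simp add: algebra_simps)
    then have "(a - x) * y + x * (b - y) \<le> 4 * ((a - x) * (b - y)) / E"
      using E by (simp only: pos_le_divide_eq mult.commute[of _ E])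
    also have "\<dots> = 2 * E * (2 / E\<^sup>2 * ((a - x) * (b - y)))" using E by (simp add: power2_eq_square)
    also have "\<dots> \<le> 2 * E * (x * y + 2 / E\<^sup>2 * ((a - x) * (b - y)))" using E assms
      by (intro mult_left_mono) auto
    finally show ?thesis .
  qed
  then have "((a - x) * y + x * (b - y)) / (2 * E) \<le> x * y + 2 / E\<^sup>2 * ((a - x) * (b - y))"
    using E by (metis mult.commute pos_divide_le_eq zero_less_mult_iff zero_less_numeral)
  moreover have "a * b = ((a - x) * y + x * (b - y)) + (a - x) * (b - y) + x * y" by algebra
  moreover have "((a - x) * y + x * (b - y)) * (1 + 1 / (2 * E)) =
      ((a - x) * y + x * (b - y)) + ((a - x) * y + x * (b - y)) / (2 * E)"
    by (simp only: distrib_left mult_1_right times_divide_eq_right)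
  moreover have "(a - x) * (b - y) * (1 - 2 / E\<^sup>2) = (a - x) * (b - y) - 2 / E\<^sup>2 * ((a - x) * (b - y))"
    by (simp only: right_diff_distrib mult_1_right mult.commute)
  ultimately show ?thesis by linarith
qed

text \<open>Bounds the fraction of a node's pairs that reach brute force, with budget
  \<open>l\<close> and \<open>d\<close> coordinates left.\<close>

definition leaf_mass :: "nat \<Rightarrow> nat \<Rightarrow> nat \<Rightarrow> real" where
  "leaf_mass e l d = (1 / (1 + 1 / (2 * real e))) ^ l * (1 / (1 - 2 / (real e)\<^sup>2)) ^ d"

text \<open>Bounds the number of nodes in a subtree. \<open>Y\<close> is a free weight: a unit of
  budget costs a factor \<open>Y\<close>, and in return a coordinate costs only
  \<open>Y / (Y - 3)\<close>, which is close to 1 for large \<open>Y\<close>.\<close>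

definition tree_size :: "real \<Rightarrow> nat \<Rightarrow> nat \<Rightarrow> real" where
  "tree_size Y l d = 2 * Y ^ l * (Y / (Y - 3)) ^ d"

lemma leaf_mass_nonneg: "2 \<le> e \<Longrightarrow> 0 \<le> leaf_mass e l d"
proof -
  assume "2 \<le> e"
  then have "2 / (real e)\<^sup>2 \<le> 1"
    by (simp add: divide_le_eq power2_eq_square) (metis mult_le_mono of_nat_le_iff of_nat_mult of_nat_numeral le_trans mult_2 le_add1 le_refl numeral_le_iff)
  then show ?thesis unfolding leaf_mass_def by simp
qed

text \<open>Losing a unit of budget multiplies \<open>leaf_mass\<close> by
  \<open>1 + 1/(2e)\<close>, losing a coordinate by \<open>1 - 2/e^2\<close>; these are the two
  weights of \<open>mass_ineq\<close>.\<close>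

lemma leaf_mass_step:
  fixes a b x y :: real
  assumes "0 \<le> x" "x \<le> a" "0 \<le> y" "y \<le> b" "2 \<le> e"
    and "a \<le> e * x \<and> b \<le> e * y \<or> e * x \<le> a \<and> e * y \<le> b"
  shows "((a - x) * y + x * (b - y)) * leaf_mass e l (Suc d) + (a - x) * (b - y) * leaf_mass e (Suc l) d
    \<le> a * b * leaf_mass e (Suc l) (Suc d)"
proof -
  let ?E = "real e"
  have E: "2 \<le> ?E" using assms by simp
  have "2 * 2 \<le> ?E * ?E" using E by (intro mult_mono) auto
  then have p: "0 < 1 - 2 / ?E\<^sup>2" using E by (simp add: divide_less_eq power2_eq_square)
  have q: "0 < 1 + 1 / (2 * ?E)" using E by (simp add: add_pos_nonneg)
  have "leaf_mass e l (Suc d) = leaf_mass e (Suc l) (Suc d) * (1 + 1 / (2 * ?E))"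
    "leaf_mass e (Suc l) d = leaf_mass e (Suc l) (Suc d) * (1 - 2 / ?E\<^sup>2)"
  proof -
    have r: "(1 / u) ^ k = (1 / u) ^ Suc k * u" if "u > 0" for u :: real and k using that by simp
    show "leaf_mass e l (Suc d) = leaf_mass e (Suc l) (Suc d) * (1 + 1 / (2 * ?E))"
      unfolding leaf_mass_def by (subst r[OF q, of l]) (simp only: mult_ac)
    show "leaf_mass e (Suc l) d = leaf_mass e (Suc l) (Suc d) * (1 - 2 / ?E\<^sup>2)"
      unfolding leaf_mass_def by (subst r[OF p, of d]) (simp only: mult_ac)
  qed
  then have "((a - x) * y + x * (b - y)) * leaf_mass e l (Suc d) + (a - x) * (b - y) * leaf_mass e (Suc l) d
    = (((a - x) * y + x * (b - y)) * (1 + 1 / (2 * ?E)) + (a - x) * (b - y) * (1 - 2 / ?E\<^sup>2)) * leaf_mass e (Suc l) (Suc d)"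
    by (simp only: ring_distribs mult_ac)
  also have "\<dots> \<le> a * b * leaf_mass e (Suc l) (Suc d)"
    by (intro mult_right_mono mass_ineq leaf_mass_nonneg) (use assms E in auto)
  finally show ?thesis .
qed

lemma tree_size_ge_1: "3 < Y \<Longrightarrow> 1 \<le> tree_size Y l d"
proof -
  assume Y: "3 < Y"
  have "1 \<le> Y ^ l" "1 \<le> (Y / (Y - 3)) ^ d" using Y by (auto intro!: one_le_power)
  then have "1 * 1 \<le> Y ^ l * (Y / (Y - 3)) ^ d" using Y by (intro mult_mono) auto
  then show ?thesis by (simp add: tree_size_def)
qed

text \<open>With \<open>u\<close> as below, the sides are \<open>1 + 4 u + 2 (Y - 3) u\<close> and
  \<open>2 Y u\<close>. The 3 in \<open>Y - 3\<close> consists of 2 for the children that pay and 1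
  for the node itself; as \<open>u\<close> is at least 1, the surplus \<open>2 u\<close> covers the
  summand 1.\<close>

lemma tree_size_step:
  assumes "3 < Y"
  shows "1 + 2 * tree_size Y l (Suc d) + tree_size Y (Suc l) d \<le> tree_size Y (Suc l) (Suc d)"
proof -
  let ?u = "Y ^ l * (Y / (Y - 3)) ^ Suc d"
  have "1 \<le> Y ^ l" using assms by (intro one_le_power) simp
  moreover have "1 \<le> (Y / (Y - 3)) ^ Suc d" using assms by (intro one_le_power) simp
  ultimately have "1 * 1 \<le> ?u" using assms by (intro mult_mono) auto
  moreover have "tree_size Y l (Suc d) = 2 * ?u" "tree_size Y (Suc l) (Suc d) = 2 * Y * ?u"
    by (simp_all add: tree_size_def)
  moreover have "tree_size Y (Suc l) d = 2 * (Y - 3) * ?u"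
  proof -
    have "2 * (Y - 3) * ?u = 2 * ((Y - 3) * (Y / (Y - 3))) * Y ^ l * (Y / (Y - 3)) ^ d"
      by (simp only: power_Suc mult_ac)
    then show ?thesis using assms by (simp add: tree_size_def)
  qed
  moreover have "1 + 2 * (2 * u) + 2 * (Y - 3) * u \<le> 2 * Y * u" if "1 * 1 \<le> u" for u
    using that by (simp add: algebra_simps)
  ultimately show ?thesis by metis
qed

text \<open>The first summand pays for splitting the nodes of the tree below, the second one for the pairs
  that reach brute force.\<close>

fun pot :: "nat \<Rightarrow> nat \<Rightarrow> real \<Rightarrow> real \<Rightarrow> node \<Rightarrow> real" where
  "pot m e Y w (A, B, j, l) = 5000 * (w * tree_size Y l (m - j) +
     real (m + 1) * (real (length A) * real (length B)) * leaf_mass e l (m - j))"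

lemma pot_nonneg: "3 < Y \<Longrightarrow> 2 \<le> e \<Longrightarrow> 0 \<le> w \<Longrightarrow> 0 \<le> pot m e Y w nd"
  using tree_size_ge_1 leaf_mass_nonneg
  by (cases nd) (auto intro!: add_nonneg_nonneg mult_nonneg_nonneg intro: order_trans[OF zero_le_one])

lemma length_filter_not: "length (filter (\<lambda>x. \<not> P x) xs) = length xs - length (filter P xs)"
  using sum_length_filter_compl[of P xs] by simp

text \<open>The amortised cost of a split: the potential lost in passing from a node to its children
  pays \<open>5000 * w\<close>. The node count and the pair count decrease by
  \<open>tree_size_step\<close> and \<open>leaf_mass_step\<close> separately.\<close>

lemma pot_children:
  assumes Y: "3 < Y" and e: "2 \<le> e" and w: "0 \<le> w" and j: "j < m" and l: "0 < l"
    and p: "A \<noteq> [] \<longrightarrow> is_pivot e (\<lambda>x. g (x + j)) A p"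
  shows "5000 * w + sum_list (map (pot m e Y w) (children e g p (A, B, j, l))) \<le> pot m e Y w (A, B, j, l)"
proof -
  obtain d where d: "m - j = Suc d" "m - Suc j = d" using j by (metis Suc_diff_Suc)
  obtain k where k: "l = Suc k" using l by (cases l) auto
  let ?v = "\<lambda>x. g (x + j)"
  define s where "s \<longleftrightarrow> length B \<le> e * length (filter (\<lambda>y. ?v y < ?v p) B)"
  define x where "x = length (filter (hi s ?v p) A)"
  define y where "y = length (filter (\<lambda>y. ?v y < ?v p) B)"
  have x: "x \<le> length A" and y: "y \<le> length B" by (simp_all add: x_def y_def)
  \<comment> \<open>If \<open>s\<close> holds, ties in \<open>A\<close> are high and the first half
    of \<open>is_pivot\<close> makes \<open>x\<close> large along with \<open>y\<close>. Otherwise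
    only strictly larger elements are high and the second half makes \<open>x\<close> small. For
    empty \<open>A\<close>, \<open>x\<close> is 0 and fits either side.\<close>
  have "length A \<le> e * x \<and> length B \<le> e * y \<or> e * x \<le> length A \<and> e * y \<le> length B"
  proof (cases "A = []")
    case True
    then show ?thesis by (auto simp: x_def)
  next
    case False
    have "hi True ?v p = (\<lambda>x. \<not> ?v x < ?v p)" "hi False ?v p = (\<lambda>x. ?v p < ?v x)"
      by (auto simp: hi_def fun_eq_iff)
    then show ?thesis using p False s_def by (cases s) (auto simp: x_def y_def is_pivot_def)
  qed
  then have c: "real (length A) \<le> e * real x \<and> real (length B) \<le> e * real y \<or>
      e * real x \<le> length A \<and> e * real y \<le> length B"
    by (metis of_nat_le_iff of_nat_mult)
  have mass: "((real (length A) - x) * y + x * (real (length B) - y)) * leaf_mass e k (Suc d)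
     + (real (length A) - x) * (real (length B) - y) * leaf_mass e (Suc k) d
    \<le> real (length A) * real (length B) * leaf_mass e (Suc k) (Suc d)"
    by (rule leaf_mass_step) (use x y e c in auto)
  have size: "w * (1 + 2 * tree_size Y k (Suc d) + tree_size Y (Suc k) d) \<le> w * tree_size Y (Suc k) (Suc d)"
    using tree_size_step[OF Y] w by (rule mult_left_mono)
  have m: "0 \<le> real (m + 1)" by simp
  have ch: "children e g p (A, B, j, l) =
      [(filter (\<lambda>x. \<not> hi s ?v p x) A, filter (\<lambda>y. ?v y < ?v p) B, j, k),
       (filter (hi s ?v p) A, filter (\<lambda>y. \<not> ?v y < ?v p) B, j, k),
       (filter (\<lambda>x. \<not> hi s ?v p x) A, filter (\<lambda>y. \<not> ?v y < ?v p) B, Suc j, Suc k)]"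
    by (simp add: Let_def s_def k)
  have "5000 * w + sum_list (map (pot m e Y w) (children e g p (A, B, j, l))) =
    5000 * (w * (1 + 2 * tree_size Y k (Suc d) + tree_size Y (Suc k) d) + real (m + 1) *
     (((real (length A) - x) * y + x * (real (length B) - y)) * leaf_mass e k (Suc d)
     + (real (length A) - x) * (real (length B) - y) * leaf_mass e (Suc k) d))"
    using x y
    by (simp only: ch list.map sum_list.Cons sum_list.Nil pot.simps length_filter_not x_def[symmetric]
        y_def[symmetric] d of_nat_diff) (simp add: algebra_simps)
  also have "\<dots> \<le> 5000 * (w * tree_size Y (Suc k) (Suc d) + real (m + 1) *
     (real (length A) * real (length B) * leaf_mass e (Suc k) (Suc d)))"
    by (rule mult_left_mono[OF add_mono[OF size mult_left_mono[OF mass m]]]) simp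
  finally show ?thesis by (simp add: d k mult.assoc)
qed

section \<open>Correctness of the split\<close>

fun has_dom :: "nat \<Rightarrow> (nat \<Rightarrow> real) \<Rightarrow> node \<Rightarrow> bool" where
  "has_dom m g (A, B, j, l) \<longleftrightarrow> (\<exists>x\<in>set A. \<exists>y\<in>set B. dom m g x y)"

text \<open>The bounds \<open>a\<close> and \<open>b\<close> on the list lengths, inherited from the
  root, allow one cost bound \<open>width\<close> for all nodes.\<close>

fun node_ok :: "nat \<Rightarrow> (nat \<Rightarrow> real) \<Rightarrow> nat \<Rightarrow> nat \<Rightarrow> node \<Rightarrow> bool" where
  "node_ok m g a b (A, B, j, l) \<longleftrightarrow> j \<le> m \<and> length A \<le> a \<and> length B \<le> b \<and>
    (\<forall>x\<in>set A. \<forall>y\<in>set B. dom j g x y)"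

text \<open>A dominating pair is never of type (high, low), and the children cover the other three
  types.\<close>

lemma has_dom_children:
  assumes "j < m"
  shows "(\<exists>c\<in>set (children e g p (A, B, j, l)). has_dom m g c) \<longleftrightarrow> has_dom m g (A, B, j, l)"
proof -
  have "dom m g x y \<Longrightarrow> g (x + j) \<le> g (y + j)" for x y
    using assms by (simp add: dom_def)
  then have key: "\<not> (hi s (\<lambda>x. g (x + j)) p x \<and> g (y + j) < g (p + j))" if "dom m g x y" for s x y
    using that by (force simp: hi_def)
  show ?thesis
  proof
    assume "has_dom m g (A, B, j, l)"
    then obtain x y where xy: "x \<in> set A" "y \<in> set B" "dom m g x y" by auto
    let ?H = "hi (length B \<le> e * length (filter (\<lambda>y. g (y + j) < g (p + j)) B)) (\<lambda>x. g (x + j)) p x"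
    show "\<exists>c\<in>set (children e g p (A, B, j, l)). has_dom m g c"
      using xy key[OF xy(3)]
      by (cases ?H; cases "g (y + j) < g (p + j)") (auto simp: Let_def)
  qed (auto simp: Let_def)
qed

text \<open>Only the third child advances \<open>j\<close>; its pairs lie on opposite sides of the
  pivot in coordinate \<open>j\<close>, hence are in order there.\<close>

lemma node_ok_children:
  assumes "j < m" "node_ok m g a b (A, B, j, l)" "c \<in> set (children e g p (A, B, j, l))"
  shows "node_ok m g a b c"
proof -
  have "length (filter P A) \<le> a" "length (filter P B) \<le> b" for P
    using assms(2) by (auto intro: order_trans[OF length_filter_le])
  then show ?thesis using assms
    by (auto simp: Let_def hi_def dom_def less_Suc_eq not_less intro: order_trans)
qed

text \<open>At \<open>j = m\<close> the invariant says that every pair dominates, so only existence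
  of a pair is left to test.\<close>

lemma node_done:
  assumes "node_ok m g a b (A, B, m, l)"
  shows "has_dom m g (A, B, m, l) \<longleftrightarrow> A \<noteq> [] \<and> B \<noteq> []"
  using assms by (cases A; cases B) auto

section \<open>Processing the queue\<close>

text \<open>The head moves past the block at once and the lists are not copied: cells 11 and 13
  point into the old block, which stays intact because new blocks go to the tail.\<close>

definition Load :: com where
  "Load =
    Seq (NSet (NConst 15) (NGet (V 6)))
   (Seq (NSet (NConst 16) (NGet (NAdd (V 6) (NConst 1))))
   (Seq (NSet (NConst 12) (NGet (NAdd (V 6) (NConst 2))))
   (Seq (NSet (NConst 14) (NGet (NAdd (V 6) (NConst 3))))
   (Seq (NSet (NConst 11) (NAdd (V 6) (NConst 4)))
   (Seq (NSet (NConst 13) (NAdd (V 11) (V 12)))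
        (NSet (NConst 6) (NAdd (V 13) (V 14))))))))"

definition Step :: com where
  "Step = Seq Load
    (If (NLess (V 15) (V 1))
      (If (NLess (NConst 0) (V 16)) Split Brute)
      (If (BAnd (NLess (NConst 0) (V 12)) (NLess (NConst 0) (V 14))) (NSet (NConst 0) (NConst 1)) Skip))"

text \<open>Work at one node up to a constant: quadratic in \<open>A\<close> for the pivot, linear
  in \<open>B\<close> for filtering. The factor \<open>m + 1\<close> covers the lower-order terms of
  brute force; its main term, the number of pairs, is charged separately in
  \<open>pot\<close>.\<close>

definition width :: "nat \<Rightarrow> nat \<Rightarrow> nat \<Rightarrow> real" where
  "width m a b = real (((a + 1)\<^sup>2 + b + 1) * (m + 1))"

text \<open>A node is split, solved by brute force when the budget is 0, or answered by
  \<open>node_done\<close> when no coordinate is left. The truth of "answer found, or some pending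
  node has a dominating pair" is preserved, and the spare 100 units pay for the test of the outer
  loop.\<close>

lemma wp_Step:
  assumes e: "2 \<le> e" "f 5 = e" and m: "f 1 = m" and Y: "3 < Y"
    and mem: "holds f (f 6) (enc nd @ rest)" "f 7 = f 6 + length (enc nd @ rest)" "100 \<le> f 6"
    and ok: "node_ok m g a b nd"
    and post: "\<And>t h ns. holds h (h 6) (rest @ concat (map enc ns)) \<Longrightarrow>
      h 7 = h 6 + length (rest @ concat (map enc ns)) \<Longrightarrow> 100 \<le> h 6 \<Longrightarrow> h 5 = e \<Longrightarrow> h 1 = m \<Longrightarrow>
      (\<And>c. c \<in> set ns \<Longrightarrow> node_ok m g a b c) \<Longrightarrow>
      h 0 = f 0 \<or> h 0 = 1 \<Longrightarrow>
      h 0 = 1 \<or> (\<exists>c\<in>set ns. has_dom m g c) \<longleftrightarrow> f 0 = 1 \<or> has_dom m g nd \<Longrightarrow>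
      real t + 100 + sum_list (map (pot m e Y (width m a b)) ns) \<le> pot m e Y (width m a b) nd \<Longrightarrow> Q t (h, g)"
  shows "wp Step (f, g) Q"
proof -
  obtain A B j l where nd: "nd = (A, B, j, l)" by (cases nd)
  let ?h = "f 6"
  let ?w = "width m a b"
  have len: "length A \<le> a" "length B \<le> b" and j: "j \<le> m" using ok by (auto simp: nd)
  have W1: "(real (length A + 1))\<^sup>2 + real (length B) + 1 \<le> ?w"
  proof -
    have "(length A + 1)\<^sup>2 + length B + 1 \<le> (a + 1)\<^sup>2 + b + 1"
      using len by (intro add_mono power_mono) auto
    also have "\<dots> \<le> ((a + 1)\<^sup>2 + b + 1) * (m + 1)" by simp
    finally have "real ((length A + 1)\<^sup>2 + length B + 1) \<le> ?w"
      unfolding width_def of_nat_le_iff .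
    then show ?thesis by simp
  qed
  then have w: "1 \<le> ?w" by (smt (verit) of_nat_0_le_iff zero_le_power2)
  have pot1: "5000 * ?w \<le> pot m e Y ?w nd"
  proof -
    have 1: "?w * 1 \<le> ?w * tree_size Y l (m - j)"
      using tree_size_ge_1[OF Y] w by (intro mult_left_mono) auto
    have 2: "0 \<le> real (m + 1) * (real (length A) * real (length B)) * leaf_mass e l (m - j)"
      by (intro mult_nonneg_nonneg leaf_mass_nonneg e) auto
    have "5000 * (?w * 1 + 0) \<le> pot m e Y ?w nd"
      unfolding nd pot.simps by (rule mult_left_mono[OF add_mono[OF 1 2]]) simp
    then show ?thesis by simp
  qed
  define f1 where "f1 = f(15 := j, 16 := l, 12 := length A, 14 := length B, 11 := ?h + 4,
    13 := ?h + 4 + length A, 6 := ?h + 4 + length A + length B)"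
  have memE: "f ?h = j" "f (Suc ?h) = l" "f (Suc (Suc ?h)) = length A" "f (Suc (Suc (Suc ?h))) = length B"
    using mem(1) by (simp_all add: nd holds_Cons)
  have memL: "holds f (?h + 4) A" "holds f (?h + 4 + length A) B"
    "holds f (?h + 4 + length A + length B) rest"
    using mem(1) by (simp_all add: nd holds_Cons holds_append numeral_eq_Suc)
  have f1: "f1 v = f v" if "v \<notin> {6, 11, 12, 13, 14, 15, 16}" for v
    using that by (simp add: f1_def)
  have f1s: "f1 6 = ?h + 4 + length A + length B" "f1 11 = ?h + 4" "f1 12 = length A"
    "f1 13 = ?h + 4 + length A" "f1 14 = length B" "f1 15 = j" "f1 16 = l"
    "f1 7 = ?h + 4 + length A + length B + length rest"
    using mem(2) by (simp_all add: f1_def nd)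
  have L: "holds f1 (?h + 4) A" "holds f1 (?h + 4 + length A) B"
    "holds f1 (?h + 4 + length A + length B) rest"
    by (subst holds_cong[where h = f]; use memL mem(3) in \<open>simp add: f1_def\<close>)+
  have "wp Load (f, g) (\<lambda>t \<tau>. t \<le> 60 \<and> \<tau> = (f1, g))"
    using memE mem(3) by (simp add: Load_def wp_simps f1_def numeral_eq_Suc[of "num.Bit0 num.One"] numeral_eq_Suc[of "num.Bit1 num.One"] fun_upd_twist)
  then show ?thesis
    unfolding Step_def
  proof (rule wp_SeqI)
    fix t :: nat and \<tau> :: ram_state
    assume "t \<le> 60 \<and> \<tau> = (f1, g)"
    then have t: "t \<le> 60" and \<tau>: "\<tau> = (f1, g)" by auto
    consider (split) "j < m" "0 < l" | (brute) "j < m" "l = 0" | (last) "j = m" using j by linarith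
    then show "wp (If (NLess (V 15) (V 1))
      (If (NLess (NConst 0) (V 16)) Split Brute)
      (If (BAnd (NLess (NConst 0) (V 12)) (NLess (NConst 0) (V 14))) (NSet (NConst 0) (NConst 1)) Skip))
      \<tau> (\<lambda>u. Q (t + u))"
    proof cases
      case split
      have "wp Split (f1, g) (\<lambda>u. Q (t + (1 + bcost (NLess (V 15) (V 1)) + (1 + bcost (NLess (NConst 0) (V 16)) + u))))"
      proof (rule wp_Split[where e = e, OF L(1) f1s(2,3) _ _ L(2) f1s(4,5) _ _ f1s(6,7)], goal_cases)
        case (7 u h p ns)
        have fr: "h v = f1 v" if "v \<notin> {7, 17, 18, 19, 20, 23, 24, 25, 26, 27, 28}" "v < f1 7" for v
          using 7(6) that by simp
        have pot: "5000 * ?w + sum_list (map (pot m e Y ?w) ns) \<le> pot m e Y ?w nd"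
          unfolding 7(3) nd by (rule pot_children) (use Y e w split 7(2) in auto)
        show ?case
        proof (rule post[of _ ns], goal_cases)
          case 1
          have "holds h (f1 6) rest"
            by (subst holds_cong[where h = f1]) (use L(3) fr mem(3) f1s in auto)
          then show ?case using 7(5) f1s fr[of 6] mem(3) by (simp add: holds_append)
        next
          case 2
          then show ?case using 7(4) f1s fr[of 6] mem(3) by simp
        next
          case (6 c)
          then show ?case using node_ok_children[OF split(1) ok[unfolded nd]] 7(3) by blast
        next
          case 8
          then show ?case using has_dom_children[OF split(1), of e g p A B l] 7(3) fr[of 0] f1 f1s mem(3)
            by (simp add: nd del: has_dom.simps children.simps)
        next
          \<comment> \<open>Of the released \<open>5000 * ?w\<close>, the split uses at most 4000
            parts; the rest pays for loading and tests.\<close>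
          case 9
          have "real u \<le> real (4000 * ((length A + 1)\<^sup>2 + length B))" using 7(1) of_nat_le_iff by blast
          then have "real u + 4000 \<le> 4000 * ?w" using W1 by simp
          then show ?case using pot t w by simp
        qed (use fr f1 f1s mem e m in auto)
      qed (use f1 f1s mem e in auto)
      moreover have "bval (NLess (V 15) (V 1)) (f1, g)" "bval (NLess (NConst 0) (V 16)) (f1, g)"
        using split f1 f1s m by simp_all
      ultimately show ?thesis by (simp only: \<tau> wp_If if_True)
    next
      case brute
      have "wp Brute (f1, g) (\<lambda>u. Q (t + (1 + bcost (NLess (V 15) (V 1)) + (1 + bcost (NLess (NConst 0) (V 16)) + u))))"
      proof (rule wp_Brute[where m = m, OF L(1) f1s(2,3) _ L(2) f1s(4,5)], goal_cases)
        case (4 u h)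
        have fr: "h v = f1 v" if "v \<notin> {0, 17, 18, 19, 20, 21, 22}" for v
          using 4(3) that by simp
        show ?case
        proof (rule post[of _ "[]"], goal_cases)
          case 1
          have "holds h (f1 6) rest"
            by (subst holds_cong[where h = f1]) (use L(3) fr mem(3) f1s in auto)
          then show ?case using fr[of 6] by simp
        next
          case 9
          have "real u \<le> real ((length A + 1) * ((length B + 1) * ((m + 1) * 110)))"
            using 4(1) of_nat_le_iff by blast
          also have "\<dots> = 110 * (real (m + 1) * (real (length A) * real (length B))) + 110 * real ((length A + length B + 1) * (m + 1))"
            by (simp add: algebra_simps)
          also have "real ((length A + length B + 1) * (m + 1)) \<le> ?w"
            unfolding width_def of_nat_le_iff
            using len by (intro mult_right_mono) (auto simp: power2_eq_square)
          finally have u: "real u \<le> 110 * (real (m + 1) * (real (length A) * real (length B))) + 110 * ?w" by simp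
          \<comment> \<open>With budget 0, \<open>leaf_mass\<close> is at least 1, so the potential
            charges every pair that is compared here.\<close>
          have "1 \<le> 1 / (1 - 2 / (real e)\<^sup>2)"
          proof -
            have "2 * 2 \<le> real e * real e" using e by (intro mult_mono) auto
            then have "2 / (real e)\<^sup>2 < 1" using e by (simp add: divide_less_eq power2_eq_square)
            then show ?thesis by simp
          qed
          then have "1 \<le> leaf_mass e 0 (m - j)" unfolding leaf_mass_def by (simp only: power_0 mult_1 one_le_power)
          then have 1: "real (m + 1) * (real (length A) * real (length B)) * 1 \<le>
            real (m + 1) * (real (length A) * real (length B)) * leaf_mass e 0 (m - j)"
            by (intro mult_left_mono) auto
          have 2: "?w * 1 \<le> ?w * tree_size Y l (m - j)"
            using tree_size_ge_1[OF Y] w by (intro mult_left_mono) auto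
          have "5000 * (?w * 1 + real (m + 1) * (real (length A) * real (length B)) * 1) \<le> pot m e Y ?w nd"
            unfolding nd pot.simps by (rule mult_left_mono[OF add_mono[OF 2 1[folded brute(2)]]]) simp
          moreover have "0 \<le> real (m + 1) * (real (length A) * real (length B))" by simp
          moreover have "real (t + (1 + bcost (NLess (V 15) (V 1)) + (1 + bcost (NLess (NConst 0) (V 16)) + u))) \<le> 71 + real u" using t by simp
          moreover define P where "P = real (m + 1) * (real (length A) * real (length B))"
          ultimately show ?case using u w unfolding P_def[symmetric] by simp
        qed (use 4 fr f1 f1s mem e m nd in auto)
      qed (use f1 f1s mem m in auto)
      moreover have "bval (NLess (V 15) (V 1)) (f1, g)" "\<not> bval (NLess (NConst 0) (V 16)) (f1, g)"
        using brute f1 f1s m by simp_all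
      ultimately show ?thesis by (simp only: \<tau> wp_If if_True if_False)
    next
      case last
      define h where "h = f1(0 := if A \<noteq> [] \<and> B \<noteq> [] then 1 else f 0)"
      have Q: "Q u (h, g)" if u: "u \<le> 200" for u
      proof (rule post[of _ "[]"], goal_cases)
        case 1
        have "holds h (f1 6) rest"
          by (subst holds_cong[where h = f1]) (use L(3) mem(3) f1s in \<open>auto simp: h_def\<close>)
        then show ?case by (simp add: h_def)
      next
        case 8
        then show ?case using node_done[OF ok[unfolded nd last]] by (simp add: nd last h_def f1 del: has_dom.simps)
      next
        case 9
        then show ?case using pot1 w u by simp
      qed (use f1 f1s mem e m in \<open>auto simp: h_def\<close>)
      have "f1(0 := f 0) = f1" using f1[of 0] by (simp add: fun_upd_idem)
      then have "wp (If (NLess (V 15) (V 1)) (If (NLess (NConst 0) (V 16)) Split Brute)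
          (If (BAnd (NLess (NConst 0) (V 12)) (NLess (NConst 0) (V 14))) (NSet (NConst 0) (NConst 1)) Skip))
          (f1, g) (\<lambda>u \<tau>. u \<le> 100 \<and> \<tau> = (h, g))"
        using last f1 f1s m by (simp add: wp_simps h_def)
      then show ?thesis unfolding \<tau> by (rule wp_mono) (use Q t in auto)
    qed
  qed
qed


definition Search :: com where
  "Search = While (NLess (V 6) (V 7)) Step"

text \<open>The time still to be spent is bounded by the sum of the potentials of the queued nodes,
  initially that of the root. The final 6 units are the failing loop test.\<close>

lemma wp_Search:
  assumes e: "2 \<le> e" "f 5 = e" and m: "f 1 = m" and Y: "3 < Y"
    and mem: "holds f (f 6) (enc nd)" "f 7 = f 6 + length (enc nd)" "100 \<le> f 6" "f 0 = 0"
    and ok: "node_ok m g a b nd"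
  shows "wp Search (f, g) (\<lambda>t \<tau>. real t \<le> pot m e Y (width m a b) nd + 6 \<and>
    fst \<tau> 0 = (if has_dom m g nd then 1 else 0))"
proof -
  define I where "I = (\<lambda>\<phi> (h, g'). g' = g \<and> (\<exists>ws. \<phi> = sum_list (map (pot m e Y (width m a b)) ws) \<and>
    holds h (h 6) (concat (map enc ws)) \<and> h 7 = h 6 + length (concat (map enc ws)) \<and> 100 \<le> h 6 \<and>
    h 5 = e \<and> h 1 = m \<and> (\<forall>c\<in>set ws. node_ok m g a b c) \<and> (h 0 = 0 \<or> h 0 = 1) \<and>
    (h 0 = 1 \<or> (\<exists>c\<in>set ws. has_dom m g c) \<longleftrightarrow> has_dom m g nd)))"
  have w: "0 \<le> width m a b" by (simp add: width_def)
  have "wp Search (f, g) (\<lambda>t \<tau>. real t \<le> pot m e Y (width m a b) nd + 1 + bcost (NLess (V 6) (V 7)) \<and>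
    (\<exists>\<psi>. I \<psi> \<tau>) \<and> \<not> bval (NLess (V 6) (V 7)) \<tau>)"
    unfolding Search_def
  proof (rule wp_While_potential)
    show "I (pot m e Y (width m a b) nd) (f, g)"
      unfolding I_def using mem ok e m by (auto intro!: exI[of _ "[nd]"])
    show "0 \<le> \<phi>" if "I \<phi> \<sigma>" for \<phi> \<sigma>
      using that w e Y by (auto simp: I_def intro!: sum_list_nonneg pot_nonneg)
    fix \<phi> \<sigma>
    assume I: "I \<phi> \<sigma>" and b: "bval (NLess (V 6) (V 7)) \<sigma>"
    obtain h where \<sigma>: "\<sigma> = (h, g)" using I by (cases \<sigma>) (simp add: I_def)
    obtain ws where ws: "\<phi> = sum_list (map (pot m e Y (width m a b)) ws)"
      "holds h (h 6) (concat (map enc ws))" "h 7 = h 6 + length (concat (map enc ws))" "100 \<le> h 6"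
      "h 5 = e" "h 1 = m" "\<forall>c\<in>set ws. node_ok m g a b c" "h 0 = 0 \<or> h 0 = 1"
      "h 0 = 1 \<or> (\<exists>c\<in>set ws. has_dom m g c) \<longleftrightarrow> has_dom m g nd"
      using I by (auto simp: I_def \<sigma>)
    obtain c cs where c: "ws = c # cs" using b ws(3) by (cases ws) (auto simp: \<sigma>)
    show "wp Step \<sigma> (\<lambda>t \<tau>. \<exists>\<psi>. I \<psi> \<tau> \<and> real (t + 1 + bcost (NLess (V 6) (V 7))) + \<psi> \<le> \<phi>)"
      unfolding \<sigma>
    proof (rule wp_Step[OF e(1) ws(5,6) Y, where nd = c and rest = "concat (map enc cs)" and a = a and b = b], goal_cases)
      case (5 t h' ns)
      have "I (sum_list (map (pot m e Y (width m a b)) (cs @ ns))) (h', g)"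
        unfolding I_def prod.case
      proof (intro conjI exI[of _ "cs @ ns"])
        show "h' 0 = 1 \<or> (\<exists>c\<in>set (cs @ ns). has_dom m g c) \<longleftrightarrow> has_dom m g nd"
          using 5(8) ws(9) unfolding c set_append bex_Un list.set bex_simps by blast
        show "h' 0 = 0 \<or> h' 0 = 1" using 5(7) ws(8) by auto
        show "\<forall>c\<in>set (cs @ ns). node_ok m g a b c" using 5(6) ws(7) unfolding c by auto
      qed (use 5(1-5) in simp_all)
      then show ?case using 5(9) ws(1) by (auto simp: c)
    qed (use ws in \<open>simp_all add: c\<close>)
  qed
  then show ?thesis
  proof (rule wp_mono)
    fix t \<tau>
    assume *: "real t \<le> pot m e Y (width m a b) nd + 1 + bcost (NLess (V 6) (V 7)) \<and>
      (\<exists>\<psi>. I \<psi> \<tau>) \<and> \<not> bval (NLess (V 6) (V 7)) \<tau>"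
    then obtain \<psi> where I: "I \<psi> \<tau>" by blast
    obtain h where \<tau>: "\<tau> = (h, g)" using I by (cases \<tau>) (simp add: I_def)
    obtain ws where ws: "h 7 = h 6 + length (concat (map enc ws))" "h 0 = 0 \<or> h 0 = 1"
      "h 0 = 1 \<or> (\<exists>c\<in>set ws. has_dom m g c) \<longleftrightarrow> has_dom m g nd"
      using I by (auto simp: I_def \<tau>)
    \<comment> \<open>A block has at least its four header cells, so head and tail meet only when
      the queue is empty.\<close>
    have "ws = []" using * ws(1) by (cases ws) (auto simp: \<tau>)
    then show "real t \<le> pot m e Y (width m a b) nd + 6 \<and> fst \<tau> 0 = (if has_dom m g nd then 1 else 0)"
      using * ws by (auto simp: \<tau>)
  qed
qed

section \<open>Setting up the root\<close>

text \<open>Division by repeated addition, with the current multiple of \<open>y\<close> in cell 18.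
  For positive \<open>y\<close>, \<open>x\<close> rounds always reach \<open>x\<close>; once it is
  reached, the remaining rounds do nothing.\<close>

definition DivUp :: "nat \<Rightarrow> nexp \<Rightarrow> nexp \<Rightarrow> com" where
  "DivUp res x y = Seq (NSet (NConst res) (NConst 0)) (Seq (NSet (NConst 18) (NConst 0))
    (For 17 x (If (NLess (V 18) x)
      (Seq (NSet (NConst 18) (NAdd (V 18) y)) (NSet (NConst res) (NAdd (V res) (NConst 1)))) Skip)))"

text \<open>The second disjunct of the upper bound only matters for \<open>x = y = 0\<close>.\<close>

definition is_divup :: "nat \<Rightarrow> nat \<Rightarrow> nat \<Rightarrow> bool" where
  "is_divup d x y \<longleftrightarrow> x \<le> d * y \<and> (d * y < x + y \<or> d = 0)"

lemma wp_DivUp: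
  assumes x: "\<And>h. (\<forall>v. v \<notin> {res, 17, 18} \<longrightarrow> h v = f v) \<Longrightarrow> nval x (h, g) = X"
    and y: "\<And>h. (\<forall>v. v \<notin> {res, 17, 18} \<longrightarrow> h v = f v) \<Longrightarrow> nval y (h, g) = Y"
    and cost: "ncost x \<le> 2" "ncost y \<le> 2" and XY: "0 < X \<Longrightarrow> 0 < Y"
    and res: "res \<noteq> 17" "res \<noteq> 18"
    and post: "\<And>t h. t \<le> (X + 1) * 60 \<Longrightarrow> is_divup (h res) X Y \<Longrightarrow>
      (\<forall>v. v \<notin> {res, 17, 18} \<longrightarrow> h v = f v) \<Longrightarrow> Q t (h, g)"
  shows "wp (DivUp res x y) (f, g) Q"
  unfolding DivUp_def wp_Seq wp_NSet
\<comment> \<open>As long as the multiple is below \<open>X\<close>, no round has been idle and the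
  quotient equals the loop counter.\<close>
proof (rule wp_For[where K = X and B = 30 and I = "\<lambda>k h g'. g' = g \<and> h 18 = h res * Y \<and>
   (h 18 < X \<longrightarrow> h res = k) \<and> (h 18 < X + Y \<or> h res = 0) \<and>
   (\<forall>v. v \<notin> {res, 17, 18} \<longrightarrow> h v = f v)"], goal_cases)
  case 1
  show ?case using res by simp
next
  case (2 k h g')
  then show ?case using x by blast
next
  case (3 k h g')
  then have "nval x (h, g) = X" "nval y (h, g) = Y" using x y by blast+
  then show ?case using 3 cost res by (auto simp: wp_simps)
next
  case (4 t h g')
  have "X \<le> h res * Y"
  proof (rule ccontr)
    assume "\<not> ?thesis"
    then have "h res = X" "0 < X" "h res * Y < X" using 4(1) by auto
    then show False using XY by (metis Suc_leI mult.right_neutral mult_le_mono2 not_le One_nat_def)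
  qed
  moreover have "g' = g" using 4 by simp
  moreover have "(X + 1) * (30 + ncost x + 13) \<le> (X + 1) * 45"
    using cost by (intro mult_left_mono) auto
  then have "t \<le> (X + 1) * 45" using 4(3) by linarith
  ultimately show ?case using 4(1,2) cost by (simp only:) (rule post, auto simp: is_divup_def)
qed

definition Mul :: "nat \<Rightarrow> nexp \<Rightarrow> nexp \<Rightarrow> com" where
  "Mul res x y = Seq (NSet (NConst res) (NConst 0)) (For 17 x (NSet (NConst res) (NAdd (V res) y)))"

lemma wp_Mul:
  assumes x: "\<And>h. (\<forall>v. v \<notin> {res, 17} \<longrightarrow> h v = f v) \<Longrightarrow> nval x (h, g) = X"
    and y: "\<And>h. (\<forall>v. v \<notin> {res, 17} \<longrightarrow> h v = f v) \<Longrightarrow> nval y (h, g) = Y"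
    and cost: "ncost x \<le> 2" "ncost y \<le> 2" and res: "res \<noteq> 17"
    and post: "\<And>t h. t \<le> (X + 1) * 60 \<Longrightarrow> h res = X * Y \<Longrightarrow>
      (\<forall>v. v \<notin> {res, 17} \<longrightarrow> h v = f v) \<Longrightarrow> Q t (h, g)"
  shows "wp (Mul res x y) (f, g) Q"
  unfolding Mul_def wp_Seq wp_NSet
proof (rule wp_For[where K = X and B = 30 and I = "\<lambda>k h g'. g' = g \<and> h res = k * Y \<and>
   (\<forall>v. v \<notin> {res, 17} \<longrightarrow> h v = f v)"], goal_cases)
  case (2 k h g')
  then show ?case using x by blast
next
  case (3 k h g')
  then have "nval y (h, g) = Y" using y by blast
  then show ?case using 3 cost res by (auto simp: wp_simps)
next
  case (4 t h g')
  moreover have "g' = g" using 4 by simp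
  moreover have "(X + 1) * (30 + ncost x + 13) \<le> (X + 1) * 45"
    using cost by (intro mult_left_mono) auto
  then have "t \<le> (X + 1) * 45" using 4(3) by linarith
  ultimately show ?case using 4(1,2) cost by (simp only:) (rule post, auto)
qed (use res in simp)

text \<open>Cell 3 holds \<open>q + 1\<close>, which keeps the divisor of the budget positive even
  for \<open>q = 0\<close>. The added 4 makes \<open>e\<close> at least 4, as
  \<open>leaf_mass_bound\<close> uses. Cell 29 receives \<open>n * m\<close>, the address of
  \<open>r\<close>.\<close>

definition Parameters :: com where
  "Parameters =
    Seq (Seq (NSet (NConst 2) (V 0)) (NSet (NConst 0) (NConst 0)))
   (Seq (Mul 29 (V 2) (V 1))
   (Seq (DivUp 3 (V 1) (V 2))
   (Seq (NSet (NConst 3) (NAdd (V 3) (NConst 1)))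
   (Seq (DivUp 10 (V 2) (NConst 3))
   (Seq (Mul 30 (NConst 100) (V 3))
   (Seq (DivUp 4 (V 2) (V 30))
   (Seq (Mul 31 (NConst 64) (V 1))
   (Seq (DivUp 5 (V 31) (V 4))
        (NSet (NConst 5) (NAdd (V 5) (NConst 4)))))))))))"

lemma wp_Parameters:
  assumes f: "f 0 = n" "f 1 = m" and nm: "n = 0 \<Longrightarrow> m = 0"
    and post: "\<And>t h q d. t \<le> 20000 * (n + m + 1) \<Longrightarrow> h 0 = 0 \<Longrightarrow> h 1 = m \<Longrightarrow> h 2 = n \<Longrightarrow> h 29 = n * m \<Longrightarrow>
      is_divup (h 10) n 3 \<Longrightarrow> is_divup q m n \<Longrightarrow> is_divup (h 4) n (100 * (q + 1)) \<Longrightarrow>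
      is_divup d (64 * m) (h 4) \<Longrightarrow> h 5 = d + 4 \<Longrightarrow> Q t (h, g)"
  shows "wp Parameters (f, g) Q"
  unfolding Parameters_def
proof (rule wp_SeqI[where R = "\<lambda>t \<tau>. t = 7 \<and> \<tau> = (f(2 := n, 0 := 0), g)"], goal_cases)
  case 1
  show ?case using f by (simp add: wp_simps)
next
  case (2 t0 \<tau>0)
  then have t0: "t0 = 7" and \<tau>0: "\<tau>0 = (f(2 := n, 0 := 0), g)" by auto
  show ?case
    unfolding \<tau>0 wp_Seq
  proof (rule wp_Mul[where X = n and Y = m], goal_cases)
    case (6 t1 f1)
    have f1: "f1 0 = 0" "f1 1 = m" "f1 2 = n" using 6(3) f by simp_all
    show ?case
    proof (rule wp_DivUp[where X = m and Y = n], goal_cases)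
      case (8 t2 f2)
      define q where "q = f2 3"
      have f2: "f2 0 = 0" "f2 1 = m" "f2 2 = n" "f2 29 = n * m" using 8(3) f1 6(2) by simp_all
      let ?f2 = "f2(3 := q + 1)"
      have "wp (NSet (NConst 3) (NAdd (V 3) (NConst 1))) (f2, g) (\<lambda>t \<tau>. t = 6 \<and> \<tau> = (?f2, g))"
        by (simp add: wp_simps q_def)
      then show ?case
      proof (rule wp_mono, elim conjE, hypsubst, goal_cases)
        case 1
        show ?case
        proof (rule wp_DivUp[where X = n and Y = 3], goal_cases)
          case (8 t3 f3)
          have f3: "f3 0 = 0" "f3 1 = m" "f3 2 = n" "f3 29 = n * m" "f3 3 = q + 1" using 8(3) f2 by simp_all
          note n1 = 8(2) and t3 = 8(1)
          show ?case
          proof (rule wp_Mul[where X = 100 and Y = "q + 1"], goal_cases)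
            case (6 t4 f4)
            have f4: "f4 0 = 0" "f4 1 = m" "f4 2 = n" "f4 29 = n * m" "f4 10 = f3 10" using 6(3) f3 by simp_all
            note t4 = 6(1) and f430 = 6(2)
            show ?case
            proof (rule wp_DivUp[where X = n and Y = "100 * (q + 1)"], goal_cases)
              case (8 t5 f5)
              have f5: "f5 0 = 0" "f5 1 = m" "f5 2 = n" "f5 29 = n * m" "f5 10 = f3 10"
                using 8(3) f4 by simp_all
              note L = 8(2) and t5 = 8(1)
              show ?case
              proof (rule wp_Mul[where X = 64 and Y = m], goal_cases)
                case (6 t6 f6)
                have f6: "f6 0 = 0" "f6 1 = m" "f6 2 = n" "f6 29 = n * m" "f6 10 = f3 10" "f6 4 = f5 4"
                  using 6(3) f5 by simp_all
                note t6 = 6(1) and f631 = 6(2)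
                show ?case
                proof (rule wp_DivUp[where X = "64 * m" and Y = "f5 4"], goal_cases)
                  case (8 t7 f7)
                  have f7: "f7 0 = 0" "f7 1 = m" "f7 2 = n" "f7 29 = n * m" "f7 10 = f3 10" "f7 4 = f5 4"
                    using 8(3) f6 by simp_all
                  have *: "Q u (f7(5 := f7 5 + 4), g)"
                    if u: "u = t0 + (t1 + (t2 + (6 + (t3 + (t4 + (t5 + (t6 + (t7 + 6))))))))" for u
                  proof (rule post)
                    show "is_divup (f2 3) m n" by (rule \<open>is_divup (f2 3) m n\<close>)
                    show "is_divup (f7 5) (64 * m) ((f7(5 := f7 5 + 4)) 4)" using 8(2) f7 by simp
                    show "is_divup ((f7(5 := f7 5 + 4)) 4) n (100 * (f2 3 + 1))" using L f7 by (simp add: q_def)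
                    show "is_divup ((f7(5 := f7 5 + 4)) 10) n 3" using n1 f7 by simp
                    show "u \<le> 20000 * (n + m + 1)"
                      using u t0 6(1) t3 t4 t5 8(1) \<open>t1 \<le> (n + 1) * 60\<close> \<open>t2 \<le> (m + 1) * 60\<close>
                      by (simp add: algebra_simps)
                  qed (use f7 in simp_all)
                  have "Q (t0 + (t1 + (t2 + (6 + (t3 + (t4 + (t5 + (t6 + (t7 +
                      (1 + ncost (NConst 5) + ncost (NAdd (V 5) (NConst 4)))))))))))) (f7(5 := f7 5 + 4), g)"
                    by (rule *) simp
                  then show ?case by (simp only: wp_NSet nval.simps fst_conv)
                next
                  \<comment> \<open>Here \<open>m > 0\<close>, so \<open>n > 0\<close>, and the
                    budget, a rounded-up quotient of \<open>n\<close>, is positive.\<close>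
                  case 5
                  show ?case using L 5 nm by (auto simp: is_divup_def intro: Nat.gr0I)
                qed (use f6 f631 in simp_all)
              qed (use f5 in simp_all)
            qed (use f4 f430 in simp_all)
          qed (use f3 in simp_all)
        qed (use f2 in simp_all)
      qed
    next
      case 5
      then show ?case using nm by auto
    qed (use f1 in simp_all)
  qed (use f in simp_all)
qed

section \<open>Enumerating partial assignments\<close>

definition subset_sum :: "(nat \<Rightarrow> real) \<Rightarrow> int \<Rightarrow> (nat \<Rightarrow> nat \<Rightarrow> real) \<Rightarrow> nat \<Rightarrow> (nat \<Rightarrow> real) \<Rightarrow> nat \<Rightarrow> real" where
  "subset_sum u s M i z j = u j + of_int s * (\<Sum>t<i. M t j * z t)"

text \<open>Offset \<open>r\<close> and sign -1 give the vectors of \<open>A\<close>, offset 0 and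
  sign 1 those of \<open>B\<close>. Two inclusions are stated rather than an indexed list, so the
  order of enumeration does not have to be tracked.\<close>

definition lists_sums ::
    "nat \<Rightarrow> (nat \<Rightarrow> real) \<Rightarrow> (nat \<Rightarrow> real) \<Rightarrow> int \<Rightarrow> (nat \<Rightarrow> nat \<Rightarrow> real) \<Rightarrow> nat \<Rightarrow> nat list \<Rightarrow> bool" where
  "lists_sums m g u s M i xs \<longleftrightarrow>
    (\<forall>x\<in>set xs. \<exists>z. (\<forall>t<i. z t \<in> {0, 1}) \<and> (\<forall>j<m. g (x + j) = subset_sum u s M i z j)) \<and>
    (\<forall>z. (\<forall>t<i. z t \<in> {0, 1}) \<longrightarrow> (\<exists>x\<in>set xs. \<forall>j<m. g (x + j) = subset_sum u s M i z j))"

lemma subset_sum_Suc_upd: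
  "subset_sum u s M (Suc i) (z(i := c)) j = subset_sum u s M i z j + of_int s * (M i j * c)"
proof -
  have "(\<Sum>t<i. M t j * (z(i := c)) t) = (\<Sum>t<i. M t j * z t)"
    by (rule sum.cong) auto
  then show ?thesis by (simp add: subset_sum_def distrib_left)
qed

text \<open>The old pointers represent the value 0 of the new variable, the pointers in
  \<open>ys\<close> the value 1.\<close>

lemma lists_sums_Suc:
  assumes xs: "lists_sums m g u s M i xs"
    and old: "\<And>x j. x \<in> set xs \<Longrightarrow> j < m \<Longrightarrow> g' (x + j) = g (x + j)"
    and len: "length ys = length xs"
    and new: "\<And>k j. k < length xs \<Longrightarrow> j < m \<Longrightarrow> g' (ys ! k + j) = g (xs ! k + j) + of_int s * M i j"
  shows "lists_sums m g' u s M (Suc i) (xs @ ys)"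
  unfolding lists_sums_def
proof (intro conjI ballI allI impI)
  fix x assume "x \<in> set (xs @ ys)"
  then consider "x \<in> set xs" | k where "k < length xs" "x = ys ! k"
    using len by (auto simp: in_set_conv_nth)
  then show "\<exists>z. (\<forall>t<Suc i. z t \<in> {0, 1}) \<and> (\<forall>j<m. g' (x + j) = subset_sum u s M (Suc i) z j)"
  proof cases
    case 1
    then obtain z where z: "\<forall>t<i. z t \<in> {0, 1}" "\<forall>j<m. g (x + j) = subset_sum u s M i z j"
      using xs unfolding lists_sums_def by blast
    have "\<forall>j<m. g' (x + j) = subset_sum u s M (Suc i) (z(i := 0)) j"
      using z(2) old 1 by (simp add: subset_sum_Suc_upd)
    then show ?thesis using z(1) by (intro exI[of _ "z(i := 0)"]) (auto simp: less_Suc_eq)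
  next
    case 2
    then have "xs ! k \<in> set xs" by simp
    then obtain z where z: "\<forall>t<i. z t \<in> {0, 1}" "\<forall>j<m. g (xs ! k + j) = subset_sum u s M i z j"
      using xs unfolding lists_sums_def by blast
    have "\<forall>j<m. g' (x + j) = subset_sum u s M (Suc i) (z(i := 1)) j"
      using z(2) new[OF 2(1)] 2 by (simp add: subset_sum_Suc_upd)
    then show ?thesis using z(1) by (intro exI[of _ "z(i := 1)"]) (auto simp: less_Suc_eq)
  qed
next
  fix z :: "nat \<Rightarrow> real"
  assume z: "\<forall>t<Suc i. z t \<in> {0, 1}"
  then have "\<forall>t<i. z t \<in> {0, 1}" by simp
  then obtain x where x: "x \<in> set xs" "\<forall>j<m. g (x + j) = subset_sum u s M i z j"
    using xs unfolding lists_sums_def by blast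
  obtain k where k: "k < length xs" "x = xs ! k" using x(1) by (auto simp: in_set_conv_nth)
  have S: "subset_sum u s M (Suc i) z j = subset_sum u s M i z j + of_int s * (M i j * z i)" for j
    by (simp add: subset_sum_def distrib_left)
  consider "z i = 0" | "z i = 1" using z by auto
  then show "\<exists>x\<in>set (xs @ ys). \<forall>j<m. g' (x + j) = subset_sum u s M (Suc i) z j"
  proof cases
    case 1
    then show ?thesis using x old by (intro bexI[of _ x]) (auto simp: S)
  next
    case 2
    then show ?thesis using x k len new by (intro bexI[of _ "ys ! k"]) (auto simp: S)
  qed
qed

lemma lists_sums_0:
  "lists_sums m g u s M 0 [x] \<longleftrightarrow> (\<forall>j<m. g (x + j) = u j)"
  by (auto simp: lists_sums_def subset_sum_def)

lemma lists_sums_cong: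
  assumes "\<And>x j. x \<in> set xs \<Longrightarrow> j < m \<Longrightarrow> g' (x + j) = g (x + j)"
  shows "lists_sums m g' u s M i xs = lists_sums m g u s M i xs"
  using assms unfolding lists_sums_def by (simp cong: bex_cong ball_cong)

text \<open>New pointers are stored right behind the list, but its length in cell 12 is doubled only
  after the loop, so the loop runs over the old entries alone. Cell 9 then moves on to the next row
  of \<open>M\<close>.\<close>

definition Double :: "int \<Rightarrow> com" where
  "Double s =
    Seq (ForList 19 20 (V 11) (V 12)
      (Seq (For 21 (V 1) (RSet (NAdd (V 8) (V 21)) (RAdd (RGet (NAdd (V 20) (V 21)))
             (RMul (RConst s) (RGet (NAdd (V 9) (V 21)))))))
      (Seq (NSet (NAdd (NAdd (V 11) (V 12)) (V 19)) (V 8))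
           (NSet (NConst 8) (NAdd (V 8) (V 1))))))
   (Seq (NSet (NConst 12) (NAdd (V 12) (V 12)))
        (NSet (NConst 9) (NAdd (V 9) (V 1))))"

lemma wp_Double:
  fixes s :: int
  assumes xs: "holds f p xs" "f 11 = p" "f 12 = length xs" "100 \<le> p"
    and m: "f 1 = m" and row: "f 9 = row" "row + m \<le> fr" and fr: "f 8 = fr"
      "\<And>x. x \<in> set xs \<Longrightarrow> x + m \<le> fr" "\<And>v. fr \<le> v \<Longrightarrow> g v = 0"
    and post: "\<And>t h g' ys. t \<le> (length xs + 1) * ((m + 1) * 150) \<Longrightarrow>
      length ys = length xs \<Longrightarrow> holds h p (xs @ ys) \<Longrightarrow>
      h 12 = 2 * length xs \<Longrightarrow> h 9 = row + m \<Longrightarrow> fr \<le> h 8 \<Longrightarrow>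
      (\<And>v. v < fr \<Longrightarrow> g' v = g v) \<Longrightarrow> (\<And>v. h 8 \<le> v \<Longrightarrow> g' v = 0) \<Longrightarrow>
      (\<And>y. y \<in> set ys \<Longrightarrow> y + m \<le> h 8) \<Longrightarrow>
      (\<And>k j. k < length xs \<Longrightarrow> j < m \<Longrightarrow> g' (ys ! k + j) = g (xs ! k + j) + of_int s * g (row + j)) \<Longrightarrow>
      (\<And>v. v \<notin> {8, 9, 12, 19, 20, 21} \<Longrightarrow> v < p \<Longrightarrow> h v = f v) \<Longrightarrow> Q t (h, g')"
  shows "wp (Double s) (f, g) Q"
proof -
  let ?n = "length xs"
  let ?ys = "\<lambda>k. map (\<lambda>i. fr + i * m) [0..<k]"
  \<comment> \<open>The copy made in round \<open>i\<close> occupies the \<open>m\<close> real cells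
    from \<open>fr + i * m\<close>; everything behind the copies is still 0.\<close>
  define I where "I = (\<lambda>k h g'. h 8 = fr + k * m \<and> holds h p (xs @ ?ys k) \<and>
    (\<forall>v. v \<notin> {8, 19, 20, 21} \<longrightarrow> v < p \<longrightarrow> h v = f v) \<and> (\<forall>v<fr. g' v = g v) \<and>
    (\<forall>v\<ge>fr + k * m. g' v = 0) \<and>
    (\<forall>i<k. \<forall>j<m. g' (fr + i * m + j) = g (xs ! i + j) + of_int s * g (row + j)))"
  show ?thesis
    unfolding Double_def wp_Seq
  proof (rule wp_ForList[where xs = xs and ?p0.0 = p and I = I and B = "(m + 1) * 80"], goal_cases)
    case 1
    have "holds (f(19 := 0)) p xs"
      by (subst holds_cong[where h = f]) (use xs in auto)
    then show ?case using fr xs by (simp add: I_def)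
  next
    case (3 k h g')
    then show ?case using xs by (simp add: I_def holds_append)
  next
    case (4 k h g')
    let ?x = "xs ! k"
    have I: "h 8 = fr + k * m" "holds h p (xs @ ?ys k)"
      "\<And>v. v \<notin> {8, 19, 20, 21} \<Longrightarrow> v < p \<Longrightarrow> h v = f v" "\<And>v. v < fr \<Longrightarrow> g' v = g v"
      "\<And>v. fr + k * m \<le> v \<Longrightarrow> g' v = 0"
      "\<And>i j. i < k \<Longrightarrow> j < m \<Longrightarrow> g' (fr + i * m + j) = g (xs ! i + j) + of_int s * g (row + j)"
      using 4(2) unfolding I_def by auto
    have x: "?x + m \<le> fr" using fr(2) 4(1) by simp
    \<comment> \<open>The real memory after \<open>j\<close> coordinates of the current copy have
      been written.\<close>
    define G where "G = (\<lambda>j v. if fr + k * m \<le> v \<and> v < fr + k * m + j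
      then g (?x + (v - (fr + k * m))) + of_int s * g (row + (v - (fr + k * m))) else g' v)"
    have h: "h 1 = m" "h 9 = row" "h 11 = p" "h 12 = ?n" using I(3) m row xs by simp_all
    show ?case
      unfolding wp_Seq
    proof (rule wp_For[where K = m and B = 40 and I = "\<lambda>j h1 g1. g1 = G j \<and>
        (\<forall>v. v \<noteq> 21 \<longrightarrow> h1 v = (h(20 := ?x)) v)"], goal_cases)
      case 1
      show ?case by (simp add: G_def fun_eq_iff)
    next
      case (2 j h1 g1)
      then show ?case using h by simp
    next
      case (3 j h1 g1)
      have v: "h1 8 = fr + k * m" "h1 9 = row" "h1 20 = ?x" "h1 21 = j" using 3 I(1) h by simp_all
      have "G j (?x + j) = g (?x + j)" "G j (row + j) = g (row + j)"
        using 3(1) x row(2) I(4) by (simp_all add: G_def)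
      then have "(G j)(fr + k * m + j := G j (?x + j) + of_int s * G j (row + j)) = G (Suc j)"
        by (auto simp: G_def fun_eq_iff)
      then show ?case using 3 v by (simp add: wp_simps)
    next
      case (4 t h1 g1)
      have v: "h1 8 = fr + k * m" "h1 11 = p" "h1 12 = ?n" "h1 19 = k" "h1 1 = m"
        using 4 I(1) h \<open>h 19 = k\<close> by simp_all
      let ?h = "h1(p + ?n + k := fr + k * m, 8 := fr + k * m + m)"
      have "I (Suc k) (?h(19 := Suc k)) (G m)"
        unfolding I_def
      proof (intro conjI allI impI)
        have "holds (?h(19 := Suc k)) p (xs @ ?ys k)"
          by (subst holds_cong[where h = h]) (use xs 4 I(2) in auto)
        then show "holds (?h(19 := Suc k)) p (xs @ ?ys (Suc k))"
          using xs(4) by (simp add: holds_append holds_Cons holds_Nil add.assoc)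
        show "(?h(19 := Suc k)) v = f v" if "v \<notin> {8, 19, 20, 21}" "v < p" for v
          using that 4(1) I(3) xs(4) by simp
        show "G m v = g v" if "v < fr" for v using that I(4) by (simp add: G_def)
        show "G m v = 0" if "v \<ge> fr + Suc k * m" for v using that I(5) by (simp add: G_def)
        show "G m (fr + i * m + j) = g (xs ! i + j) + of_int s * g (row + j)"
          if ij: "i < Suc k" "j < m" for i j
        proof (cases "i = k")
          case True
          then show ?thesis using ij by (simp add: G_def)
        next
          case False
          then have "Suc i * m \<le> k * m" using ij by (intro mult_le_mono1) simp
          then have "i * m + j < k * m" using ij by simp
          then show ?thesis using I(6)[of i j] False ij by (simp add: G_def)
        qed
      qed simp
      then show ?case using 4 v xs(4) by (simp add: wp_simps algebra_simps)
    qed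
  next
    case (5 t h g')
    have I: "h 8 = fr + ?n * m" "holds h p (xs @ ?ys ?n)"
      "\<And>v. v \<notin> {8, 19, 20, 21} \<Longrightarrow> v < p \<Longrightarrow> h v = f v" "\<And>v. v < fr \<Longrightarrow> g' v = g v"
      "\<And>v. fr + ?n * m \<le> v \<Longrightarrow> g' v = 0"
      "\<And>i j. i < ?n \<Longrightarrow> j < m \<Longrightarrow> g' (fr + i * m + j) = g (xs ! i + j) + of_int s * g (row + j)"
      using 5(1) unfolding I_def by auto
    let ?h = "h(12 := 2 * ?n, 9 := row + m)"
    have Q: "Q u (?h, g')" if u: "u = t + 14" for u
    proof (rule post[where ys = "?ys ?n"])
      have "t \<le> (?n + 1) * ((m + 1) * 110)" using 5(3) by (simp add: algebra_simps)
      then show "u \<le> (?n + 1) * ((m + 1) * 150)" using u by (simp add: algebra_simps)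
      show "holds ?h p (xs @ ?ys ?n)"
        by (subst holds_cong[where h = h]) (use xs I(2) in auto)
      show "y + m \<le> ?h 8" if "y \<in> set (?ys ?n)" for y
      proof -
        obtain i where i: "i < ?n" "y = fr + i * m" using \<open>y \<in> set (?ys ?n)\<close> by auto
        then have "Suc i * m \<le> ?n * m" by (intro mult_le_mono1) simp
        then show ?thesis using I(1) i by simp
      qed
    qed (use I xs(4) in auto)
    have "Q (t + ((1 + ncost (NConst 12) + ncost (NAdd (V 12) (V 12))) + (1 + ncost (NConst 9) + ncost (NAdd (V 9) (V 1))))) (?h, g')"
      by (rule Q) simp
    moreover have "h 12 = ?n" "h 9 = row" "h 1 = m" using I(3) xs m row by simp_all
    ultimately show ?case by (simp add: wp_NSet mult_2 flip: add.assoc)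
  qed simp
qed

definition Build :: "nexp \<Rightarrow> int \<Rightarrow> com" where
  "Build e s = For 22 e (Double s)"

text \<open>Each of the \<open>k\<close> rounds is charged as if the list already had full length,
  which loses only a factor linear in \<open>k\<close>.\<close>

lemma wp_Build:
  fixes s :: int
  assumes mem: "f p = x0" "f 11 = p" "f 12 = 1" "100 \<le> p"
    and m: "f 1 = m" and row: "f 9 = row" "row + k * m \<le> fr" and fr: "f 8 = fr"
      "x0 + m \<le> fr" "\<And>v. fr \<le> v \<Longrightarrow> g v = 0"
    and e: "\<And>h. (\<forall>v. v \<notin> {8, 9, 12, 19, 20, 21, 22} \<longrightarrow> v < p \<longrightarrow> h v = f v) \<Longrightarrow> nval e (h, g) = k"
      "\<And>h g g'. nval e (h, g) = nval e (h, g')" "ncost e \<le> 10"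
    and M: "\<And>i j. i < k \<Longrightarrow> j < m \<Longrightarrow> g (row + i * m + j) = M i j"
    and u: "\<And>j. j < m \<Longrightarrow> g (x0 + j) = u j"
    and post: "\<And>t h g' xs. t \<le> (k + 1) * (2 ^ k * ((m + 1) * 400)) \<Longrightarrow>
      length xs = 2 ^ k \<Longrightarrow> holds h p xs \<Longrightarrow> h 12 = 2 ^ k \<Longrightarrow> h 9 = row + k * m \<Longrightarrow>
      fr \<le> h 8 \<Longrightarrow> (\<And>v. v < fr \<Longrightarrow> g' v = g v) \<Longrightarrow> (\<And>v. h 8 \<le> v \<Longrightarrow> g' v = 0) \<Longrightarrow>
      (\<And>x. x \<in> set xs \<Longrightarrow> x + m \<le> h 8) \<Longrightarrow> lists_sums m g' u s M k xs \<Longrightarrow>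
      (\<And>v. v \<notin> {8, 9, 12, 19, 20, 21, 22} \<Longrightarrow> v < p \<Longrightarrow> h v = f v) \<Longrightarrow> Q t (h, g')"
  shows "wp (Build e s) (f, g) Q"
proof -
  define I where "I = (\<lambda>i h g'. \<exists>xs. length xs = 2 ^ i \<and> holds h p xs \<and> h 12 = 2 ^ i \<and> h 9 = row + i * m \<and>
    fr \<le> h 8 \<and> (\<forall>v<fr. g' v = g v) \<and> (\<forall>v\<ge>h 8. g' v = 0) \<and> (\<forall>x\<in>set xs. x + m \<le> h 8) \<and>
    lists_sums m g' u s M i xs \<and>
    (\<forall>v. v \<notin> {8, 9, 12, 19, 20, 21, 22} \<longrightarrow> v < p \<longrightarrow> h v = f v))"
  show ?thesis
    unfolding Build_def
  proof (rule wp_For[where K = k and I = I and B = "2 ^ k * ((m + 1) * 300)"], goal_cases)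
    case 1
    show ?case unfolding I_def
      by (rule exI[of _ "[x0]"]) (use mem m row fr u in \<open>auto simp: holds_Cons holds_Nil lists_sums_0\<close>)
  next
    case (2 i h g')
    then show ?case using e(1)[of h] e(2)[of h g g'] unfolding I_def by metis
  next
    case (3 i h g')
    obtain xs where xs: "length xs = 2 ^ i" "holds h p xs" "h 12 = 2 ^ i" "h 9 = row + i * m"
      "fr \<le> h 8" "\<And>v. v < fr \<Longrightarrow> g' v = g v" "\<And>v. h 8 \<le> v \<Longrightarrow> g' v = 0"
      "\<And>x. x \<in> set xs \<Longrightarrow> x + m \<le> h 8" "lists_sums m g' u s M i xs"
      "\<And>v. v \<notin> {8, 9, 12, 19, 20, 21, 22} \<Longrightarrow> v < p \<Longrightarrow> h v = f v"
      using 3(2) unfolding I_def by auto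
    have "Suc i * m \<le> k * m" using 3(1) by (intro mult_le_mono1) simp
    then have r: "row + i * m + m \<le> fr" using row(2) by simp
    show ?case
    proof (rule wp_Double[where p = p and xs = xs and m = m and row = "row + i * m" and fr = "h 8"], goal_cases)
      case (11 t h1 g1 ys)
      have "lists_sums m g1 u s M (Suc i) (xs @ ys)"
      proof (rule lists_sums_Suc[OF xs(9)])
        show "g1 (x + j) = g' (x + j)" if "x \<in> set xs" "j < m" for x j
          using 11(7) xs(8)[OF that(1)] that(2) by simp
        show "g1 (ys ! l + j) = g' (xs ! l + j) + of_int s * M i j" if "l < length xs" "j < m" for l j
          using 11(10)[OF that] xs(6)[of "row + i * m + j"] M[OF 3(1) that(2)] that r by simp
      qed (rule 11(2))
      moreover have "holds (h1(22 := Suc i)) p (xs @ ys)"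
        by (subst holds_cong[where h = h1]) (use 11(3) mem in auto)
      moreover have "x + m \<le> h1 8" if "x \<in> set (xs @ ys)" for x
        using that 11(6,9) xs(8) by (auto intro: order_trans)
      ultimately have "I (Suc i) (h1(22 := Suc i)) g1"
        unfolding I_def using 11 xs mem
        by (intro exI[of _ "xs @ ys"]) (auto intro: order_trans)
      moreover have "t \<le> 2 ^ k * ((m + 1) * 300)"
      proof -
        have "(2::nat) ^ i \<le> 2 ^ k" using 3(1) by (intro power_increasing) auto
        then have "length xs + 1 \<le> 2 ^ k * 2" using xs(1) one_le_power[of "2::nat" k] by linarith
        then have "(length xs + 1) * ((m + 1) * 150) \<le> 2 ^ k * 2 * ((m + 1) * 150)"
          by (rule mult_le_mono1)
        then show ?thesis using 11(1) by (simp add: algebra_simps)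
      qed
      moreover have "h1 22 = i" using 11(11)[of 22] 3(3) mem(4) by simp
      ultimately show ?case by simp
    qed (use xs mem m r in \<open>auto simp: add.assoc\<close>)
  next
    case (4 t h g')
    obtain xs where xs: "length xs = 2 ^ k" "holds h p xs" "h 12 = 2 ^ k" "h 9 = row + k * m"
      "fr \<le> h 8" "\<And>v. v < fr \<Longrightarrow> g' v = g v" "\<And>v. h 8 \<le> v \<Longrightarrow> g' v = 0"
      "\<And>x. x \<in> set xs \<Longrightarrow> x + m \<le> h 8" "lists_sums m g' u s M k xs"
      "\<And>v. v \<notin> {8, 9, 12, 19, 20, 21, 22} \<Longrightarrow> v < p \<Longrightarrow> h v = f v"
      using 4(1) unfolding I_def by auto
    show ?case
    proof (rule post[OF _ xs])
      have "1 * 1 \<le> 2 ^ k * (m + 1)" by (intro mult_le_mono) auto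
      then have "2 ^ k * ((m + 1) * 300) + ncost e + 13 \<le> 2 ^ k * ((m + 1) * 400)"
        using e(3) by (simp add: algebra_simps)
      then have "(k + 1) * (2 ^ k * ((m + 1) * 300) + ncost e + 13) \<le> (k + 1) * (2 ^ k * ((m + 1) * 400))"
        by (rule mult_le_mono2)
      then show "t \<le> (k + 1) * (2 ^ k * ((m + 1) * 400))" using 4(3) by linarith
    qed
  qed
qed

text \<open>The root block is assembled in place: header in cells 100 to 103, \<open>A\<close> from
  104, \<open>B\<close> right behind it. The first vector of \<open>A\<close> is \<open>r\<close>
  itself inside the input, that of \<open>B\<close> a fresh block of zeros. The row pointer is not
  reset in between, so \<open>B\<close> continues with the remaining variables.\<close>

definition Setup :: com where
  "Setup =
    Seq (Seq (NSet (NConst 6) (NConst 100))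
        (Seq (NSet (NConst 100) (NConst 0))
        (Seq (NSet (NConst 101) (V 4))
        (Seq (NSet (NConst 11) (NConst 104))
        (Seq (NSet (NConst 104) (V 29))
        (Seq (NSet (NConst 12) (NConst 1))
        (Seq (NSet (NConst 9) (NConst 0))
             (NSet (NConst 8) (NAdd (V 29) (V 1))))))))))
   (Seq (Build (V 10) (- 1))
   (Seq (Seq (NSet (NConst 102) (V 12))
        (Seq (NSet (NConst 11) (NAdd (V 11) (V 12)))
        (Seq (NSet (V 11) (V 8))
        (Seq (NSet (NConst 8) (NAdd (V 8) (V 1)))
             (NSet (NConst 12) (NConst 1))))))
   (Seq (Build (NSub (V 2) (V 10)) 1)
        (Seq (NSet (NConst 103) (V 12))
             (NSet (NConst 7) (NAdd (V 11) (V 12)))))))"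

lemma wp_Setup:
  fixes g :: "nat \<Rightarrow> real"
  assumes f: "f 0 = 0" "f 1 = m" "f 2 = n" "f 29 = n * m" "f 10 = n1" "f 4 = L" "f 5 = e" and n1: "n1 \<le> n"
    and g: "g = snd (ilp_input n m M r)"
    and post: "\<And>t h g' A B. t \<le> (n + 1) * ((2 ^ n1 + 2 ^ (n - n1)) * ((m + 1) * 500)) \<Longrightarrow>
      length A = 2 ^ n1 \<Longrightarrow> length B = 2 ^ (n - n1) \<Longrightarrow>
      holds h 100 (enc (A, B, 0, L)) \<Longrightarrow> h 6 = 100 \<Longrightarrow> h 7 = 100 + length (enc (A, B, 0, L)) \<Longrightarrow>
      h 0 = 0 \<Longrightarrow> h 1 = m \<Longrightarrow> h 5 = e \<Longrightarrow>
      lists_sums m g' r (- 1) M n1 A \<Longrightarrow> lists_sums m g' (\<lambda>_. 0) 1 (\<lambda>i. M (n1 + i)) (n - n1) B \<Longrightarrow> Q t (h, g')"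
  shows "wp Setup (f, g) Q"
proof -
  have gM: "g (i * m + j) = M i j" if "i < n" "j < m" for i j
  proof -
    have "Suc i * m \<le> n * m" using that by (intro mult_le_mono1) simp
    then show ?thesis using that by (simp add: g ilp_input_def)
  qed
  have gr: "g (n * m + j) = r j" if "j < m" for j using that by (simp add: g ilp_input_def)
  have g0: "g v = 0" if "n * m + m \<le> v" for v using that by (simp add: g ilp_input_def)
  define f1 where "f1 = f(6 := 100, 100 := 0, 101 := L, 11 := 104, 104 := n * m, 12 := 1, 9 := 0, 8 := n * m + m)"
  have n1m: "n1 * m \<le> n * m" using n1 by (rule mult_le_mono1)
  show ?thesis
    unfolding Setup_def
  proof (rule wp_SeqI[where R = "\<lambda>t \<tau>. t \<le> 60 \<and> \<tau> = (f1, g)"], goal_cases)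
    case 1
    show ?case using f by (simp add: wp_simps f1_def)
  next
    case (2 t0 \<tau>0)
    then have t0: "t0 \<le> 60" and \<tau>0: "\<tau>0 = (f1, g)" by auto
    show ?case
      unfolding \<tau>0
      apply (subst wp_Seq)
    proof (rule wp_Build[where p = 104 and ?x0.0 = "n * m" and m = m and row = 0 and fr = "n * m + m" and k = n1
          and M = M and u = r], goal_cases)
      case (16 t1 h1 g1 A)
      have fr: "h1 v = f1 v" if "v \<notin> {8, 9, 12, 19, 20, 21, 22}" "v < 104" for v using 16(11) that .
      note xA = 16(9) and out = 16
      let ?p = "104 + 2 ^ n1 :: nat"
      define f2 where "f2 = h1(102 := 2 ^ n1, 11 := ?p, ?p := h1 8, 8 := h1 8 + m, 12 := 1)"
      have f2: "f2 v = f1 v" if "v \<notin> {8, 9, 11, 12, 19, 20, 21, 22, 102}" "v < 104" for v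
        using fr that by (simp add: f2_def)
      have f2s: "f2 ?p = h1 8" "f2 11 = ?p" "f2 12 = 1" "f2 1 = m" "f2 9 = n1 * m" "f2 8 = h1 8 + m"
        using f2[of 1] f 16(5) by (simp_all add: f2_def f1_def)
      show ?case
      proof (rule wp_SeqI[where R = "\<lambda>t \<tau>. t \<le> 40 \<and> \<tau> = (f2, g1)"], goal_cases)
        case 1
        show ?case using 16(4) fr f by (simp add: wp_simps f2_def f1_def fun_upd_twist)
      next
        case (2 t2 \<tau>2)
        then have t2: "t2 \<le> 40" and \<tau>2: "\<tau>2 = (f2, g1)" by auto
        show ?case
          unfolding \<tau>2 wp_Seq
        proof (rule wp_Build[where p = ?p and ?x0.0 = "h1 8" and m = m and row = "n1 * m" and fr = "h1 8 + m" and k = "n - n1"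
          and M = "\<lambda>i. M (n1 + i)" and u = "\<lambda>_. 0"], goal_cases)
          case 7
          have "n1 * m + (n - n1) * m = n * m" using n1 by (simp flip: distrib_right)
          then show ?case using 16(6) by simp
        next
          case (14 i j)
          have "Suc (n1 + i) * m \<le> n * m" using 14 n1 by (intro mult_le_mono1) simp
          moreover have "n1 * m + i * m + j = (n1 + i) * m + j" by (simp add: distrib_right)
          ultimately show ?case using 14 16(7) gM[of "n1 + i" j] n1 by simp
        next
          case (16 t3 h3 g3 B)
          note B = this
          note A = \<open>length A = 2 ^ n1\<close> \<open>holds h1 104 A\<close> \<open>lists_sums m g1 r (- 1) M n1 A\<close>
          have fr3: "h3 v = f2 v" if "v \<notin> {8, 9, 12, 19, 20, 21, 22}" "v < ?p" for v
            using B(11) that .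
          have h3s: "h3 6 = 100" "h3 0 = 0" "h3 1 = m" "h3 5 = e"
            using fr3[of 6] fr3[of 0] fr3[of 1] fr3[of 5] f2[of 6] f2[of 0] f2[of 1] f2[of 5] f
            by (simp_all add: f1_def)
          let ?h = "h3(103 := 2 ^ (n - n1), 7 := ?p + 2 ^ (n - n1))"
          have Q: "Q u (?h, g3)" if u: "u = t0 + (t1 + (t2 + (t3 + 11)))" for u
          proof (rule post[OF _ A(1) B(2)])
            have "t1 \<le> (n + 1) * (2 ^ n1 * ((m + 1) * 400))"
              using n1 \<open>t1 \<le> (n1 + 1) * _\<close> by (elim order_trans) (intro mult_le_mono1, simp)
            moreover have "t3 \<le> (n + 1) * (2 ^ (n - n1) * ((m + 1) * 400))"
              using n1 B(1) by (elim order_trans) (intro mult_le_mono1, simp)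
            moreover have "t0 + t2 + 11 \<le> (n + 1) * (2 ^ n1 * ((m + 1) * 100)) + (n + 1) * (2 ^ (n - n1) * ((m + 1) * 100))"
            proof -
              have "1 * (1 * (1 * 100)) \<le> (n + 1) * (2 ^ k * ((m + 1) * 100))" for k :: nat
                by (intro mult_le_mono) auto
              from this[of n1] this[of "n - n1"] show ?thesis using t0 t2 by linarith
            qed
            ultimately show "u \<le> (n + 1) * ((2 ^ n1 + 2 ^ (n - n1)) * ((m + 1) * 500))"
              using u by (simp add: algebra_simps)
            have "holds ?h 104 A"
              by (subst holds_cong[where h = h1]) (use A fr3 in \<open>auto simp: f2_def\<close>)
            moreover have "holds ?h ?p B"
              by (subst holds_cong[where h = h3]) (use B(3) in auto)
            moreover have "?h 100 = 0" "?h 101 = L" "?h 102 = 2 ^ n1" "?h 103 = 2 ^ (n - n1)"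
              using fr3 fr by (simp_all add: f2_def f1_def)
            ultimately show "holds ?h 100 (enc (A, B, 0, L))"
              using A(1) B(2) by (simp add: holds_Cons holds_append)
            show "lists_sums m g3 r (- 1) M n1 A"
            proof (subst lists_sums_cong[where g = g1])
              show "g3 (x + j) = g1 (x + j)" if "x \<in> set A" "j < m" for x j
                using B(7)[of "x + j"] xA[OF that(1)] that(2) by simp
            qed (rule A(3))
          qed (use A(1) B(2,10) h3s in simp_all)
          have "Q (t0 + (t1 + (t2 + (t3 + ((1 + ncost (NConst 103) + ncost (V 12)) +
              (1 + ncost (NConst 7) + ncost (NAdd (V 11) (V 12)))))))) (?h, g3)"
            by (rule Q) simp
          moreover have "h3 12 = 2 ^ (n - n1)" "h3 11 = ?p" using B(4) fr3 by (simp_all add: f2_def)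
          ultimately show ?case by (simp add: wp_NSet)
        next
          case 10
          then show ?case using out(8) by simp
        next
          case (11 h)
          have "h 2 = n" "h 10 = n1" using 11 f2 f by (simp_all add: f1_def)
          then show ?case by simp
        next
          \<comment> \<open>Real cells from the first free one on are still 0, so they serve as the
            zero vector.\<close>
          case (15 j)
          then show ?case using out(8) by simp
        qed (use f2s in simp_all)
      qed
    next
      case 7
      show ?case using n1m by linarith
    qed (use f n1 gM gr g0 in \<open>auto simp: f1_def\<close>)
  qed
qed

text \<open>With the sum split at \<open>n1\<close>, each constraint reads
  \<open>r - S1 <= S2\<close>, where \<open>S1\<close> is the contribution of the first part and
  \<open>S2\<close> that of the second.\<close>

lemma sums_dominate:
  assumes n1: "n1 \<le> n" and A: "lists_sums m g r (- 1) M n1 A"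
    and B: "lists_sums m g (\<lambda>_. 0) 1 (\<lambda>i. M (n1 + i)) (n - n1) B"
  shows "has_dom m g (A, B, j, l) \<longleftrightarrow> ilp_feasible n m M r"
proof -
  have S: "(\<Sum>t<n1. M t j * x t) + (\<Sum>t<n - n1. M (n1 + t) j * x (n1 + t)) = (\<Sum>t<n. M t j * x t)" for x :: "nat \<Rightarrow> real" and j
  proof -
    have "(\<Sum>t<n. M t j * x t) = (\<Sum>t<n1. M t j * x t) + (\<Sum>t\<in>{n1..<n}. M t j * x t)"
      using n1 by (simp add: sum.atLeastLessThan_concat flip: atLeast0LessThan)
    also have "(\<Sum>t\<in>{n1..<n}. M t j * x t) = (\<Sum>t<n - n1. M (n1 + t) j * x (n1 + t))"
      using n1 by (intro sum.reindex_bij_witness[of _ "\<lambda>t. n1 + t" "\<lambda>t. t - n1"]) auto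
    finally show ?thesis by simp
  qed
  show ?thesis
  proof
    assume "has_dom m g (A, B, j, l)"
    then obtain a b where ab: "a \<in> set A" "b \<in> set B" "\<And>j. j < m \<Longrightarrow> g (a + j) \<le> g (b + j)"
      by (auto simp: dom_def)
    obtain y where y: "\<forall>t<n1. y t \<in> {0, 1}" "\<forall>j<m. g (a + j) = subset_sum r (- 1) M n1 y j"
      using A ab unfolding lists_sums_def by blast
    obtain z where z: "\<forall>t<n - n1. z t \<in> {0, 1}" "\<forall>j<m. g (b + j) = subset_sum (\<lambda>_. 0) 1 (\<lambda>i. M (n1 + i)) (n - n1) z j"
      using B ab unfolding lists_sums_def by blast
    \<comment> \<open>Glue the two partial assignments together.\<close>
    let ?x = "\<lambda>t. if t < n1 then y t else z (t - n1)"
    show "ilp_feasible n m M r"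
      unfolding ilp_feasible_def
    proof (intro exI[of _ ?x] conjI allI impI)
      show "?x i \<in> {0, 1}" if "i < n" for i using that y(1) z(1) by auto
      show "r j \<le> (\<Sum>t<n. M t j * ?x t)" if j: "j < m" for j
        using ab(3)[OF j] y(2) z(2) j unfolding S[of j ?x, symmetric] by (simp add: subset_sum_def)
    qed
  next
    assume "ilp_feasible n m M r"
    then obtain x where x: "\<forall>i<n. x i \<in> {0, 1::real}" "\<forall>j<m. r j \<le> (\<Sum>i<n. M i j * x i)"
      unfolding ilp_feasible_def by blast
    have "\<forall>t<n1. x t \<in> {0, 1}" using x(1) n1 by simp
    then obtain a where a: "a \<in> set A" "\<forall>j<m. g (a + j) = subset_sum r (- 1) M n1 x j"
      using A unfolding lists_sums_def by blast
    have "\<forall>t<n - n1. x (n1 + t) \<in> {0, 1}" using x(1) n1 by simp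
    then obtain b where b: "b \<in> set B" "\<forall>j<m. g (b + j) = subset_sum (\<lambda>_. 0) 1 (\<lambda>i. M (n1 + i)) (n - n1) (\<lambda>t. x (n1 + t)) j"
      using B[unfolded lists_sums_def, THEN conjunct2, THEN spec[of _ "\<lambda>t. x (n1 + t)"]] by blast
    have "dom m g a b"
      unfolding dom_def
    proof (intro allI impI)
      fix j assume j: "j < m"
      have "r j \<le> (\<Sum>i<n. M i j * x i)" using x(2) j by simp
      then show "g (a + j) \<le> g (b + j)"
        using a(2) b(2) j unfolding S[symmetric] by (simp add: subset_sum_def)
    qed
    then show "has_dom m g (A, B, j, l)" using a b by auto
  qed
qed

definition ilp_program :: com where
  "ilp_program = Seq Parameters (Seq Setup Search)"

text \<open>The parameters remain existential with their defining inequalities, which separates the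
  program from the estimates. The weight \<open>Y = 3 + 60 (q + 1)\<close> belongs to the analysis
  only.\<close>

lemma ilp_program_correct:
  assumes nm: "n = 0 \<Longrightarrow> m = 0"
  shows "\<exists>t \<tau> n1 q L d. exec ilp_program (ilp_input n m M r) t \<tau> \<and>
    fst \<tau> 0 = (if ilp_feasible n m M r then 1 else 0) \<and>
    is_divup n1 n 3 \<and> is_divup q m n \<and> is_divup L n (100 * (q + 1)) \<and> is_divup d (64 * m) L \<and>
    real t \<le> 20000 * real (n + m + 1) + real ((n + 1) * ((2 ^ n1 + 2 ^ (n - n1)) * ((m + 1) * 500))) +
      5000 * (width m (2 ^ n1) (2 ^ (n - n1)) * tree_size (3 + 60 * real (q + 1)) L m +
        real (m + 1) * (real (2 ^ n1) * real (2 ^ (n - n1))) * leaf_mass (d + 4) L m) + 6"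
proof -
  obtain f g where fg: "ilp_input n m M r = (f, g)" by (cases "ilp_input n m M r")
  have f: "f 0 = n" "f 1 = m" and g: "g = snd (ilp_input n m M r)"
    using fg by (auto simp: ilp_input_def)
  have "wp ilp_program (f, g) (\<lambda>t \<tau>. \<exists>n1 q L d.
    fst \<tau> 0 = (if ilp_feasible n m M r then 1 else 0) \<and>
    is_divup n1 n 3 \<and> is_divup q m n \<and> is_divup L n (100 * (q + 1)) \<and> is_divup d (64 * m) L \<and>
    real t \<le> 20000 * real (n + m + 1) + real ((n + 1) * ((2 ^ n1 + 2 ^ (n - n1)) * ((m + 1) * 500))) +
      5000 * (width m (2 ^ n1) (2 ^ (n - n1)) * tree_size (3 + 60 * real (q + 1)) L m +
        real (m + 1) * (real (2 ^ n1) * real (2 ^ (n - n1))) * leaf_mass (d + 4) L m) + 6)"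
    unfolding ilp_program_def wp_Seq
  proof (rule wp_Parameters[OF f nm], goal_cases)
    case (2 t1 h q d)
    define n1 where "n1 = h 10"
    define L where "L = h 4"
    have n1: "n1 \<le> n" using 2(6) by (auto simp: is_divup_def n1_def)
    show ?case
    proof (rule wp_Setup[OF 2(2,3,4,5) n1_def[symmetric] L_def[symmetric] 2(10) n1 g], goal_cases)
      case (1 t2 h2 g2 A B)
      have dom: "has_dom m g2 (A, B, 0, L) \<longleftrightarrow> ilp_feasible n m M r"
        by (rule sums_dominate[OF n1 1(10,11)])
      have "wp Search (h2, g2) (\<lambda>t \<tau>. real t \<le>
          pot m (d + 4) (3 + 60 * real (q + 1)) (width m (2 ^ n1) (2 ^ (n - n1))) (A, B, 0, L) + 6 \<and>
          fst \<tau> 0 = (if has_dom m g2 (A, B, 0, L) then 1 else 0))"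
        by (rule wp_Search) (use 1 in \<open>simp_all add: dom_def\<close>)
      then show ?case
      proof (rule wp_mono)
        fix t3 :: nat and \<tau> :: ram_state
        assume *: "real t3 \<le>
          pot m (d + 4) (3 + 60 * real (q + 1)) (width m (2 ^ n1) (2 ^ (n - n1))) (A, B, 0, L) + 6 \<and>
          fst \<tau> 0 = (if has_dom m g2 (A, B, 0, L) then 1 else 0)"
        have "real t1 \<le> real (20000 * (n + m + 1))" using 2(1) of_nat_le_iff by blast
        then have t1: "real t1 \<le> 20000 * real (n + m + 1)" by simp
        have t2: "real t2 \<le> real ((n + 1) * ((2 ^ n1 + 2 ^ (n - n1)) * ((m + 1) * 500)))"
          using 1(1) of_nat_le_iff by blast
        have "pot m (d + 4) (3 + 60 * real (q + 1)) (width m (2 ^ n1) (2 ^ (n - n1))) (A, B, 0, L) =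
         5000 * (width m (2 ^ n1) (2 ^ (n - n1)) * tree_size (3 + 60 * real (q + 1)) L m +
        real (m + 1) * (real (2 ^ n1) * real (2 ^ (n - n1))) * leaf_mass (d + 4) L m)"
          by (simp only: pot.simps 1(2,3) diff_zero)
        then have "real (t1 + (t2 + t3)) \<le> 20000 * real (n + m + 1) + real ((n + 1) * ((2 ^ n1 + 2 ^ (n - n1)) * ((m + 1) * 500))) +
      5000 * (width m (2 ^ n1) (2 ^ (n - n1)) * tree_size (3 + 60 * real (q + 1)) L m +
        real (m + 1) * (real (2 ^ n1) * real (2 ^ (n - n1))) * leaf_mass (d + 4) L m) + 6"
          unfolding of_nat_add[of t1] of_nat_add[of t2] using * t1 t2 by linarith
        moreover have "fst \<tau> 0 = (if ilp_feasible n m M r then 1 else 0)" using * dom by simp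
        ultimately show "\<exists>n1 q L d.
    fst \<tau> 0 = (if ilp_feasible n m M r then 1 else 0) \<and>
    is_divup n1 n 3 \<and> is_divup q m n \<and> is_divup L n (100 * (q + 1)) \<and> is_divup d (64 * m) L \<and>
    real (t1 + (t2 + t3)) \<le> 20000 * real (n + m + 1) + real ((n + 1) * ((2 ^ n1 + 2 ^ (n - n1)) * ((m + 1) * 500))) +
      5000 * (width m (2 ^ n1) (2 ^ (n - n1)) * tree_size (3 + 60 * real (q + 1)) L m +
        real (m + 1) * (real (2 ^ n1) * real (2 ^ (n - n1))) * leaf_mass (d + 4) L m) + 6"
          using 2(6-9) unfolding n1_def[symmetric] L_def[symmetric] by blast
      qed
    qed
  qed simp
  then show ?thesis unfolding wp_def fg by blast
qed

section \<open>Running time\<close>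

text \<open>Write \<open>E = d + 4\<close>. The two factors are at most
  \<open>exp (- 1/(4E))\<close> per unit of budget and \<open>exp (4/E^2)\<close> per coordinate.
  Since \<open>64 m <= E L\<close>, the coordinates lose at most \<open>L/(16E)\<close> of the gain
  \<open>L/(4E)\<close>, so more than \<open>L/(8E)\<close> remains when
  \<open>L > 0\<close>.\<close>

lemma leaf_mass_bound:
  assumes "64 * m \<le> d * L"
  shows "leaf_mass (d + 4) L m \<le> exp (- (real L / (8 * real (d + 4))))"
proof -
  define E where "E = real (d + 4)"
  have E: "4 \<le> E" by (simp add: E_def)
  define t where "t = 1 / (2 * E)"
  define v where "v = 2 / E\<^sup>2"
  have t: "0 \<le> t" "t \<le> 1" using E by (auto simp: t_def)
  have "4 * 4 \<le> E * E" using E by (intro mult_mono) auto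
  then have v: "0 \<le> v" "v \<le> 1 / 2" using E by (auto simp: v_def power2_eq_square divide_le_eq)
  have "exp (t / 2) \<le> 1 + t / 2 + (t / 2)\<^sup>2" by (rule exp_bound) (use t in auto)
  also have "\<dots> \<le> 1 + t" using t mult_left_le[of t t] by (simp add: power2_eq_square)
  finally have "1 / (1 + t) \<le> 1 / exp (t / 2)" by (intro divide_left_mono) (use t in auto)
  then have 1: "1 / (1 + t) \<le> exp (- (t / 2))" by (simp add: exp_minus inverse_eq_divide)
  have "1 \<le> (1 - v) * (1 + 2 * v)"
  proof -
    have "v * v \<le> v * (1 / 2)" using v by (intro mult_left_mono) auto
    then show ?thesis by (simp add: algebra_simps)
  qed
  then have "1 / (1 - v) \<le> 1 + 2 * v" using v by (simp add: divide_le_eq mult.commute)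
  also have "\<dots> \<le> exp (2 * v)" using v by (intro exp_ge_add_one_self_aux) auto
  finally have 2: "1 / (1 - v) \<le> exp (2 * v)" .
  have "leaf_mass (d + 4) L m = (1 / (1 + t)) ^ L * (1 / (1 - v)) ^ m"
    by (simp only: leaf_mass_def E_def t_def v_def)
  also have "\<dots> \<le> exp (- (t / 2)) ^ L * exp (2 * v) ^ m"
    using 1 2 t v by (intro mult_mono power_mono) auto
  also have "\<dots> = exp (- (real L * (t / 2)) + real m * (2 * v))"
    by (simp add: mult_exp_exp exp_of_nat_mult[symmetric])
  also have "- (real L * (t / 2)) + real m * (2 * v) \<le> - (real L / (8 * E))"
  proof -
    have "real (64 * m) \<le> real (d * L)" using assms of_nat_le_iff by blast
    also have "\<dots> \<le> E * real L" unfolding E_def by (simp add: mult_right_mono)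
    finally have "64 * real m / (16 * E\<^sup>2) \<le> E * real L / (16 * E\<^sup>2)" by (intro divide_right_mono) auto
    then have "real m * (2 * v) \<le> real L / (16 * E)"
      using E by (simp add: v_def power2_eq_square)
    moreover have "real L * (t / 2) = real L / (4 * E)" by (simp add: t_def)
    moreover have "real L / (16 * E) - real L / (4 * E) \<le> - (real L / (8 * E))"
      using E by (simp add: field_simps)
    ultimately show ?thesis by linarith
  qed
  finally show ?thesis by (simp add: E_def)
qed

text \<open>With \<open>p = q + 1\<close>, \<open>Y\<close> is at most \<open>2^(7p)\<close> and
  \<open>L\<close> at most \<open>n/(100p) + 1\<close>, so \<open>Y^L\<close> contributes
  \<open>7n/100\<close> to the exponent besides the constant \<open>7p\<close>. As
  \<open>Y/(Y - 3) = 1 + 1/(20p)\<close> and \<open>m <= p n\<close>, the coordinates contribute at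
  most \<open>exp (n/20)\<close>, which adds \<open>n/10\<close>.\<close>

lemma tree_size_bound:
  assumes m: "m \<le> q * n" and L: "100 * (q + 1) * L \<le> n + 100 * (q + 1)"
  shows "tree_size (3 + 60 * real (q + 1)) L m \<le> 2 * 2 powr (7 * real (q + 1)) * 2 powr (17 / 100 * real n)"
proof -
  define p where "p = q + 1"
  let ?Y = "3 + 60 * real p"
  have p: "1 \<le> real p" by (simp add: p_def)
  have "real p \<le> 2 ^ p" by (simp add: less_imp_le)
  moreover have "?Y \<le> 64 * real p" using p by simp
  ultimately have "?Y \<le> 64 * 2 ^ p" by linarith
  also have "\<dots> = 2 powr (6 + real p)" by (simp add: powr_add powr_realpow)
  also have "\<dots> \<le> 2 powr (7 * real p)" using p by simp
  finally have "?Y ^ L \<le> (2 powr (7 * real p)) ^ L" by (intro power_mono) auto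
  also have "\<dots> = 2 powr (7 * real p * real L)" by (simp add: powr_powr flip: powr_realpow)
  also have "\<dots> \<le> 2 powr (7 * real p + 7 / 100 * real n)"
  proof -
    have "real (100 * p * L) \<le> real (n + 100 * p)" using L of_nat_le_iff unfolding p_def by blast
    then show ?thesis by simp
  qed
  finally have 1: "?Y ^ L \<le> 2 powr (7 * real p) * 2 powr (7 / 100 * real n)" by (simp add: powr_add)
  have "?Y / (?Y - 3) = 1 + 1 / (20 * real p)" using p by (simp add: field_simps)
  then have "(?Y / (?Y - 3)) ^ m = (1 + 1 / (20 * real p)) ^ m" by (simp only:)
  also have "\<dots> \<le> exp (1 / (20 * real p)) ^ m" using p by (intro power_mono exp_ge_add_one_self) auto
  also have "\<dots> = exp (real m / (20 * real p))" by (simp add: exp_of_nat_mult[symmetric])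
  also have "\<dots> \<le> exp (real n / 20)"
  proof -
    have "m \<le> p * n" using m by (simp add: p_def)
    then have "real m \<le> real p * real n" by (metis of_nat_le_iff of_nat_mult)
    then show ?thesis using p by (simp add: divide_le_eq algebra_simps)
  qed
  also have "\<dots> = exp 1 powr (real n / 20)" by (simp add: powr_def)
  \<comment> \<open>The base of the exponential is at most 3, hence at most 4.\<close>
  also have "\<dots> \<le> (2 powr 2) powr (real n / 20)" using exp_le by (intro powr_mono2) auto
  also have "\<dots> = 2 powr (1 / 10 * real n)" by (simp only: powr_powr) simp
  finally have "(?Y / (?Y - 3)) ^ m \<le> 2 powr (1 / 10 * real n)" .
  with 1 have "?Y ^ L * (?Y / (?Y - 3)) ^ m \<le> 2 powr (7 * real p) * 2 powr (7 / 100 * real n) * 2 powr (1 / 10 * real n)"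
    by (intro mult_mono) auto
  also have "\<dots> = 2 powr (7 * real p) * 2 powr (17 / 100 * real n)"
    by (simp add: powr_add[symmetric] algebra_simps)
  finally show ?thesis unfolding tree_size_def p_def by simp
qed

text \<open>Since \<open>m\<close> is at most \<open>q n\<close> and \<open>n\<close> at most
  \<open>100 p L\<close>, the quotient \<open>64 m / L\<close> is at most \<open>6400 p^2\<close>.
  So \<open>e\<close> is of order \<open>p^2\<close>, \<open>L\<close> of order \<open>n/p\<close>,
  and the saving of order \<open>n/p^3\<close>.\<close>

lemma leaf_exponent:
  assumes q: "m \<le> q * n" and L: "n \<le> L * (100 * (q + 1))"
    and d: "is_divup d (64 * m) L" and Q: "real (q + 1) \<le> Q"
  shows "real n / (10000000 * Q ^ 3) \<le> real L / (8 * real (d + 4))"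
proof (cases "L = 0")
  case True
  then show ?thesis using L by simp
next
  case False
  define p where "p = q + 1"
  have p: "1 \<le> p" by (simp add: p_def)
  have "d \<le> 6401 * (p * p)"
  proof (cases "d = 0")
    case False
    then have "d * L < 64 * m + L" using d by (simp add: is_divup_def)
    also have "64 * m \<le> 64 * (q * (L * (100 * p)))"
      using q L mult_le_mono2[OF L, of q] unfolding p_def by linarith
    also have "\<dots> \<le> 64 * (p * (L * (100 * p)))"
      by (intro mult_le_mono) (auto simp: p_def)
    finally have "d * L < (6400 * (p * p) + 1) * L" by (simp add: algebra_simps)
    then have "d < 6400 * (p * p) + 1" using mult_less_cancel2 by blast
    then show ?thesis by simp
  qed simp
  moreover have "1 \<le> p * p" using p by (metis mult_le_mono nat_mult_1)
  ultimately have "d + 4 \<le> 6405 * (p * p)" by linarith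
  then have "real (d + 4) \<le> real (6405 * (p * p))" using of_nat_le_iff by blast
  then have E: "real (d + 4) \<le> 6405 * (real p * real p)" by simp
  have "real n \<le> real (L * (100 * p))" using L of_nat_le_iff unfolding p_def by blast
  then have n: "real n \<le> real L * (100 * real p)" by simp
  have Qp: "real p ^ 3 \<le> Q ^ 3" using Q p by (intro power_mono) (auto simp: p_def)
  have "0 < Q" using Q by linarith
  \<comment> \<open>The denominator 5124000 is 100 * 8 * 6405, rounded up to 10000000.\<close>
  then have "real n / (10000000 * Q ^ 3) \<le> real n / (5124000 * real p ^ 3)"
    using Qp p by (intro divide_left_mono mult_mono mult_pos_pos) (auto intro: less_le_trans[of _ "real p ^ 3"])
  also have "\<dots> \<le> real L * (100 * real p) / (5124000 * real p ^ 3)"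
    using n by (intro divide_right_mono) auto
  also have "\<dots> = real L / (8 * (6405 * (real p * real p)))"
    using p by (simp add: field_simps power3_eq_cube)
  also have "\<dots> \<le> real L / (8 * real (d + 4))"
    using E p by (intro divide_left_mono mult_left_mono mult_pos_pos) auto
  finally show ?thesis .
qed

lemma exp_le_two_powr:
  fixes x :: real
  assumes x: "0 \<le> x"
  shows "exp (- x) \<le> 2 powr (- x)"
proof -
  have "(2::real) powr x \<le> exp 1 powr x"
    using exp_ge_add_one_self[of 1] x by (intro powr_mono2) auto
  then have "2 powr x \<le> exp x" by (simp add: powr_def)
  then show ?thesis by (simp add: powr_minus exp_minus le_imp_inverse_le)
qed

text \<open>Building the lists takes about \<open>2^(2n/3)\<close>, work at the nodes that times
  \<open>2^(17n/100)\<close>, and brute force \<open>2^((1 - \<eta>) n)\<close>, up to constants and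
  polynomial factors. The last term dominates.\<close>

lemma total_time_bound:
  assumes n1: "is_divup n1 n 3" and q: "is_divup q m n" and L: "is_divup L n (100 * (q + 1))"
    and d: "is_divup d (64 * m) L" and Q: "real (q + 1) \<le> Q" "1 \<le> Q"
  shows "20000 * real (n + m + 1) + real ((n + 1) * ((2 ^ n1 + 2 ^ (n - n1)) * ((m + 1) * 500))) +
      5000 * (width m (2 ^ n1) (2 ^ (n - n1)) * tree_size (3 + 60 * real (q + 1)) L m +
        real (m + 1) * (real (2 ^ n1) * real (2 ^ (n - n1))) * leaf_mass (d + 4) L m) + 6
    \<le> 220000 * 2 powr (7 * Q) * (real (n + 1) * real (m + 1)) * 2 powr ((1 - 1 / (10000000 * Q ^ 3)) * real n)"
proof -
  define \<eta> where "\<eta> = 1 / (10000000 * Q ^ 3)"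
  define X where "X = 2 powr (2 / 3 * real n)"
  define Z where "Z = 2 powr ((1 - \<eta>) * real n)"
  define P where "P = 2 powr (7 * Q)"
  define K where "K = real (n + 1) * real (m + 1)"
  have "1 \<le> Q ^ 3" using Q by (intro one_le_power) auto
  then have "10 \<le> 10000000 * Q ^ 3" by linarith
  \<comment> \<open>The bound 1/10 suffices for \<open>2/3 + 17/100 <= 1 - \<eta>\<close>.\<close>
  then have \<eta>: "0 \<le> \<eta>" "\<eta> \<le> 1 / 10"
    unfolding \<eta>_def using Q by (simp, intro divide_left_mono) auto
  have n1': "3 * n1 \<le> n + 2" "n \<le> 3 * n1" using n1 by (auto simp: is_divup_def)
  have n1n: "n1 \<le> n" using n1' by linarith
  have X1: "1 \<le> X" by (simp add: X_def ge_one_powr_ge_zero)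
  have P1: "1 \<le> P" using Q by (simp add: P_def ge_one_powr_ge_zero)
  have "X * 2 powr (17 / 100 * real n) = 2 powr ((2 / 3 + 17 / 100) * real n)"
    by (simp add: X_def distrib_right flip: powr_add)
  also have "\<dots> \<le> Z" unfolding Z_def using \<eta> by (intro powr_mono mult_right_mono) auto
  finally have XZ: "X * 2 powr (17 / 100 * real n) \<le> Z" .
  have "X * 1 \<le> X * 2 powr (17 / 100 * real n)" using X1
    by (intro mult_left_mono) (auto simp: ge_one_powr_ge_zero)
  then have XZ': "X \<le> Z" using XZ by linarith
  have K1: "1 \<le> K" "real (n + m + 1) \<le> K" "real (m + 1) \<le> K" by (simp_all add: K_def algebra_simps)
  have sq: "(2 ^ n1)\<^sup>2 \<le> 4 * X"
  proof -
    have "((2::real) ^ n1)\<^sup>2 = 2 powr (2 * real n1)"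
      by (simp add: powr_realpow[symmetric] power2_eq_square powr_add[symmetric])
    \<comment> \<open>Rounding up gives \<open>2 n1 <= 2n/3 + 4/3\<close>, which costs at most the
      factor 4.\<close>
    also have "\<dots> \<le> 2 powr (2 + 2 / 3 * real n)" using n1'(1) by (intro powr_mono) linarith+
    also have "\<dots> = 4 * X" by (simp add: X_def powr_add)
    finally show ?thesis .
  qed
  have one: "1 \<le> (2::real) ^ n1" by simp
  then have a: "2 ^ n1 \<le> 4 * X" using sq self_le_power[of "2 ^ n1 :: real" 2] by linarith
  have b: "2 ^ (n - n1) \<le> X"
  proof -
    have "(2::real) ^ (n - n1) = 2 powr (real n - real n1)" using n1n by (simp add: powr_realpow[symmetric] of_nat_diff)
    also have "\<dots> \<le> X" unfolding X_def using n1'(2) by (intro powr_mono) linarith+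
    finally show ?thesis .
  qed
  have "((2::real) ^ n1 + 1)\<^sup>2 \<le> (2 * 2 ^ n1)\<^sup>2" using one by (intro power_mono) auto
  then have "((2::real) ^ n1 + 1)\<^sup>2 \<le> 16 * X" using sq by (simp add: power_mult_distrib)
  then have "((2::real) ^ n1 + 1)\<^sup>2 + 2 ^ (n - n1) + 1 \<le> 18 * X" using b X1 by linarith
  then have w: "width m (2 ^ n1) (2 ^ (n - n1)) \<le> 18 * X * real (m + 1)"
    unfolding width_def of_nat_mult by (intro mult_right_mono) (auto simp: ac_simps)
  have mq: "m \<le> q * n" using q by (simp add: is_divup_def)
  have "L * (100 * (q + 1)) \<le> n + 100 * (q + 1)" using L by (auto simp: is_divup_def)
  then have "tree_size (3 + 60 * real (q + 1)) L m \<le> 2 * 2 powr (7 * real (q + 1)) * 2 powr (17 / 100 * real n)"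
    using mq by (intro tree_size_bound) (simp_all only: mult.commute)
  also have "\<dots> \<le> 2 * P * 2 powr (17 / 100 * real n)"
    unfolding P_def using Q by (intro mult_right_mono mult_left_mono powr_mono) auto
  finally have ts: "tree_size (3 + 60 * real (q + 1)) L m \<le> 2 * P * 2 powr (17 / 100 * real n)" .
  have "width m (2 ^ n1) (2 ^ (n - n1)) * tree_size (3 + 60 * real (q + 1)) L m
      \<le> (18 * X * real (m + 1)) * (2 * P * 2 powr (17 / 100 * real n))"
    using w ts X1 tree_size_ge_1[of "3 + 60 * real (q + 1)" L m]
    by (intro mult_mono) (auto intro: mult_nonneg_nonneg)
  also have "\<dots> = 36 * P * (real (m + 1) * (X * 2 powr (17 / 100 * real n)))" by (simp add: algebra_simps)
  also have "\<dots> \<le> 36 * P * (K * Z)"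
    using P1 XZ K1 X1 by (intro mult_left_mono mult_mono) auto
  finally have A: "width m (2 ^ n1) (2 ^ (n - n1)) * tree_size (3 + 60 * real (q + 1)) L m \<le> 36 * P * (K * Z)" .
  have "leaf_mass (d + 4) L m \<le> exp (- (real L / (8 * real (d + 4))))"
    by (rule leaf_mass_bound) (use d in \<open>simp add: is_divup_def\<close>)
  also have "\<dots> \<le> exp (- (\<eta> * real n))"
    using leaf_exponent[OF mq _ d Q(1)] L by (simp add: is_divup_def \<eta>_def)
  also have "\<dots> \<le> 2 powr (- (\<eta> * real n))" using \<eta> by (intro exp_le_two_powr) auto
  finally have lm: "leaf_mass (d + 4) L m \<le> 2 powr (- (\<eta> * real n))" .
  have "real (2 ^ n1) * real (2 ^ (n - n1)) = 2 powr real n"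
    using n1n by (simp add: powr_realpow flip: power_add)
  then have "real (m + 1) * (real (2 ^ n1) * real (2 ^ (n - n1))) * leaf_mass (d + 4) L m
    \<le> real (m + 1) * 2 powr real n * 2 powr (- (\<eta> * real n))"
    using lm by (simp only:) (intro mult_left_mono, auto)
  also have "\<dots> = real (m + 1) * Z"
    by (simp add: Z_def left_diff_distrib flip: powr_add)
  also have "\<dots> \<le> K * Z" using K1 by (intro mult_right_mono) (auto simp: Z_def)
  finally have B: "real (m + 1) * (real (2 ^ n1) * real (2 ^ (n - n1))) * leaf_mass (d + 4) L m \<le> K * Z" .
  have "real ((n + 1) * ((2 ^ n1 + 2 ^ (n - n1)) * ((m + 1) * 500))) = 500 * (K * (2 ^ n1 + 2 ^ (n - n1)))"
    by (simp add: K_def algebra_simps)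
  also have "\<dots> \<le> 500 * (K * (5 * Z))"
    using a b XZ' K1 by (intro mult_left_mono) auto
  finally have C: "real ((n + 1) * ((2 ^ n1 + 2 ^ (n - n1)) * ((m + 1) * 500))) \<le> 2500 * (K * Z)" by simp
  have KZ: "K * 1 \<le> K * Z" using K1 X1 XZ' by (intro mult_left_mono) auto
  have "1 * (K * Z) \<le> P * (K * Z)" using P1 K1 X1 XZ' by (intro mult_right_mono) auto
  \<comment> \<open>The coefficients add up to 20000 + 2500 + 5000 * 37 + 6 = 207506.\<close>
  moreover have "20000 * x + 2500 * w + 5000 * (36 * v + w) + 6 \<le> 220000 * v"
    if "1 * w \<le> v" "x \<le> k" "k * 1 \<le> w" "1 \<le> k" for x w v k :: real
    using that by simp
  ultimately have "20000 * real (n + m + 1) + 2500 * (K * Z) + 5000 * (36 * (P * (K * Z)) + K * Z) + 6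
      \<le> 220000 * (P * (K * Z))"
    using K1(1,2) KZ by blast
  moreover have "x + c' + 5000 * (a' + b') + 6 \<le> y"
    if "x + c + 5000 * (a + b) + 6 \<le> y" "a' \<le> a" "b' \<le> b" "c' \<le> c" for a b c a' b' c' x y :: real
    using that by simp
  ultimately have "20000 * real (n + m + 1) + real ((n + 1) * ((2 ^ n1 + 2 ^ (n - n1)) * ((m + 1) * 500))) +
      5000 * (width m (2 ^ n1) (2 ^ (n - n1)) * tree_size (3 + 60 * real (q + 1)) L m +
        real (m + 1) * (real (2 ^ n1) * real (2 ^ (n - n1))) * leaf_mass (d + 4) L m) + 6 \<le> 220000 * (P * (K * Z))"
    using A[unfolded mult.assoc[of 36]] B C by blast
  then show ?thesis by (simp only: P_def K_def Z_def \<eta>_def mult.assoc)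
qed

text \<open>Used to absorb polynomial factors into a small part of the exponential saving. It
  combines \<open>1 + y <= exp y\<close> with \<open>ln 2 >= 1/2\<close>.\<close>

lemma linear_le_powr:
  assumes "0 < \<epsilon>" "\<epsilon> \<le> 2"
  shows "real n + 1 \<le> 2 / \<epsilon> * 2 powr (\<epsilon> * real n)"
proof -
  have "1 + \<epsilon> * real n * ln 2 \<le> exp (\<epsilon> * real n * ln 2)" by (rule exp_ge_add_one_self)
  moreover have "\<epsilon> * real n * (1 / 2) \<le> \<epsilon> * real n * ln 2"
  proof (intro mult_left_mono)
    have "exp (1 / 2 :: real) \<le> 1 + 1 / 2 + (1 / 2)\<^sup>2" by (rule exp_bound) auto
    then have "exp (1 / 2 :: real) \<le> 2" by (simp add: power2_eq_square)
    then show "1 / 2 \<le> ln (2 :: real)" by (subst ln_ge_iff) auto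
  qed (use assms in auto)
  moreover have "2 powr (\<epsilon> * real n) = exp (\<epsilon> * real n * ln 2)" by (simp add: powr_def)
  ultimately have "1 + \<epsilon> * real n / 2 \<le> 2 powr (\<epsilon> * real n)" by linarith
  then have "2 / \<epsilon> * (1 + \<epsilon> * real n / 2) \<le> 2 / \<epsilon> * 2 powr (\<epsilon> * real n)"
    using assms by (intro mult_left_mono) auto
  moreover have "real n + 1 \<le> 2 / \<epsilon> * (1 + \<epsilon> * real n / 2)" using assms by (simp add: field_simps)
  ultimately show ?thesis by linarith
qed

theorem theorem1p1:
  "\<exists>(p :: com) (s :: real \<Rightarrow> real).
     (\<forall>c>0. 0 < s c \<and> s c < 1) \<and>
     (\<exists>\<delta>>0. \<exists>K>0. \<forall>c\<ge>1. s c \<ge> \<delta> * c powr (- K)) \<and>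
     (\<forall>c>0. \<exists>C>0. \<forall>(n :: nat) (m :: nat) (M :: nat \<Rightarrow> nat \<Rightarrow> real) (r :: nat \<Rightarrow> real).
        real m = c * real n \<longrightarrow>
        decides_ilp_within p n m M r (C * 2 powr ((1 - s c) * real n)))"
proof -
  \<comment> \<open>Half of the saving \<open>1 / (10000000 Q^3)\<close> for
    \<open>Q = c + 2\<close>; the other half absorbs the factor
    \<open>(n + 1) (m + 1)\<close>.\<close>
  define s :: "real \<Rightarrow> real" where "s = (\<lambda>c. 1 / (20000000 * (c + 2) ^ 3))"
  have s: "0 < s c \<and> s c < 1" if "0 < c" for c
  proof -
    have "1 \<le> (c + 2) ^ 3" using that by (intro one_le_power) auto
    then have "1 < 20000000 * (c + 2) ^ 3" by linarith
    then show ?thesis using that by (simp add: s_def)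
  qed
  \<comment> \<open>For \<open>c >= 1\<close>, \<open>c + 2 <= 3 c\<close>, and 540000000 is 27 *
    20000000.\<close>
  have poly: "1 / 540000000 * c powr (- 3) \<le> s c" if c: "1 \<le> c" for c
  proof -
    have "(c + 2) ^ 3 \<le> (3 * c) ^ 3" using c by (intro power_mono) auto
    then have "20000000 * (c + 2) ^ 3 \<le> 540000000 * c ^ 3" by (simp add: power_mult_distrib)
    then have "1 / (540000000 * c ^ 3) \<le> s c"
      unfolding s_def using c by (intro divide_left_mono) auto
    moreover have "c powr (- 3) = 1 / c ^ 3"
      using c by (simp add: powr_minus powr_realpow[of c 3, simplified] inverse_eq_divide)
    ultimately show ?thesis by simp
  qed
  have time: "\<exists>C>0. \<forall>n m M r. real m = c * real n \<longrightarrow>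
      decides_ilp_within ilp_program n m M r (C * 2 powr ((1 - s c) * real n))" if c: "0 < c" for c
  proof -
    define Q where "Q = c + 2"
    define C where "C = 220000 * 2 powr (7 * Q) * (1 + c) * (4 / s c)\<^sup>2"
    have "0 < C" using c s[OF c] by (simp add: C_def)
    moreover have "decides_ilp_within ilp_program n m M r (C * 2 powr ((1 - s c) * real n))"
      if m: "real m = c * real n" for n m M r
    proof -
      have nm: "m = 0" if "n = 0" using m that by simp
      obtain t \<tau> n1 q L d where ex: "exec ilp_program (ilp_input n m M r) t \<tau>"
        "fst \<tau> 0 = (if ilp_feasible n m M r then 1 else 0)"
        and par: "is_divup n1 n 3" "is_divup q m n" "is_divup L n (100 * (q + 1))" "is_divup d (64 * m) L"
        and t: "real t \<le> 20000 * real (n + m + 1) + real ((n + 1) * ((2 ^ n1 + 2 ^ (n - n1)) * ((m + 1) * 500))) +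
          5000 * (width m (2 ^ n1) (2 ^ (n - n1)) * tree_size (3 + 60 * real (q + 1)) L m +
          real (m + 1) * (real (2 ^ n1) * real (2 ^ (n - n1))) * leaf_mass (d + 4) L m) + 6"
        using ilp_program_correct[where n = n and m = m and M = M and r = r, OF nm] by blast
      \<comment> \<open>Rounding up \<open>m/n = c\<close> adds at most 1, so
        \<open>q + 1 <= c + 2 = Q\<close>.\<close>
      have "real q \<le> c + 1"
      proof (cases "q = 0")
        case False
        then have *: "q * n < m + n" using par(2) by (simp add: is_divup_def)
        then have n: "0 < real n" using nm by (cases n) auto
        from * have "real (q * n) < real (m + n)" by (simp only: of_nat_less_iff)
        then have "real q * real n < (c + 1) * real n" using m by (simp add: distrib_right)
        then show ?thesis using n by simp
      qed (use c in simp)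
      then have Q: "real (q + 1) \<le> Q" "1 \<le> Q" using c by (simp_all add: Q_def)
      have "real t \<le> 220000 * 2 powr (7 * Q) * (real (n + 1) * real (m + 1)) *
          2 powr ((1 - 1 / (10000000 * Q ^ 3)) * real n)"
        using t total_time_bound[OF par Q] by linarith
      also have "1 / (10000000 * Q ^ 3) = 2 * s c" by (simp add: s_def Q_def)
      also have "real (n + 1) * real (m + 1) \<le> (1 + c) * ((4 / s c)\<^sup>2 * 2 powr (s c * real n))"
      proof -
        have "real (m + 1) \<le> (1 + c) * real (n + 1)" using m c by (simp add: algebra_simps)
        then have "real (n + 1) * real (m + 1) \<le> real (n + 1) * ((1 + c) * real (n + 1))"
          by (intro mult_left_mono) auto
        also have "\<dots> = (1 + c) * (real n + 1)\<^sup>2" by (simp add: power2_eq_square algebra_simps)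
        \<comment> \<open>Exponent \<open>s c / 2\<close> for each of the two linear factors,
          together \<open>s c\<close>.\<close>
        also have "(real n + 1)\<^sup>2 \<le> (2 / (s c / 2) * 2 powr (s c / 2 * real n))\<^sup>2"
          using s[OF c] by (intro power_mono linear_le_powr) auto
        also have "\<dots> = (4 / s c)\<^sup>2 * 2 powr (s c * real n)"
          by (simp add: power_mult_distrib power2_eq_square mult.commute flip: powr_add)
        finally show ?thesis using c by simp
      qed
      finally have "real t \<le> 220000 * 2 powr (7 * Q) * ((1 + c) * ((4 / s c)\<^sup>2 * 2 powr (s c * real n))) *
          2 powr ((1 - 2 * s c) * real n)" by simp
      also have "\<dots> = C * (2 powr (s c * real n) * 2 powr ((1 - 2 * s c) * real n))"
        by (simp only: C_def mult_ac)
      also have "2 powr (s c * real n) * 2 powr ((1 - 2 * s c) * real n) = 2 powr ((1 - s c) * real n)"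
        by (simp add: algebra_simps flip: powr_add)
      finally show ?thesis unfolding decides_ilp_within_def using ex by blast
    qed
    ultimately show ?thesis by blast
  qed
  show ?thesis
  proof (intro exI[of _ ilp_program] exI[of _ s] conjI)
    show "\<exists>\<delta>>0. \<exists>K>0. \<forall>c\<ge>1. \<delta> * c powr (- K) \<le> s c"
      by (intro exI[of _ "1 / 540000000"] exI[of _ 3] conjI) (use poly in auto)
  qed (use s time in blast)+
qed
end
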